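(* Let $(H,K)$ be a strong Shoda pair of a finite group $G$, let $N=N_G(K)$, and suppose that $\tau(gH,g'H)=1$ for all $g,g'\in N$, where $\tau$ is the twisting described in the context. Let $\varepsilon=\varepsilon(H,K)$, $e=e(G,H,K)$, $n=[N:H]$, and let $F$ be the fixed subfield of $\mathbb{Q}H\varepsilon$ under the natural action of $N/H$. Let $w$ be a normal element of $\mathbb{Q}H\varepsilon/F$, $B$ the normal basis determined by $w$, $\psi:\mathbb{Q}N\varepsilon\to M_n(F)$ the isomorphism with respect to $B$ described in the context, and $x_e=\psi^{-1}(PAP^{-1})$ with $P,A\in M_n(F)$ the matrices described in the context. Let $T_1$ be a transversal of $H$ in $N$, $\widehat{T_1}=\frac1{|T_1|}\sum_{t\in T_1}t\in\mathbb{Q}G$, and let $T_2$ be a right transversal of $N$ in $G$. For every $x,x'\in T_2\langle x_e\rangle$, let $$E_{xx'}=x\widehat{T_1}\varepsilon x'^{-1}.$$ Then $\{E_{xx'}\mid x,x'\in T_2\langle x_e\rangle\}$ is a complete set of matrix units in $\mathbb{Q}Ge$, i.e. $e=\sum_{x\in T_2\langle x_e\rangle}E_{xx}$ and $E_{xy}E_{zw}=\delta_{yz}E_{xw}$ for every $x,y,z,w\in T_2\langle x_e\rangle$. Moreover $E_{xx}\,\mathbb{Q}G\,E_{xx}\simeq F$.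
   Context: For a subgroup $H$ of a finite group $G$, $\widehat{H}=\frac1{|H|}\sum_{h\in H}h\in\mathbb{Q}G$. For $K\lhd H\le G$ with $K\ne H$, put $\varepsilon(H,K)=\prod_M(\widehat{K}-\widehat{M})$, where $M$ runs over the minimal elements of the set of normal subgroups of $H$ properly containing $K$; put $\varepsilon(H,H)=\widehat{H}$. Let $e(G,H,K)$ be the sum of the distinct $G$-conjugates of $\varepsilon(H,K)$. A strong Shoda pair of $G$ is a pair $(H,K)$ of subgroups with $K\le H\unlhd N_G(K)$, $H/K$ cyclic and a maximal abelian subgroup of $N_G(K)/K$, and the distinct $G$-conjugates of $\varepsilon(H,K)$ pairwise orthogonal. In this case the centralizer of $\varepsilon(H,K)$ in $G$ is $N_G(K)$ and $e(G,H,K)$ is a primitive central idempotent of $\mathbb{Q}G$. Let $N=N_G(K)$, $k=[H:K]$, $H/K=\langle yK\rangle$, and let $\phi:N/H\to N/K$ be a section of the canonical projection $N/K\to N/H$. Then $\mathbb{Q}H\varepsilon\cong\mathbb{Q}(\zeta_k)$ is a field with identity $\varepsilon$ ($\zeta_k$ a complex primitive $k$-th root of unity), on which $N/H$ acts faithfully by conjugation, so $N/H$ is identified with $\mathrm{Gal}(\mathbb{Q}H\varepsilon/F)$, where $F$ is the fixed field. The twisting is $\tau(gH,g'H)=\zeta_k^j$ if $\phi(gg'H)^{-1}\phi(gH)\phi(g'H)=y^jK$. For a coset $tK\in N/K$ the element $t\varepsilon$ depends only on $tK$; write $\phi(gH)\varepsilon$ accordingly. The algebra $\mathbb{Q}N\varepsilon=\bigoplus_{gH\in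 N/H}\mathbb{Q}H\varepsilon\cdot\phi(gH)\varepsilon$ is a crossed product of $\mathbb{Q}H\varepsilon$ by $N/H$ with twisting $\tau$. A normal element of a finite Galois extension $E/F$ is $w\in E$ such that $\{\sigma(w):\sigma\in\mathrm{Gal}(E/F)\}$ is an $F$-basis of $E$ (the normal basis determined by $w$). The isomorphism $\psi$: when $\tau=1$, $\psi:\mathbb{Q}N\varepsilon\to\mathrm{End}_F(\mathbb{Q}H\varepsilon)\to M_n(F)$ is the $F$-algebra isomorphism sending $x\,\phi(gH)\varepsilon$ (with $x\in\mathbb{Q}H\varepsilon$) to the matrix in the basis $B$ of the $F$-linear map $v\mapsto x\cdot\sigma_g(v)$, where $\sigma_g\in\mathrm{Gal}(\mathbb{Q}H\varepsilon/F)$ is the automorphism $\sigma_g(v)=gvg^{-1}$. The matrices: the first row and first column of $P\in M_n(F)$ consist of ones, $P_{ii}=-1$ for $i\ge2$, and all other entries of $P$ are $0$; $A\in M_n(F)$ has $A_{i+1,i}=1$ for $1\le i<n$, $A_{1,n}=1$, and all other entries $0$. $\langle x_e\rangle$ is the cyclic group generated by $x_e$ in the unit group of $\mathbb{Q}N\varepsilon$ (identity $\varepsilon$); $T_2\langle x_e\rangle=\{t x_e^i : t\in T_2,\ i\in\mathbb{Z}\}$, and for $x=tx_e^i$ we write $x^{-1}=x_e^{-i}t^{-1}$.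
   Formalization: T_1 is required to represent the given section φ (tK = φ(tH) for t in T_1), since the claim fails for an arbitrary transversal (S_3, H=A_3=⟨y⟩, K=1, T_1={y,s}); "right transversal of N in G" is taken as one element in each coset tN. *)

theory Defs
  imports Complex_Main "HOL-Algebra.Algebra"
begin

text \<open>Elements of the group algebra of a finite group are the functions supported on the carrier.
  For a subset \<open>S\<close> of \<open>G\<close>, the algebra of \<open>G\<lparr>carrier := S\<rparr>\<close> is literally a subset of that of \<open>G\<close>.\<close>

definition group_algebra :: "('a, 'b) monoid_scheme \<Rightarrow> ('a \<Rightarrow> rat) ring" where
  "group_algebra G =
    \<lparr>carrier = {f. \<forall>x. x \<notin> carrier G \<longrightarrow> f x = 0},
     monoid.mult = (\<lambda>f g z. \<Sum>(x, y) \<in> {(x, y). x \<in> carrier G \<and> y \<in> carrier G \<and> x \<otimes>\<^bsub>G\<^esub> y = z}. f x * g y),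
     monoid.one = (\<lambda>x. if x = \<one>\<^bsub>G\<^esub> then 1 else 0),
     ring.zero = (\<lambda>x. 0),
     ring.add = (\<lambda>f g x. f x + g x)\<rparr>"

definition group_elem :: "'a \<Rightarrow> ('a \<Rightarrow> rat)" where
  "group_elem g = (\<lambda>x. if x = g then 1 else 0)"

definition hat :: "'a set \<Rightarrow> ('a \<Rightarrow> rat)" where
  "hat S = (\<lambda>x. if x \<in> S then 1 / of_nat (card S) else 0)"

definition conj_by :: "('a, 'b) monoid_scheme \<Rightarrow> 'a \<Rightarrow> ('a \<Rightarrow> rat) \<Rightarrow> ('a \<Rightarrow> rat)" where
  "conj_by G g \<alpha> = group_elem g \<otimes>\<^bsub>group_algebra G\<^esub> \<alpha> \<otimes>\<^bsub>group_algebra G\<^esub> group_elem (inv\<^bsub>G\<^esub> g)"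

definition conjugates :: "('a, 'b) monoid_scheme \<Rightarrow> ('a \<Rightarrow> rat) \<Rightarrow> ('a \<Rightarrow> rat) set" where
  "conjugates G \<alpha> = (\<lambda>g. conj_by G g \<alpha>) ` carrier G"

text \<open>For an idempotent \<open>f\<close> commuting with the elements of the subgroup \<open>S\<close>: the ring \<open>\<rat>S f\<close>,
  with identity \<open>f\<close>.\<close>

definition idem_algebra ::
    "('a, 'b) monoid_scheme \<Rightarrow> 'a set \<Rightarrow> ('a \<Rightarrow> rat) \<Rightarrow> ('a \<Rightarrow> rat) ring" where
  "idem_algebra G S f = (group_algebra G)
    \<lparr>carrier := (\<lambda>\<alpha>. \<alpha> \<otimes>\<^bsub>group_algebra G\<^esub> f) ` carrier (group_algebra (G\<lparr>carrier := S\<rparr>)), one := f\<rparr>"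

definition corner_ring :: "('c, 'd) ring_scheme \<Rightarrow> 'c \<Rightarrow> ('c, 'd) ring_scheme" where
  "corner_ring R f = R\<lparr>carrier := (\<lambda>\<alpha>. f \<otimes>\<^bsub>R\<^esub> \<alpha> \<otimes>\<^bsub>R\<^esub> f) ` carrier R, one := f\<rparr>"

definition minimal_normal_above :: "('a, 'b) monoid_scheme \<Rightarrow> 'a set \<Rightarrow> 'a set \<Rightarrow> 'a set set" where
  "minimal_normal_above G H K =
    {M. M \<lhd> G\<lparr>carrier := H\<rparr> \<and> K \<subset> M \<and>
        (\<forall>M'. M' \<lhd> G\<lparr>carrier := H\<rparr> \<and> K \<subset> M' \<and> M' \<subseteq> M \<longrightarrow> M' = M)}"

text \<open>Although the group algebra need not be commutative, the \<open>finprod\<close> below is a fold over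
  pairwise commuting factors (each is central in \<open>\<rat>H\<close>), hence independent of the order.\<close>

definition shoda_eps :: "('a, 'b) monoid_scheme \<Rightarrow> 'a set \<Rightarrow> 'a set \<Rightarrow> ('a \<Rightarrow> rat)" where
  "shoda_eps G H K =
    (if H = K then hat H
     else (\<Otimes>\<^bsub>group_algebra G\<^esub> M \<in> minimal_normal_above G H K. hat K \<ominus>\<^bsub>group_algebra G\<^esub> hat M))"

definition shoda_e :: "('a, 'b) monoid_scheme \<Rightarrow> 'a set \<Rightarrow> 'a set \<Rightarrow> ('a \<Rightarrow> rat)" where
  "shoda_e G H K = (\<Oplus>\<^bsub>group_algebra G\<^esub> c \<in> conjugates G (shoda_eps G H K). c)"

definition maximal_abelian_subgroup :: "'c set \<Rightarrow> ('c, 'd) monoid_scheme \<Rightarrow> bool" where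
  "maximal_abelian_subgroup A Q \<longleftrightarrow>
    subgroup A Q \<and> comm_group (Q\<lparr>carrier := A\<rparr>) \<and>
    (\<forall>B. subgroup B Q \<and> comm_group (Q\<lparr>carrier := B\<rparr>) \<and> A \<subseteq> B \<longrightarrow> B = A)"

definition norm_group :: "('a, 'b) monoid_scheme \<Rightarrow> 'a set \<Rightarrow> ('a, 'b) monoid_scheme" where
  "norm_group G K = G\<lparr>carrier := normalizer G K\<rparr>"

definition strong_shoda_pair :: "('a, 'b) monoid_scheme \<Rightarrow> 'a set \<Rightarrow> 'a set \<Rightarrow> bool" where
  "strong_shoda_pair G H K \<longleftrightarrow>
    subgroup H G \<and> subgroup K G \<and> K \<subseteq> H \<and> H \<lhd> norm_group G K \<and>
    cyclic_group (G\<lparr>carrier := H\<rparr> Mod K) \<and>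
    maximal_abelian_subgroup (carrier (G\<lparr>carrier := H\<rparr> Mod K)) (norm_group G K Mod K) \<and>
    (\<forall>c \<in> conjugates G (shoda_eps G H K). \<forall>d \<in> conjugates G (shoda_eps G H K).
       c \<noteq> d \<longrightarrow> c \<otimes>\<^bsub>group_algebra G\<^esub> d = \<zero>\<^bsub>group_algebra G\<^esub>)"

text \<open>Throughout, \<open>N\<close> is the normalizer of \<open>K\<close>. The projection \<open>N/K \<rightarrow> N/H\<close> sends a coset \<open>C\<close> of \<open>K\<close>
  to the product set \<open>HX\<close>.\<close>

definition is_section ::
    "('a, 'b) monoid_scheme \<Rightarrow> 'a set \<Rightarrow> 'a set \<Rightarrow> ('a set \<Rightarrow> 'a set) \<Rightarrow> bool" where
  "is_section G H K \<phi> \<longleftrightarrow>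
    (\<forall>C \<in> carrier (norm_group G K Mod H).
       \<phi> C \<in> carrier (norm_group G K Mod K) \<and> H <#>\<^bsub>G\<^esub> \<phi> C = C)"

definition is_primitive_root :: "complex \<Rightarrow> nat \<Rightarrow> bool" where
  "is_primitive_root \<zeta> k \<longleftrightarrow> \<zeta> ^ k = 1 \<and> (\<forall>m. 0 < m \<and> m < k \<longrightarrow> \<zeta> ^ m \<noteq> 1)"

definition twisting ::
    "('a, 'b) monoid_scheme \<Rightarrow> 'a set \<Rightarrow> 'a set \<Rightarrow> 'a \<Rightarrow> complex \<Rightarrow> ('a set \<Rightarrow> 'a set) \<Rightarrow>
     'a set \<Rightarrow> 'a set \<Rightarrow> complex" where
  "twisting G H K y \<zeta> \<phi> C C' =
    (let NH = norm_group G K Mod H; NK = norm_group G K Mod K in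
     THE z. \<exists>j::nat. z = \<zeta> ^ j \<and>
       inv\<^bsub>NK\<^esub> \<phi> (C \<otimes>\<^bsub>NH\<^esub> C') \<otimes>\<^bsub>NK\<^esub> \<phi> C \<otimes>\<^bsub>NK\<^esub> \<phi> C' = (K #>\<^bsub>G\<^esub> y) [^]\<^bsub>NK\<^esub> j)"

definition coeff_field :: "('a, 'b) monoid_scheme \<Rightarrow> 'a set \<Rightarrow> 'a set \<Rightarrow> ('a \<Rightarrow> rat) ring" where
  "coeff_field G H K = idem_algebra G H (shoda_eps G H K)"

definition fixed_field :: "('a, 'b) monoid_scheme \<Rightarrow> 'a set \<Rightarrow> 'a set \<Rightarrow> ('a \<Rightarrow> rat) ring" where
  "fixed_field G H K = (coeff_field G H K)
    \<lparr>carrier := {v \<in> carrier (coeff_field G H K). \<forall>g \<in> normalizer G K. conj_by G g v = v}\<rparr>"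

definition galois_group :: "('c, 'd) ring_scheme \<Rightarrow> 'c set \<Rightarrow> ('c \<Rightarrow> 'c) set" where
  "galois_group E F = {\<sigma> \<in> ring_iso E E. \<forall>x \<in> F. \<sigma> x = x}"

definition normal_basis :: "('c, 'd) ring_scheme \<Rightarrow> 'c set \<Rightarrow> 'c \<Rightarrow> 'c set" where
  "normal_basis E F w = (\<lambda>\<sigma>. \<sigma> w) ` galois_group E F"

definition normal_element :: "('c, 'd) ring_scheme \<Rightarrow> 'c set \<Rightarrow> 'c \<Rightarrow> bool" where
  "normal_element E F w \<longleftrightarrow>
    w \<in> carrier E \<and>
    (\<exists>bs. set bs = normal_basis E F w \<and> ring.independent E F bs \<and> ring.Span E F bs = carrier E)"

text \<open>A coset \<open>tK\<close> acts through any of its elements: \<open>t\<epsilon>\<close> depends only on \<open>tK\<close>. Likewise the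
  automorphism \<open>v \<mapsto> gvg\<^sup>-\<^sup>1\<close> of the commutative ring \<open>\<rat>H \<epsilon>\<close> depends only on \<open>gH\<close>.\<close>

definition coset_elem ::
    "('a, 'b) monoid_scheme \<Rightarrow> 'a set \<Rightarrow> 'a set \<Rightarrow> 'a set \<Rightarrow> ('a \<Rightarrow> rat)" where
  "coset_elem G H K Y = group_elem (SOME t. t \<in> Y) \<otimes>\<^bsub>group_algebra G\<^esub> shoda_eps G H K"

definition coset_aut :: "('a, 'b) monoid_scheme \<Rightarrow> 'a set \<Rightarrow> ('a \<Rightarrow> rat) \<Rightarrow> ('a \<Rightarrow> rat)" where
  "coset_aut G C v = conj_by G (SOME g. g \<in> C) v"

text \<open>Matrices over a ring record, with indices running over \<open>{..<n}\<close> (so the first row and column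
  have index \<open>0\<close>) and entries outside this range equal to zero.\<close>

definition mat_entries :: "('c, 'd) ring_scheme \<Rightarrow> nat \<Rightarrow> (nat \<Rightarrow> nat \<Rightarrow> 'c) \<Rightarrow> (nat \<Rightarrow> nat \<Rightarrow> 'c)" where
  "mat_entries R n f = (\<lambda>i j. if i < n \<and> j < n then f i j else \<zero>\<^bsub>R\<^esub>)"

definition mat_ring :: "('c, 'd) ring_scheme \<Rightarrow> nat \<Rightarrow> (nat \<Rightarrow> nat \<Rightarrow> 'c) ring" where
  "mat_ring R n =
    \<lparr>carrier = {M. \<forall>i j. if i < n \<and> j < n then M i j \<in> carrier R else M i j = \<zero>\<^bsub>R\<^esub>},
     monoid.mult = (\<lambda>M M'. mat_entries R n (\<lambda>i j. \<Oplus>\<^bsub>R\<^esub> l \<in> {..<n}. M i l \<otimes>\<^bsub>R\<^esub> M' l j)),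
     monoid.one = mat_entries R n (\<lambda>i j. if i = j then \<one>\<^bsub>R\<^esub> else \<zero>\<^bsub>R\<^esub>),
     ring.zero = mat_entries R n (\<lambda>i j. \<zero>\<^bsub>R\<^esub>),
     ring.add = (\<lambda>M M'. mat_entries R n (\<lambda>i j. M i j \<oplus>\<^bsub>R\<^esub> M' i j))\<rparr>"

definition mat_P :: "('c, 'd) ring_scheme \<Rightarrow> nat \<Rightarrow> (nat \<Rightarrow> nat \<Rightarrow> 'c)" where
  "mat_P R n = mat_entries R n
    (\<lambda>i j. if i = 0 \<or> j = 0 then \<one>\<^bsub>R\<^esub> else if i = j then \<ominus>\<^bsub>R\<^esub> \<one>\<^bsub>R\<^esub> else \<zero>\<^bsub>R\<^esub>)"

definition mat_A :: "('c, 'd) ring_scheme \<Rightarrow> nat \<Rightarrow> (nat \<Rightarrow> nat \<Rightarrow> 'c)" where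
  "mat_A R n = mat_entries R n
    (\<lambda>i j. if i = j + 1 \<or> (i = 0 \<and> j = n - 1) then \<one>\<^bsub>R\<^esub> else \<zero>\<^bsub>R\<^esub>)"

definition degree_NH :: "('a, 'b) monoid_scheme \<Rightarrow> 'a set \<Rightarrow> 'a set \<Rightarrow> nat" where
  "degree_NH G H K = card (carrier (norm_group G K Mod H))"

text \<open>\<open>\<psi>\<close> with respect to the ordered basis \<open>bs\<close> of \<open>\<rat>H \<epsilon>\<close> over \<open>F\<close>: writing \<open>\<alpha>\<close> as the sum of the
  \<open>\<xi> C \<cdot> \<phi>(C) \<epsilon>\<close> over \<open>C \<in> N/H\<close>, with coefficients \<open>\<xi> C\<close> in \<open>\<rat>H \<epsilon>\<close>, the columns of \<open>\<psi>(\<alpha>)\<close> are the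
  coordinates of the images of the basis vectors under \<open>v \<mapsto> \<Sum>\<^sub>C \<xi> C \<cdot> \<sigma>\<^sub>C(v)\<close>. This is the additive
  extension of the prescription for the summands \<open>x \<cdot> \<phi>(gH) \<epsilon>\<close>.\<close>

definition psi ::
    "('a, 'b) monoid_scheme \<Rightarrow> 'a set \<Rightarrow> 'a set \<Rightarrow> ('a set \<Rightarrow> 'a set) \<Rightarrow> ('a \<Rightarrow> rat) list \<Rightarrow>
     ('a \<Rightarrow> rat) \<Rightarrow> (nat \<Rightarrow> nat \<Rightarrow> ('a \<Rightarrow> rat))" where
  "psi G H K \<phi> bs \<alpha> =
    (let QG = group_algebra G; NH = carrier (norm_group G K Mod H); n = degree_NH G H K in
     THE M. M \<in> carrier (mat_ring (fixed_field G H K) n) \<and>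
       (\<exists>\<xi> \<in> NH \<rightarrow> carrier (coeff_field G H K).
          \<alpha> = (\<Oplus>\<^bsub>QG\<^esub> C \<in> NH. \<xi> C \<otimes>\<^bsub>QG\<^esub> coset_elem G H K (\<phi> C)) \<and>
          (\<forall>j<n. (\<Oplus>\<^bsub>QG\<^esub> C \<in> NH. \<xi> C \<otimes>\<^bsub>QG\<^esub> coset_aut G C (bs ! j)) =
                 (\<Oplus>\<^bsub>QG\<^esub> i \<in> {..<n}. M i j \<otimes>\<^bsub>QG\<^esub> (bs ! i)))))"

definition norm_algebra :: "('a, 'b) monoid_scheme \<Rightarrow> 'a set \<Rightarrow> 'a set \<Rightarrow> ('a \<Rightarrow> rat) ring" where
  "norm_algebra G H K = idem_algebra G (normalizer G K) (shoda_eps G H K)"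

definition x_elem ::
    "('a, 'b) monoid_scheme \<Rightarrow> 'a set \<Rightarrow> 'a set \<Rightarrow> ('a set \<Rightarrow> 'a set) \<Rightarrow> ('a \<Rightarrow> rat) list \<Rightarrow> ('a \<Rightarrow> rat)"
  where
  "x_elem G H K \<phi> bs =
    (let F = fixed_field G H K; n = degree_NH G H K; MF = mat_ring F n in
     inv_into (carrier (norm_algebra G H K)) (psi G H K \<phi> bs)
       (mat_P F n \<otimes>\<^bsub>MF\<^esub> mat_A F n \<otimes>\<^bsub>MF\<^esub> inv\<^bsub>MF\<^esub> mat_P F n))"

text \<open>One element from each coset \<open>gU\<close>: this is the sense in which the conjugates \<open>t \<epsilon> t\<^sup>-\<^sup>1\<close>,
  with \<open>t\<close> in a transversal of the normalizer \<open>N\<close> in \<open>G\<close>, are distinct and add up to \<open>e\<close>. It matters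
  since \<open>N\<close> need not be normal in \<open>G\<close>.\<close>

definition transversal :: "('a, 'b) monoid_scheme \<Rightarrow> 'a set \<Rightarrow> 'a set \<Rightarrow> 'a set \<Rightarrow> bool" where
  "transversal G S U T \<longleftrightarrow> T \<subseteq> S \<and> (\<forall>g \<in> S. \<exists>!t. t \<in> T \<inter> (g <#\<^bsub>G\<^esub> U))"

text \<open>The set \<open>T\<langle>x\<^sub>e\<rangle>\<close>, where \<open>R\<close> is the ring in whose unit group \<open>x\<^sub>e\<close> lives, and the
  inverse \<open>x\<^sub>e\<^sup>-\<^sup>i t\<^sup>-\<^sup>1\<close> of \<open>t x\<^sub>e\<^sup>i\<close>, which is not an inverse in the group algebra.\<close>

definition index_set ::
    "('a, 'b) monoid_scheme \<Rightarrow> ('a \<Rightarrow> rat) ring \<Rightarrow> 'a set \<Rightarrow> ('a \<Rightarrow> rat) \<Rightarrow> ('a \<Rightarrow> rat) set" where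
  "index_set G R T xe = {group_elem t \<otimes>\<^bsub>group_algebra G\<^esub> (xe [^]\<^bsub>R\<^esub> i) | t (i::int). t \<in> T}"

definition index_inv ::
    "('a, 'b) monoid_scheme \<Rightarrow> ('a \<Rightarrow> rat) ring \<Rightarrow> 'a set \<Rightarrow> ('a \<Rightarrow> rat) \<Rightarrow> ('a \<Rightarrow> rat) \<Rightarrow> ('a \<Rightarrow> rat)" where
  "index_inv G R T xe x =
    (THE z. \<exists>t \<in> T. \<exists>i::int. x = group_elem t \<otimes>\<^bsub>group_algebra G\<^esub> (xe [^]\<^bsub>R\<^esub> i) \<and>
       z = (xe [^]\<^bsub>R\<^esub> (- i)) \<otimes>\<^bsub>group_algebra G\<^esub> group_elem (inv\<^bsub>G\<^esub> t))"

definition complete_matrix_units :: "('c, 'd) ring_scheme \<Rightarrow> 'i set \<Rightarrow> ('i \<Rightarrow> 'i \<Rightarrow> 'c) \<Rightarrow> bool" where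
  "complete_matrix_units R J E \<longleftrightarrow>
    (\<forall>x \<in> J. \<forall>y \<in> J. E x y \<in> carrier R) \<and>
    \<one>\<^bsub>R\<^esub> = (\<Oplus>\<^bsub>R\<^esub> x \<in> J. E x x) \<and>
    (\<forall>x \<in> J. \<forall>y \<in> J. \<forall>z \<in> J. \<forall>u \<in> J.
       E x y \<otimes>\<^bsub>R\<^esub> E z u = (if y = z then E x u else \<zero>\<^bsub>R\<^esub>))"

end

theory Submission
  imports Defs "HOL-Library.Function_Algebras"
begin

text \<open>Write \<open>E\<close> for \<open>\<rat>H\<epsilon>\<close> and \<open>\<theta>\<close> for the average of \<open>T\<^sub>1\<close> times \<open>\<epsilon>\<close>. Trivial twisting says that
  \<open>t \<mapsto> t\<epsilon>\<close> makes \<open>T\<^sub>1\<close> a copy of the group \<open>N/H\<close> inside the units of \<open>\<rat>N\<epsilon>\<close>. Hence \<open>\<theta>\<close> is an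
  idempotent fixed by \<open>T\<^sub>1\<close>, and the left ideal of \<open>\<rat>N\<epsilon>\<close> generated by \<open>\<theta>\<close> is \<open>E\<theta>\<close>. There
  \<open>(x t)(v\<theta>) = x \<sigma>\<^sub>t(v) \<theta>\<close>, so left multiplication on \<open>E\<theta>\<close> is the action of \<open>\<rat>N\<epsilon>\<close> on \<open>E\<close> by
  \<open>F\<close>-linear maps from which \<open>\<psi>\<close> is defined.

  The key is the identity \<open>\<Sum>\<^sub>h h \<theta> h\<inverse> = (|H|/n) \<epsilon>\<close>, where \<open>h\<close> runs over \<open>H\<close> (\<open>average_theta\<close>). For
  \<open>t\<close> in \<open>N\<close> outside \<open>H\<close> the commutators \<open>h t h\<inverse> t\<inverse>\<close> run, up to \<open>K\<close>, through a subgroup of \<open>H\<close>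
  strictly above \<open>K\<close>, because \<open>H/K\<close> is its own centralizer in \<open>N/K\<close>; and \<open>\<epsilon>\<close> annihilates the sum of
  such a subgroup (\<open>sum_conj_H_zero\<close>). The identity shows that \<open>\<rat>N\<epsilon>\<close> acts faithfully on \<open>E\<theta>\<close>
  (\<open>faithful\<close>) and, with \<open>h\<close> replaced by \<open>f(h\<epsilon>)\<close>, that every \<open>F\<close>-linear map \<open>f\<close> of \<open>E\<close> is realized
  by an element of \<open>\<rat>N\<epsilon>\<close> (\<open>realize_linear\<close>). So \<open>\<psi>\<close> is bijective by direct computation. The same
  faithfulness shows that the conjugates of \<open>w\<close> satisfy no linear relation over \<open>F\<close>
  (\<open>unique_coefficients\<close>); here one uses that \<open>N/H\<close>, a group of automorphisms of the cyclic group
  \<open>H/K\<close>, is abelian. An abstract automorphism of \<open>E\<close> over \<open>F\<close> moves \<open>w\<close> to one of these conjugates,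
  because it fixes the trace of \<open>w\<close> and the normal basis is linearly independent (\<open>set_bs_conj\<close>). So
  the normal basis consists of the \<open>n\<close> conjugates of \<open>w\<close> by \<open>T\<^sub>1\<close>.

  Let \<open>u\<^sub>0, \<dots>, u\<^sub>n\<^sub>-\<^sub>1\<close> be the columns of \<open>P\<close>, read as elements of \<open>E\<close>: the first is the sum of the
  normal basis, the others are differences of two of its members. Then \<open>x\<^sub>e\<close> is the element that
  moves \<open>u\<^sub>j\<theta>\<close> to \<open>u\<^sub>j\<^sub>+\<^sub>1\<theta>\<close> cyclically (\<open>xe_shift\<close>), while \<open>\<theta>\<close>, which acts as the trace divided by
  \<open>n\<close>, fixes \<open>u\<^sub>0\<theta>\<close> and kills the other \<open>u\<^sub>j\<theta>\<close> (\<open>theta_u\<close>). Comparing actions on the \<open>u\<^sub>j\<theta>\<close> gives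
  \<open>\<theta> x\<^sub>e\<^sup>m \<theta> = 0\<close> unless \<open>n\<close> divides \<open>m\<close>, and \<open>\<Sum>\<^sub>r x\<^sub>e\<^sup>r \<theta> x\<^sub>e\<^sup>-\<^sup>r = \<epsilon>\<close>: these are the matrix units inside
  \<open>\<rat>N\<epsilon>\<close>. Translating by \<open>T\<^sub>2\<close> gives those of \<open>\<rat>Ge\<close>, as the conjugates of \<open>\<epsilon>\<close> by distinct elements
  of \<open>T\<^sub>2\<close> are orthogonal. This needs that \<open>\<epsilon> \<noteq> 0\<close> and that only the elements of \<open>N\<close> commute
  with \<open>\<epsilon>\<close>; the first is seen on a faithful character of \<open>H/K\<close>, the second holds because \<open>K\<close> is exactly the set of elements \<open>g\<close> with
  \<open>g\<epsilon> = \<epsilon>\<close>. Finally \<open>\<theta> \<rat>G \<theta> = F\<theta>\<close> (\<open>theta_corner\<close>), which identifies the corners with \<open>F\<close>.\<close>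

section \<open>The rational group algebra as a ring of functions\<close>

definition scale :: "rat \<Rightarrow> ('a \<Rightarrow> rat) \<Rightarrow> ('a \<Rightarrow> rat)" (infixr "*\<^sub>Q" 75) where
  "c *\<^sub>Q f = (\<lambda>x. c * f x)"

lemma scale_apply [simp]: "(c *\<^sub>Q f) x = c * f x"
  by (simp add: scale_def)

interpretation rat_fun: vector_space "scale :: rat \<Rightarrow> ('a \<Rightarrow> rat) \<Rightarrow> ('a \<Rightarrow> rat)"
  by standard (auto simp: fun_eq_iff algebra_simps)

lemma sum_fun_apply: "(\<Sum>i\<in>A. f i) x = (\<Sum>i\<in>A. (f i :: 'a \<Rightarrow> rat) x)"
  by (induction A rule: infinite_finite_induct) auto

lemma diff_fun_apply [simp]: "((f::'a \<Rightarrow> rat) - g) x = f x - g x"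
  by (simp add: fun_diff_def)

lemma uminus_fun_apply [simp]: "(- (f::'a \<Rightarrow> rat)) x = - f x"
  by (simp add: fun_Compl_def)

lemma sum_constant_scale: "(\<Sum>i\<in>A. f) = of_nat (card A) *\<^sub>Q f"
  by (simp add: fun_eq_iff)

definition supp :: "'a set \<Rightarrow> ('a \<Rightarrow> rat) set" where
  "supp S = {f. \<forall>x. x \<notin> S \<longrightarrow> f x = 0}"

lemma supp_zero [simp, intro]: "0 \<in> supp S"
  and supp_add [intro]: "f \<in> supp S \<Longrightarrow> g \<in> supp S \<Longrightarrow> f + g \<in> supp S"
  and supp_diff [intro]: "f \<in> supp S \<Longrightarrow> g \<in> supp S \<Longrightarrow> f - g \<in> supp S"
  and supp_scale [intro]: "f \<in> supp S \<Longrightarrow> c *\<^sub>Q f \<in> supp S"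
  and supp_delta [intro]: "s \<in> S \<Longrightarrow> group_elem s \<in> supp S"
  and supp_hat [intro]: "hat S \<in> supp S"
  by (auto simp: supp_def group_elem_def hat_def)

lemma supp_mono: "f \<in> supp S \<Longrightarrow> S \<subseteq> S' \<Longrightarrow> f \<in> supp S'"
  by (auto simp: supp_def)

lemma supp_sum [intro]: "(\<And>i. i \<in> A \<Longrightarrow> f i \<in> supp S) \<Longrightarrow> sum f A \<in> supp S"
  by (induction A rule: infinite_finite_induct) auto

lemma supp_expand:
  assumes "finite S" "f \<in> supp S"
  shows "f = (\<Sum>s\<in>S. f s *\<^sub>Q group_elem s)"
proof
  fix x
  have "(\<Sum>s\<in>S. f s *\<^sub>Q group_elem s) x = (\<Sum>s\<in>S. if s = x then f s else 0)"
    unfolding sum_fun_apply by (intro sum.cong) (auto simp: group_elem_def)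
  then show "f x = (\<Sum>s\<in>S. f s *\<^sub>Q group_elem s) x"
    using assms by (simp add: supp_def)
qed

lemma hat_expand:
  assumes "finite S"
  shows "hat S = (1 / of_nat (card S)) *\<^sub>Q (\<Sum>s\<in>S. group_elem s)"
  by (subst supp_expand[OF assms supp_hat], subst rat_fun.scale_sum_right)
     (auto intro!: sum.cong simp: hat_def)

lemma carrier_group_algebra: "carrier (group_algebra G) = supp (carrier G)"
  by (simp add: group_algebra_def supp_def)

lemma zero_group_algebra: "\<zero>\<^bsub>group_algebra G\<^esub> = 0"
  and one_group_algebra: "\<one>\<^bsub>group_algebra G\<^esub> = group_elem \<one>\<^bsub>G\<^esub>"
  and add_group_algebra: "f \<oplus>\<^bsub>group_algebra G\<^esub> g = f + g"
  by (auto simp: group_algebra_def group_elem_def)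

text \<open>Every ring below is a set of functions with pointwise addition, so all finite sums are
  pointwise sums.\<close>

lemma finsum_pointwise:
  fixes R :: "('a \<Rightarrow> rat, 'c) ring_scheme"
  assumes "\<And>f g. f \<oplus>\<^bsub>R\<^esub> g = f + g" "\<zero>\<^bsub>R\<^esub> = 0" "carrier R = S"
    "0 \<in> S" "\<And>f g. f \<in> S \<Longrightarrow> g \<in> S \<Longrightarrow> f + g \<in> S"
    "\<And>i. i \<in> A \<Longrightarrow> F i \<in> S"
  shows "finsum R F A = sum F A"
proof -
  interpret comm_monoid "add_monoid R"
    by standard (use assms in \<open>auto simp: add.assoc add.commute\<close>)
  have one: "\<one>\<^bsub>add_monoid R\<^esub> = 0"
    using assms(2) by simp
  have "finprod (add_monoid R) F A = sum F A"
    using assms(6)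
  proof (induction A rule: infinite_finite_induct)
    case (insert x A)
    then have "finprod (add_monoid R) F (insert x A) = F x + finprod (add_monoid R) F A"
      using assms by (subst finprod_insert) auto
    then show ?case
      using insert by simp
  qed (simp_all only: one finprod_infinite finprod_empty sum.infinite sum.empty not_False_eq_True)
  then show ?thesis
    by (simp add: finsum_def)
qed

locale rat_group_algebra = group G for G (structure) +
  assumes finite_carrier: "finite (carrier G)"
begin

abbreviation star :: "('a \<Rightarrow> rat) \<Rightarrow> ('a \<Rightarrow> rat) \<Rightarrow> ('a \<Rightarrow> rat)" (infixl "\<star>" 70) where
  "f \<star> g \<equiv> f \<otimes>\<^bsub>group_algebra G\<^esub> g"

abbreviation delta :: "'a \<Rightarrow> ('a \<Rightarrow> rat)" ("\<delta>") where
  "\<delta> \<equiv> group_elem"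

text \<open>Only values on the carrier enter the product, so the laws of a ring without unit hold for
  all functions. The simplifier can thus use them without side conditions.\<close>

lemma star_apply:
  "(f \<star> g) z = (if z \<in> carrier G then \<Sum>x\<in>carrier G. f x * g (inv x \<otimes> z) else 0)"
proof (cases "z \<in> carrier G")
  case True
  let ?S = "{(x, y). x \<in> carrier G \<and> y \<in> carrier G \<and> x \<otimes> y = z}"
  have "(\<Sum>(x, y)\<in>?S. f x * g y) = (\<Sum>x\<in>carrier G. f x * g (inv x \<otimes> z))"
    by (rule sum.reindex_bij_witness[of _ "\<lambda>x. (x, inv x \<otimes> z)" fst])
       (use True in \<open>auto simp: m_assoc[symmetric]\<close>)
  with True show ?thesis
    by (simp add: group_algebra_def)
next
  case False
  then have "{(x, y). x \<in> carrier G \<and> y \<in> carrier G \<and> x \<otimes> y = z} = {}"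
    by auto
  then show ?thesis
    using False by (simp only: group_algebra_def monoid.simps) simp
qed

lemma star_add_left: "(f + g) \<star> h = f \<star> h + g \<star> h"
  and star_add_right: "h \<star> (f + g) = h \<star> f + h \<star> g"
  and star_diff_left: "(f - g) \<star> h = f \<star> h - g \<star> h"
  and star_diff_right: "h \<star> (f - g) = h \<star> f - h \<star> g"
  and star_scale_left: "(c *\<^sub>Q f) \<star> h = c *\<^sub>Q (f \<star> h)"
  and star_scale_right: "h \<star> (c *\<^sub>Q f) = c *\<^sub>Q (h \<star> f)"
  and star_zero_left [simp]: "0 \<star> h = 0"
  and star_zero_right [simp]: "h \<star> 0 = 0"
  by (simp_all add: fun_eq_iff star_apply algebra_simps sum.distrib sum_subtractf sum_distrib_left)

lemma star_sum_left: "sum f A \<star> h = (\<Sum>i\<in>A. f i \<star> h)"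
  for f :: "'i \<Rightarrow> 'a \<Rightarrow> rat"
  using sum_comp_morphism[of "\<lambda>f. f \<star> h" f A] by (simp add: star_add_left o_def)

lemma star_sum_right: "h \<star> sum f A = (\<Sum>i\<in>A. h \<star> f i)"
  for f :: "'i \<Rightarrow> 'a \<Rightarrow> rat"
  using sum_comp_morphism[of "\<lambda>f. h \<star> f" f A] by (simp add: star_add_right o_def)

lemma inv_mult_cancel:
  assumes "x \<in> carrier G" "u \<in> carrier G" "z \<in> carrier G"
  shows "x \<otimes> u \<otimes> inv u \<otimes> z = x \<otimes> z"
  using assms by (simp add: m_assoc)

lemma star_assoc: "f \<star> g \<star> h = f \<star> (g \<star> h)"
proof
  fix z
  show "(f \<star> g \<star> h) z = (f \<star> (g \<star> h)) z"
  proof (cases "z \<in> carrier G")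
    case z: True
    have "(f \<star> g \<star> h) z = (\<Sum>x\<in>carrier G. \<Sum>u\<in>carrier G. f u * (g (inv u \<otimes> x) * h (inv x \<otimes> z)))"
      using z by (simp add: star_apply[of "f \<star> g"] star_apply[of f g] sum_distrib_right mult.assoc)
    also have "\<dots> = (\<Sum>u\<in>carrier G. f u * (\<Sum>x\<in>carrier G. g (inv u \<otimes> x) * h (inv x \<otimes> z)))"
      by (subst sum.swap) (simp add: sum_distrib_left)
    also have "\<dots> = (\<Sum>u\<in>carrier G. f u * (\<Sum>v\<in>carrier G. g v * h (inv v \<otimes> (inv u \<otimes> z))))"
    proof (rule sum.cong[OF refl])
      fix u assume u: "u \<in> carrier G"
      have "(\<Sum>x\<in>carrier G. g (inv u \<otimes> x) * h (inv x \<otimes> z)) =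
            (\<Sum>v\<in>carrier G. g v * h (inv v \<otimes> (inv u \<otimes> z)))"
        by (rule sum.reindex_bij_witness[of _ "\<lambda>v. u \<otimes> v" "\<lambda>x. inv u \<otimes> x"])
           (use u z in \<open>auto simp: m_assoc[symmetric] inv_mult_group inv_mult_cancel\<close>)
      then show "f u * (\<Sum>x\<in>carrier G. g (inv u \<otimes> x) * h (inv x \<otimes> z)) =
            f u * (\<Sum>v\<in>carrier G. g v * h (inv v \<otimes> (inv u \<otimes> z)))"
        by simp
    qed
    also have "\<dots> = (f \<star> (g \<star> h)) z"
      using z by (simp add: star_apply[of f "g \<star> h"] star_apply[of g h])
    finally show ?thesis .
  qed (simp add: star_apply)
qed

lemma delta_star_apply:
  assumes "g \<in> carrier G"
  shows "(\<delta> g \<star> f) z = (if z \<in> carrier G then f (inv g \<otimes> z) else 0)"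
proof -
  have "(\<Sum>x\<in>carrier G. \<delta> g x * f (inv x \<otimes> z)) = (\<Sum>x\<in>carrier G. if x = g then f (inv x \<otimes> z) else 0)"
    by (intro sum.cong) (auto simp: group_elem_def)
  then show ?thesis
    using assms by (simp add: star_apply finite_carrier)
qed

lemma star_delta_apply:
  assumes "g \<in> carrier G"
  shows "(f \<star> \<delta> g) z = (if z \<in> carrier G then f (z \<otimes> inv g) else 0)"
proof (cases "z \<in> carrier G")
  case z: True
  have eq: "inv x \<otimes> z = g \<longleftrightarrow> x = z \<otimes> inv g" if "x \<in> carrier G" for x
    using inv_solve_left[of g x z] inv_solve_right[of x z g] that z assms by auto
  have "(\<Sum>x\<in>carrier G. f x * \<delta> g (inv x \<otimes> z)) = (\<Sum>x\<in>carrier G. if x = z \<otimes> inv g then f x else 0)"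
    by (intro sum.cong) (auto simp: group_elem_def eq)
  then show ?thesis
    using assms z by (simp add: star_apply finite_carrier)
qed (simp add: star_apply)

lemma delta_mult [simp]:
  assumes "g \<in> carrier G" "h \<in> carrier G"
  shows "\<delta> g \<star> \<delta> h = \<delta> (g \<otimes> h)"
proof
  fix z
  show "(\<delta> g \<star> \<delta> h) z = \<delta> (g \<otimes> h) z"
  proof (cases "z \<in> carrier G")
    case True
    then have "inv g \<otimes> z = h \<longleftrightarrow> z = g \<otimes> h"
      using assms by (metis inv_solve_left)
    with True show ?thesis
      using assms by (simp add: delta_star_apply) (simp add: group_elem_def)
  next
    case False
    with assms show ?thesis
      by (auto simp: delta_star_apply) (auto simp: group_elem_def)
  qed
qed

lemma delta_delta_star [simp]:
  assumes "g \<in> carrier G" "h \<in> carrier G"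
  shows "\<delta> g \<star> (\<delta> h \<star> f) = \<delta> (g \<otimes> h) \<star> f"
  using assms by (simp add: star_assoc[symmetric])

lemma delta_one_star: "f \<in> supp (carrier G) \<Longrightarrow> \<delta> \<one> \<star> f = f"
  and star_delta_one: "f \<in> supp (carrier G) \<Longrightarrow> f \<star> \<delta> \<one> = f"
  by (auto simp: fun_eq_iff delta_star_apply star_delta_apply supp_def)

lemma star_in_carrier [intro, simp]: "f \<star> g \<in> supp (carrier G)"
  by (simp add: supp_def star_apply)

lemma supp_star:
  assumes S: "subgroup S G" and f: "f \<in> supp S" and g: "g \<in> supp S"
  shows "f \<star> g \<in> supp S"
proof -
  have "finite S"
    using S finite_carrier finite_subset subgroup.subset by metis
  then have "f \<star> g = (\<Sum>s\<in>S. f s *\<^sub>Q \<delta> s) \<star> (\<Sum>s\<in>S. g s *\<^sub>Q \<delta> s)"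
    using f g by (simp add: supp_expand[symmetric])
  also have "\<dots> = (\<Sum>s\<in>S. \<Sum>s'\<in>S. (f s * g s') *\<^sub>Q \<delta> (s \<otimes> s'))"
    unfolding star_sum_left[of _ S "sum _ _"] unfolding star_sum_right
    by (intro sum.cong) (simp_all add: star_scale_left star_scale_right subgroup.mem_carrier[OF S])
  also have "\<dots> \<in> supp S"
    using S by (intro supp_sum supp_scale supp_delta) (rule subgroup.m_closed)
  finally show ?thesis .
qed

lemma commute_supp:
  assumes "finite S" "\<And>s. s \<in> S \<Longrightarrow> \<delta> s \<star> v = v \<star> \<delta> s" "f \<in> supp S"
  shows "f \<star> v = v \<star> f"
proof -
  have "(\<Sum>s\<in>S. f s *\<^sub>Q \<delta> s) \<star> v = v \<star> (\<Sum>s\<in>S. f s *\<^sub>Q \<delta> s)"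
    using assms by (simp add: star_sum_left star_sum_right star_scale_left star_scale_right)
  then show ?thesis
    using supp_expand[OF assms(1,3)] by simp
qed

text \<open>The augmentation of \<open>f\<close> is the scalar by which \<open>f\<close> acts on a vector fixed by its support.\<close>

lemma supp_star_fixed:
  assumes "finite S" "\<And>s. s \<in> S \<Longrightarrow> \<delta> s \<star> v = v" "f \<in> supp S"
  shows "f \<star> v = (\<Sum>s\<in>S. f s) *\<^sub>Q v"
proof -
  have "(\<Sum>s\<in>S. f s *\<^sub>Q \<delta> s) \<star> v = (\<Sum>s\<in>S. f s) *\<^sub>Q v"
    using assms by (simp add: star_sum_left star_scale_left rat_fun.scale_sum_left)
  then show ?thesis
    using supp_expand[OF assms(1,3)] by simp
qed

lemma hat_star_fixed:
  assumes "finite S" "S \<noteq> {}" "\<And>s. s \<in> S \<Longrightarrow> \<delta> s \<star> v = v"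
  shows "hat S \<star> v = v"
  using supp_star_fixed[OF assms(1,3) supp_hat] assms(1,2) by (simp add: hat_def)

lemma finite_subgroup: "subgroup S G \<Longrightarrow> finite S"
  using finite_carrier finite_subset subgroup.subset by metis

lemma delta_star_hat:
  assumes S: "subgroup S G" and s: "s \<in> S"
  shows "\<delta> s \<star> hat S = hat S"
proof
  fix z
  have "s \<in> carrier G" using assms by (rule subgroup.mem_carrier)
  moreover have "inv s \<otimes> z \<in> S \<longleftrightarrow> z \<in> S" if "z \<in> carrier G"
    using that s S \<open>s \<in> carrier G\<close>
    by (metis inv_solve_left subgroup.m_closed subgroup.m_inv_closed m_closed inv_closed)
  ultimately show "(\<delta> s \<star> hat S) z = hat S z"
    using subgroup.mem_carrier[OF S] by (auto simp: delta_star_apply hat_def)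
qed

subsection \<open>Conjugation\<close>

lemma conj_by_eq: "conj_by G g f = \<delta> g \<star> f \<star> \<delta> (inv g)"
  by (simp add: conj_by_def)

lemma conj_by_star:
  assumes "g \<in> carrier G"
  shows "conj_by G g (f \<star> h) = conj_by G g f \<star> conj_by G g h"
proof -
  have "f \<star> h = f \<star> (\<delta> \<one> \<star> h)"
    by (auto simp: fun_eq_iff star_apply[of f] delta_star_apply)
  then show ?thesis
    using assms by (simp add: conj_by_eq star_assoc)
qed

lemma conj_by_add: "conj_by G g (f + h) = conj_by G g f + conj_by G g h"
  and conj_by_diff: "conj_by G g (f - h) = conj_by G g f - conj_by G g h"
  and conj_by_scale: "conj_by G g (c *\<^sub>Q f) = c *\<^sub>Q conj_by G g f"
  and conj_by_zero [simp]: "conj_by G g 0 = 0"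
  and conj_by_sum: "conj_by G g (sum F A) = (\<Sum>i\<in>A. conj_by G g (F i))"
  by (simp_all add: conj_by_eq star_add_left star_add_right star_diff_left star_diff_right
      star_scale_left star_scale_right star_sum_left star_sum_right)

lemma conj_by_conj_by:
  assumes "g \<in> carrier G" "h \<in> carrier G"
  shows "conj_by G g (conj_by G h f) = conj_by G (g \<otimes> h) f"
  using assms by (simp add: conj_by_eq star_assoc inv_mult_group)

lemma conj_by_delta:
  assumes "g \<in> carrier G" "h \<in> carrier G"
  shows "conj_by G g (\<delta> h) = \<delta> (g \<otimes> h \<otimes> inv g)"
  using assms by (simp add: conj_by_eq)

lemma conj_by_one: "f \<in> supp (carrier G) \<Longrightarrow> conj_by G \<one> f = f"
  by (simp add: conj_by_eq delta_one_star star_delta_one)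

lemma conj_by_apply:
  assumes "g \<in> carrier G"
  shows "conj_by G g f z = (if z \<in> carrier G then f (inv g \<otimes> z \<otimes> g) else 0)"
  using assms by (simp add: conj_by_eq star_delta_apply delta_star_apply m_assoc)

lemma delta_star_eq_conj:
  assumes "g \<in> carrier G" "f \<in> supp (carrier G)"
  shows "\<delta> g \<star> f = conj_by G g f \<star> \<delta> g"
  using assms by (simp add: conj_by_eq star_assoc star_delta_one)

lemma conj_by_eq_self_iff:
  assumes "g \<in> carrier G" "f \<in> supp (carrier G)"
  shows "conj_by G g f = f \<longleftrightarrow> \<delta> g \<star> f = f \<star> \<delta> g"
proof
  assume "conj_by G g f = f"
  then show "\<delta> g \<star> f = f \<star> \<delta> g"
    using delta_star_eq_conj[OF assms] by simp
next
  assume "\<delta> g \<star> f = f \<star> \<delta> g"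
  then show "conj_by G g f = f"
    using assms by (simp add: conj_by_eq star_assoc star_delta_one)
qed

lemma conj_by_hat:
  assumes g: "g \<in> carrier G" and S: "S \<subseteq> carrier G"
  shows "conj_by G g (hat S) = hat ((\<lambda>s. g \<otimes> s \<otimes> inv g) ` S)"
proof -
  have inj: "inj_on (\<lambda>s. g \<otimes> s \<otimes> inv g) S"
    using g S by (auto intro!: inj_onI simp: subset_iff)
  have fS: "finite S"
    using S finite_carrier finite_subset by blast
  have "conj_by G g (hat S) = (1 / of_nat (card S)) *\<^sub>Q (\<Sum>s\<in>S. \<delta> (g \<otimes> s \<otimes> inv g))"
    using g S fS by (auto simp: hat_expand conj_by_scale conj_by_sum conj_by_delta subset_iff)
  then show ?thesis
    using fS inj by (simp add: hat_expand card_image sum.reindex)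
qed

lemma finsum_group_algebra:
  assumes "\<And>i. i \<in> A \<Longrightarrow> f i \<in> supp (carrier G)"
  shows "finsum (group_algebra G) f A = sum f A"
  by (rule finsum_pointwise[where S = "supp (carrier G)"])
     (use assms in \<open>auto simp: carrier_group_algebra zero_group_algebra add_group_algebra\<close>)

end

text \<open>From here on the simplifier treats functions as ring elements, without evaluating them.\<close>

declare plus_fun_apply [simp del] zero_fun_apply [simp del] times_fun_apply [simp del]
  one_fun_apply [simp del] scale_apply [simp del] diff_fun_apply [simp del] uminus_fun_apply [simp del]

lemmas fun_apply_simps = plus_fun_apply zero_fun_apply scale_apply diff_fun_apply uminus_fun_apply

(* Otherwise the notation for left cosets would be ambiguous. *)
no_notation subset_mset (infix \<open><#\<close> 50)

section \<open>Groups: the pair and its quotients\<close>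

lemma (in group) cancel_inv_left [simp]:
  "x \<in> carrier G \<Longrightarrow> z \<in> carrier G \<Longrightarrow> inv x \<otimes> (x \<otimes> z) = z"
  "x \<in> carrier G \<Longrightarrow> z \<in> carrier G \<Longrightarrow> x \<otimes> (inv x \<otimes> z) = z"
  by (simp_all add: m_assoc[symmetric])

text \<open>Centralizers are subgroups, so commuting passes to powers, first of one element and then of the
  other.\<close>

lemma (in group) commute_int_pow:
  assumes "a \<in> carrier G" "b \<in> carrier G" "a \<otimes> b = b \<otimes> a"
  shows "a [^] (i::int) \<otimes> b [^] (j::int) = b [^] j \<otimes> a [^] i"
proof -
  have centralizer: "subgroup {z \<in> carrier G. z \<otimes> c = c \<otimes> z} G" if "c \<in> carrier G" for c
  proof (rule subgroupI)
    fix z assume z: "z \<in> {z \<in> carrier G. z \<otimes> c = c \<otimes> z}"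
    then have "inv z \<otimes> (z \<otimes> c) \<otimes> inv z = inv z \<otimes> (c \<otimes> z) \<otimes> inv z"
      by simp
    moreover have "inv z \<otimes> (z \<otimes> c) \<otimes> inv z = c \<otimes> inv z"
      using z that by (subst cancel_inv_left) auto
    moreover have "inv z \<otimes> (c \<otimes> z) \<otimes> inv z = inv z \<otimes> c"
      using z that by (subst m_assoc) (auto simp: m_assoc)
    ultimately have "inv z \<otimes> c = c \<otimes> inv z"
      by simp
    then show "inv z \<in> {z \<in> carrier G. z \<otimes> c = c \<otimes> z}"
      using z by simp
  next
    fix z z' assume z: "z \<in> {z \<in> carrier G. z \<otimes> c = c \<otimes> z}" "z' \<in> {z \<in> carrier G. z \<otimes> c = c \<otimes> z}"
    have "z \<otimes> z' \<otimes> c = z \<otimes> (c \<otimes> z')"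
      using z that by (simp add: m_assoc)
    also have "\<dots> = c \<otimes> z \<otimes> z'"
      using z that by (simp add: m_assoc[symmetric])
    also have "\<dots> = c \<otimes> (z \<otimes> z')"
      using z that by (simp add: m_assoc)
    finally show "z \<otimes> z' \<in> {z \<in> carrier G. z \<otimes> c = c \<otimes> z}"
      using z by simp
  qed (use that in auto)
  have "a [^] i \<in> {z \<in> carrier G. z \<otimes> b = b \<otimes> z}"
    using subgroup_int_pow_closed[OF centralizer[of b]] assms by auto
  then have "b [^] j \<in> {z \<in> carrier G. z \<otimes> a [^] i = a [^] i \<otimes> z}"
    using subgroup_int_pow_closed[OF centralizer[of "a [^] i"]] assms by auto
  then show ?thesis by simp
qed

text \<open>This will be applied to a generator of \<open>H/K\<close> and an element of \<open>N/K\<close> that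
  centralizes it.\<close>

lemma (in group) commuting_pair_abelian_subgroup:
  assumes ab: "a \<in> carrier G" "b \<in> carrier G" "a \<otimes> b = b \<otimes> a"
  defines "B \<equiv> {a [^] (i::int) \<otimes> b [^] (j::int) | i j. True}"
  shows "subgroup B G" "comm_group (G\<lparr>carrier := B\<rparr>)"
proof -
  have mult: "a [^] i \<otimes> b [^] j \<otimes> (a [^] i' \<otimes> b [^] j') = a [^] (i + i') \<otimes> b [^] (j + j')"
    for i j i' j' :: int
  proof -
    have "a [^] i \<otimes> b [^] j \<otimes> (a [^] i' \<otimes> b [^] j') = a [^] i \<otimes> (b [^] j \<otimes> a [^] i') \<otimes> b [^] j'"
      using ab by (simp add: m_assoc)
    also have "b [^] j \<otimes> a [^] i' = a [^] i' \<otimes> b [^] j"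
      using commute_int_pow[OF ab] by simp
    finally show ?thesis
      using ab by (simp add: int_pow_mult m_assoc)
  qed
  show B: "subgroup B G"
  proof (rule subgroupI)
    show "B \<noteq> {}" "B \<subseteq> carrier G"
      using ab by (auto simp: B_def)
  next
    fix x assume "x \<in> B"
    then obtain i j :: int where x: "x = a [^] i \<otimes> b [^] j"
      by (auto simp: B_def)
    have "a [^] (- i) \<otimes> b [^] (- j) \<otimes> x = \<one>"
      unfolding x mult using ab by simp
    then have "inv x = a [^] (- i) \<otimes> b [^] (- j)"
      using ab x by (intro inv_equality) auto
    then show "inv x \<in> B" by (auto simp: B_def)
  next
    fix x x' assume "x \<in> B" "x' \<in> B"
    then show "x \<otimes> x' \<in> B"
      unfolding B_def using mult by blast
  qed
  have "x \<otimes> x' = x' \<otimes> x" if "x \<in> B" "x' \<in> B" for x x'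
    using that mult by (auto simp: B_def add.commute)
  then show "comm_group (G\<lparr>carrier := B\<rparr>)"
    using subgroup_imp_group[OF B] by (intro group.group_comm_groupI) auto
qed

lemma (in group) conj_nat_pow:
  assumes c: "x \<in> carrier G" "z \<in> carrier G"
  shows "x \<otimes> z [^] (n::nat) \<otimes> inv x = (x \<otimes> z \<otimes> inv x) [^] n"
proof (induction n)
  case (Suc n)
  have "x \<otimes> z [^] Suc n \<otimes> inv x = (x \<otimes> z [^] n \<otimes> inv x) \<otimes> (x \<otimes> z \<otimes> inv x)"
    using c by (simp add: m_assoc)
  then show ?case
    using Suc by simp
qed (use c in simp)

text \<open>Automorphisms of a cyclic group commute, as each raises all elements to a fixed power.\<close>

lemma (in group) conj_power_commute:
  assumes c: "Y \<in> carrier G" "g \<in> carrier G" "g' \<in> carrier G"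
    and conj: "g \<otimes> Y \<otimes> inv g = Y [^] (i::nat)" "g' \<otimes> Y \<otimes> inv g' = Y [^] (j::nat)"
  shows "(g \<otimes> g') \<otimes> Y \<otimes> inv (g \<otimes> g') = (g' \<otimes> g) \<otimes> Y \<otimes> inv (g' \<otimes> g)"
proof -
  have "(x \<otimes> x') \<otimes> Y \<otimes> inv (x \<otimes> x') = x \<otimes> (x' \<otimes> Y \<otimes> inv x') \<otimes> inv x"
    if "x \<in> carrier G" "x' \<in> carrier G" for x x'
    using that c by (simp add: m_assoc inv_mult_group)
  then show ?thesis
    using c conj conj_nat_pow by (simp add: nat_pow_pow mult.commute)
qed

text \<open>The twisting is expressed in terms of the generator \<open>y\<close> of \<open>H/K\<close> and the
  root of unity \<open>\<zeta>\<close>. Sending \<open>y\<close> to \<open>\<zeta>\<close> also defines a faithful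
  linear character of \<open>H/K\<close>.\<close>

locale shoda_pair = rat_group_algebra G for G :: "('a, 'b) monoid_scheme" (structure) +
  fixes H K :: "'a set" and y :: 'a and \<zeta> :: complex
  assumes strong_shoda_pair: "strong_shoda_pair G H K"
    and y_in_H: "y \<in> H"
    and y_generates: "subgroup_generated (G\<lparr>carrier := H\<rparr> Mod K) {K #> y} = G\<lparr>carrier := H\<rparr> Mod K"
    and primitive_root: "is_primitive_root \<zeta> (card (carrier (G\<lparr>carrier := H\<rparr> Mod K)))"
begin

abbreviation "N \<equiv> normalizer G K"
abbreviation "Q \<equiv> norm_group G K Mod K"
abbreviation "k \<equiv> card (carrier (G\<lparr>carrier := H\<rparr> Mod K))"

lemma subgroup_H: "subgroup H G" and subgroup_K: "subgroup K G" and K_subset_H: "K \<subseteq> H"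
  and H_normal_N: "H \<lhd> norm_group G K"
  and H_mod_K_maximal: "maximal_abelian_subgroup (carrier (G\<lparr>carrier := H\<rparr> Mod K)) Q"
  using strong_shoda_pair by (auto simp: strong_shoda_pair_def)

lemma subgroup_N: "subgroup N G"
  using normalizer_imp_subgroup subgroup.subset[OF subgroup_K] .

lemma K_normal_N: "K \<lhd> norm_group G K"
  unfolding norm_group_def using subgroup_in_normalizer[OF subgroup_K] .

lemma H_subset_N: "H \<subseteq> N"
  using subgroup.subset[OF normal_imp_subgroup[OF H_normal_N]] by (simp add: norm_group_def)

lemma H_carrier [simp]: "h \<in> H \<Longrightarrow> h \<in> carrier G"
  and K_carrier [simp]: "h \<in> K \<Longrightarrow> h \<in> carrier G"
  and N_carrier [simp]: "h \<in> N \<Longrightarrow> h \<in> carrier G"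
  and K_in_H [simp]: "h \<in> K \<Longrightarrow> h \<in> H"
  and H_in_N [simp]: "h \<in> H \<Longrightarrow> h \<in> N"
  using subgroup.mem_carrier[OF subgroup_H] subgroup.mem_carrier[OF subgroup_K]
    subgroup.mem_carrier[OF subgroup_N] K_subset_H H_subset_N by auto

lemmas H_closed = subgroup.m_closed[OF subgroup_H] subgroup.m_inv_closed[OF subgroup_H]
    subgroup.one_closed[OF subgroup_H]
  and K_closed = subgroup.m_closed[OF subgroup_K] subgroup.m_inv_closed[OF subgroup_K]
    subgroup.one_closed[OF subgroup_K]
  and N_closed = subgroup.m_closed[OF subgroup_N] subgroup.m_inv_closed[OF subgroup_N]
    subgroup.one_closed[OF subgroup_N]

lemma finite_H: "finite H" and finite_K: "finite K" and finite_N: "finite N"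
  using finite_subgroup subgroup_H subgroup_K subgroup_N by auto

lemma norm_group_inv: "g \<in> N \<Longrightarrow> inv\<^bsub>norm_group G K\<^esub> g = inv g"
  unfolding norm_group_def by (rule m_inv_consistent[OF subgroup_N])

lemma norm_group_simps [simp]:
  "carrier (norm_group G K) = N" "monoid.mult (norm_group G K) = monoid.mult G"
  "one (norm_group G K) = \<one>"
  by (simp_all add: norm_group_def)

lemma norm_group_cosets [simp]:
  "A #>\<^bsub>norm_group G K\<^esub> g = A #> g" "A <#>\<^bsub>norm_group G K\<^esub> B = A <#> B"
  by (simp_all add: r_coset_def set_mult_def)

lemma conj_in_H: "g \<in> N \<Longrightarrow> h \<in> H \<Longrightarrow> g \<otimes> h \<otimes> inv g \<in> H"
  using normal.inv_op_closed2[OF H_normal_N] by (simp add: norm_group_inv)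

lemma conj_in_K: "g \<in> N \<Longrightarrow> h \<in> K \<Longrightarrow> g \<otimes> h \<otimes> inv g \<in> K"
  using normal.inv_op_closed2[OF K_normal_N] by (simp add: norm_group_inv)

text \<open>A conjugate of the finite group \<open>K\<close> that is contained in \<open>K\<close> is all of
  \<open>K\<close>.\<close>

lemma in_N_I:
  assumes g: "g \<in> carrier G" and "\<And>h. h \<in> K \<Longrightarrow> g \<otimes> h \<otimes> inv g \<in> K"
  shows "g \<in> N"
proof -
  have im: "g <# K #> inv g = (\<lambda>h. g \<otimes> h \<otimes> inv g) ` K"
    by (auto simp: l_coset_def r_coset_def)
  moreover have "inj_on (\<lambda>h. g \<otimes> h \<otimes> inv g) K"
    using g by (intro inj_onI) simp
  ultimately have "g <# K #> inv g = K"
    using assms(2) finite_K card_subset_eq[of K "(\<lambda>h. g \<otimes> h \<otimes> inv g) ` K"]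
    by (simp only: card_image image_subset_iff) blast
  then show ?thesis
    using g subgroup.subset[OF subgroup_K] unfolding normalizer_def stabilizer_def by simp
qed

lemma group_Q: "group Q"
  by (rule normal.factorgroup_is_group[OF K_normal_N])

lemma carrier_Q: "carrier Q = (\<lambda>g. K #> g) ` N"
  by (simp add: carrier_FactGroup)

lemma Q_mult: "g \<in> N \<Longrightarrow> g' \<in> N \<Longrightarrow> (K #> g) \<otimes>\<^bsub>Q\<^esub> (K #> g') = K #> (g \<otimes> g')"
  using normal.rcos_sum[OF K_normal_N] by simp

lemma Q_inv: "g \<in> N \<Longrightarrow> inv\<^bsub>Q\<^esub> (K #> g) = K #> inv g"
  using normal.inv_FactGroup[OF K_normal_N] normal.rcos_inv[OF K_normal_N] norm_group_inv
  by (simp add: carrier_Q)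

lemma norm_group_pow: "g [^]\<^bsub>norm_group G K\<^esub> (j::nat) = g [^] j"
  using nat_pow_consistent[of g j N] by (simp add: norm_group_def)

lemma Q_pow: "g \<in> N \<Longrightarrow> (K #> g) [^]\<^bsub>Q\<^esub> (j::nat) = K #> (g [^] j)"
  using normal.FactGroup_pow[OF K_normal_N] by (simp add: norm_group_pow)

lemma coset_eq_iff:
  assumes "subgroup S G" "g \<in> carrier G" "g' \<in> carrier G"
  shows "S #> g = S #> g' \<longleftrightarrow> g \<otimes> inv g' \<in> S"
proof
  assume "S #> g = S #> g'"
  then have "g \<in> S #> g'"
    using rcos_self assms by metis
  then show "g \<otimes> inv g' \<in> S"
    using assms subgroup.mem_carrier[OF assms(1)] by (auto simp: r_coset_def m_assoc)
next
  assume "g \<otimes> inv g' \<in> S"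
  then have "(g \<otimes> inv g') \<otimes> g' \<in> S #> g'"
    unfolding r_coset_def by blast
  then have "g \<in> S #> g'"
    using assms by (simp add: m_assoc)
  then show "S #> g = S #> g'"
    using repr_independence assms by metis
qed

lemma K_normal_H: "K \<lhd> G\<lparr>carrier := H\<rparr>"
proof -
  interpret H: group "G\<lparr>carrier := H\<rparr>"
    by (rule subgroup_imp_group[OF subgroup_H])
  have "subgroup K (G\<lparr>carrier := H\<rparr>)"
    using subgroup_incl[OF subgroup_K subgroup_H K_subset_H] .
  then show ?thesis
    using conj_in_K subgroup_H by (simp add: H.normal_inv_iff)
qed

lemma HK_cosets: "carrier (G\<lparr>carrier := H\<rparr> Mod K) = (\<lambda>g. K #> g) ` H"
  by (auto simp: carrier_FactGroup r_coset_def)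

lemma finite_HK: "finite (carrier (G\<lparr>carrier := H\<rparr> Mod K))"
  by (simp add: HK_cosets finite_H)

lemma HK_pow: "g \<in> H \<Longrightarrow> (K #> g) [^]\<^bsub>G\<lparr>carrier := H\<rparr> Mod K\<^esub> (j::nat) = K #> (g [^] j)"
  using normal.FactGroup_pow[OF K_normal_H, of g j] nat_pow_consistent[of g j H]
  by (simp add: r_coset_def)

lemma coset_generated:
  shows "carrier (G\<lparr>carrier := H\<rparr> Mod K) = generate (G\<lparr>carrier := H\<rparr> Mod K) {K #> y}"
proof -
  have "K #> y \<in> carrier (G\<lparr>carrier := H\<rparr> Mod K)"
    using y_in_H by (simp add: HK_cosets)
  then show ?thesis
    using carrier_subgroup_generated[of "G\<lparr>carrier := H\<rparr> Mod K" "{K #> y}"] y_generates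
    by (simp add: Int_absorb1)
qed

lemma coset_power_of_y:
  assumes "h \<in> H"
  shows "\<exists>j::nat. K #> h = K #> (y [^] j)"
proof -
  interpret HK: group "G\<lparr>carrier := H\<rparr> Mod K"
    by (rule normal.factorgroup_is_group[OF K_normal_H])
  have "K #> h \<in> generate (G\<lparr>carrier := H\<rparr> Mod K) {K #> y}"
    using assms unfolding coset_generated[symmetric] by (simp add: HK_cosets)
  then show ?thesis
    using HK.generate_pow_on_finite_carrier[OF finite_HK, of "K #> y"] y_in_H
    by (auto simp: HK_cosets HK_pow)
qed

lemma y_power_in_K: "y [^] (j::nat) \<in> K \<longleftrightarrow> k dvd j"
proof -
  interpret HK: group "G\<lparr>carrier := H\<rparr> Mod K"
    by (rule normal.factorgroup_is_group[OF K_normal_H])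
  have Y: "K #> y \<in> carrier (G\<lparr>carrier := H\<rparr> Mod K)"
    using y_in_H by (simp add: HK_cosets)
  have "y [^] j \<in> K \<longleftrightarrow> K #> (y [^] j) = K"
    using y_in_H coset_join1 coset_join2 subgroup_K by (metis H_carrier nat_pow_closed subgroup.subset)
  also have "\<dots> \<longleftrightarrow> HK.ord (K #> y) dvd j"
    using HK.pow_eq_id[OF Y, of j] y_in_H by (simp add: HK_pow)
  also have "HK.ord (K #> y) = k"
    using HK.generate_pow_card[OF Y] coset_generated by simp
  finally show ?thesis .
qed

lemma k_pos: "k > 0"
proof -
  have "carrier (G\<lparr>carrier := H\<rparr> Mod K) \<noteq> {}"
    using y_in_H by (auto simp: HK_cosets)
  then show ?thesis
    using finite_HK by (simp add: card_gt_0_iff)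
qed

lemma y_pow_in_H: "y [^] (j::nat) \<in> H"
  using subgroup_int_pow_closed[OF subgroup_H y_in_H, of "int j"] by (simp add: int_pow_int)

lemma commutator_in_K:
  assumes "h \<in> H" "h' \<in> H"
  shows "(h \<otimes> h') \<otimes> inv (h' \<otimes> h) \<in> K"
proof -
  interpret Q: group Q by (rule group_Q)
  from coset_power_of_y[OF assms(1)] obtain i :: nat where i: "K #> h = K #> (y [^] i)" ..
  from coset_power_of_y[OF assms(2)] obtain j :: nat where j: "K #> h' = K #> (y [^] j)" ..
  have y: "y [^] n \<in> N" for n :: nat
    using y_pow_in_H by simp
  have swap: "(K #> (y [^] i)) \<otimes>\<^bsub>Q\<^esub> (K #> (y [^] j)) = (K #> (y [^] j)) \<otimes>\<^bsub>Q\<^esub> (K #> (y [^] i))"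
    unfolding Q_mult[OF y y] using y_in_H by (simp add: nat_pow_mult add.commute)
  have "K #> (h \<otimes> h') = (K #> h) \<otimes>\<^bsub>Q\<^esub> (K #> h')"
    by (rule Q_mult[symmetric]) (use assms in auto)
  also have "\<dots> = (K #> h') \<otimes>\<^bsub>Q\<^esub> (K #> h)"
    unfolding i j by (rule swap)
  also have "\<dots> = K #> (h' \<otimes> h)"
    by (rule Q_mult) (use assms in auto)
  finally show ?thesis
    using coset_eq_iff[OF subgroup_K] assms by simp
qed

text \<open>Together with \<open>H/K\<close>, an element that centralizes \<open>H/K\<close> generates an
  abelian subgroup of \<open>N/K\<close>. By maximality this subgroup is \<open>H/K\<close> itself.\<close>

lemma in_H_if_centralizes_y:
  assumes g: "g \<in> N" and comm: "(g \<otimes> y) \<otimes> inv (y \<otimes> g) \<in> K"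
  shows "g \<in> H"
proof -
  interpret Q: group Q by (rule group_Q)
  let ?X = "K #> g" and ?Y = "K #> y"
  have XY: "?Y \<in> carrier Q" "?X \<in> carrier Q"
    using g y_in_H by (auto simp: carrier_Q)
  have "K #> (g \<otimes> y) = K #> (y \<otimes> g)"
    using coset_eq_iff[OF subgroup_K] g y_in_H comm by simp
  then have comm: "?Y \<otimes>\<^bsub>Q\<^esub> ?X = ?X \<otimes>\<^bsub>Q\<^esub> ?Y"
    using Q_mult[of g y] Q_mult[of y g] g y_in_H by simp
  define B where "B = {?Y [^]\<^bsub>Q\<^esub> (i::int) \<otimes>\<^bsub>Q\<^esub> ?X [^]\<^bsub>Q\<^esub> (j::int) | i j. True}"
  note B = Q.commuting_pair_abelian_subgroup[OF XY comm, folded B_def]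
  have "carrier (G\<lparr>carrier := H\<rparr> Mod K) \<subseteq> B"
  proof
    fix C assume "C \<in> carrier (G\<lparr>carrier := H\<rparr> Mod K)"
    then obtain j :: nat where "C = K #> (y [^] j)"
      using coset_power_of_y by (auto simp: HK_cosets)
    then have "C = ?Y [^]\<^bsub>Q\<^esub> int j \<otimes>\<^bsub>Q\<^esub> ?X [^]\<^bsub>Q\<^esub> (0::int)"
      using y_in_H XY Q.r_one[of "?Y [^]\<^bsub>Q\<^esub> j"] Q.nat_pow_closed[OF XY(1), of j]
      by (simp add: int_pow_int Q_pow del: mult_FactGroup one_FactGroup)
    then show "C \<in> B" unfolding B_def by blast
  qed
  then have "B = carrier (G\<lparr>carrier := H\<rparr> Mod K)"
    using H_mod_K_maximal B by (simp add: maximal_abelian_subgroup_def)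
  moreover have "?X = ?Y [^]\<^bsub>Q\<^esub> (0::int) \<otimes>\<^bsub>Q\<^esub> ?X [^]\<^bsub>Q\<^esub> (1::int)"
    using XY Q.l_one by (simp del: mult_FactGroup one_FactGroup)
  then have "?X \<in> B" unfolding B_def by blast
  ultimately obtain h where h: "h \<in> H" "K #> g = K #> h"
    by (auto simp: HK_cosets)
  then have "g \<otimes> inv h \<in> H"
    using coset_eq_iff[OF subgroup_K] g by simp
  then have "g \<otimes> inv h \<otimes> h \<in> H"
    using h by (simp add: H_closed)
  then show ?thesis
    using g h by (simp add: m_assoc)
qed

text \<open>The quotient \<open>N/H\<close> acts faithfully on the cyclic group \<open>H/K\<close>, hence it is abelian.\<close>

lemma N_mod_H_abelian:
  assumes g: "g \<in> N" "g' \<in> N"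
  shows "(g \<otimes> g') \<otimes> inv (g' \<otimes> g) \<in> H"
proof -
  interpret Q: group Q by (rule group_Q)
  have conj: "\<exists>i::nat. (K #> g) \<otimes>\<^bsub>Q\<^esub> (K #> y) \<otimes>\<^bsub>Q\<^esub> inv\<^bsub>Q\<^esub> (K #> g) = (K #> y) [^]\<^bsub>Q\<^esub> i"
    if "g \<in> N" for g
    using coset_power_of_y[OF conj_in_H[OF that y_in_H]] that y_in_H
    by (simp add: Q_mult Q_inv Q_pow N_closed del: mult_FactGroup)
  obtain i j :: nat where
    "(K #> g) \<otimes>\<^bsub>Q\<^esub> (K #> y) \<otimes>\<^bsub>Q\<^esub> inv\<^bsub>Q\<^esub> (K #> g) = (K #> y) [^]\<^bsub>Q\<^esub> i"
    "(K #> g') \<otimes>\<^bsub>Q\<^esub> (K #> y) \<otimes>\<^bsub>Q\<^esub> inv\<^bsub>Q\<^esub> (K #> g') = (K #> y) [^]\<^bsub>Q\<^esub> j"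
    using conj g by metis
  from Q.conj_power_commute[OF _ _ _ this]
  have "K #> ((g \<otimes> g') \<otimes> y \<otimes> inv (g \<otimes> g')) = K #> ((g' \<otimes> g) \<otimes> y \<otimes> inv (g' \<otimes> g))"
    using g y_in_H by (simp add: Q_mult Q_inv carrier_Q N_closed del: mult_FactGroup)
  then have in_K: "((g \<otimes> g') \<otimes> y \<otimes> inv (g \<otimes> g')) \<otimes> inv ((g' \<otimes> g) \<otimes> y \<otimes> inv (g' \<otimes> g)) \<in> K"
    using coset_eq_iff[OF subgroup_K] g y_in_H by simp
  define c where "c = inv (g' \<otimes> g) \<otimes> (g \<otimes> g')"
  have c: "c \<in> N" using g by (simp add: c_def N_closed)
  have "inv (g' \<otimes> g) \<otimes> (((g \<otimes> g') \<otimes> y \<otimes> inv (g \<otimes> g')) \<otimes> inv ((g' \<otimes> g) \<otimes> y \<otimes> inv (g' \<otimes> g)))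
      \<otimes> inv (inv (g' \<otimes> g)) \<in> K"
    by (rule conj_in_K[OF _ in_K]) (use g in \<open>simp add: N_closed\<close>)
  also have "inv (g' \<otimes> g) \<otimes> (((g \<otimes> g') \<otimes> y \<otimes> inv (g \<otimes> g')) \<otimes> inv ((g' \<otimes> g) \<otimes> y \<otimes> inv (g' \<otimes> g)))
      \<otimes> inv (inv (g' \<otimes> g)) = (c \<otimes> y) \<otimes> inv (y \<otimes> c)"
  proof -
    define p q where "p = g \<otimes> g'" and "q = g' \<otimes> g"
    have "p \<in> carrier G" "q \<in> carrier G" "y \<in> carrier G"
      using g y_in_H by (auto simp: p_def q_def)
    then show ?thesis
      unfolding c_def p_def[symmetric] q_def[symmetric]
      by (simp add: inv_mult_group m_assoc) 
  qed
  finally have "c \<in> H"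
    using in_H_if_centralizes_y c by blast
  then have "(g' \<otimes> g) \<otimes> c \<otimes> inv (g' \<otimes> g) \<in> H"
    using conj_in_H g by (simp add: N_closed)
  then show ?thesis
    using g by (simp add: c_def m_assoc)
qed

end

section \<open>The idempotent of the pair\<close>

context shoda_pair
begin

abbreviation "\<epsilon> \<equiv> shoda_eps G H K"

text \<open>Conjugation by \<open>g\<close> raises the elements of the cyclic group \<open>H/K\<close> to a fixed power, so it
  preserves every subgroup between \<open>K\<close> and \<open>H\<close>.\<close>

lemma conj_in_intermediate:
  assumes g: "g \<in> N" and M: "subgroup M G" "K \<subseteq> M" "M \<subseteq> H" and m: "m \<in> M"
  shows "g \<otimes> m \<otimes> inv g \<in> M"
proof -
  interpret Q: group Q by (rule group_Q)
  let ?x = "K #> g" and ?z = "K #> y"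
  have mH: "m \<in> H" using M m by auto
  from coset_power_of_y[OF conj_in_H[OF g y_in_H]] obtain a :: nat
    where a: "K #> (g \<otimes> y \<otimes> inv g) = K #> (y [^] a)" ..
  from coset_power_of_y[OF mH] obtain j :: nat where j: "K #> m = K #> (y [^] j)" ..
  have xz: "?x \<in> carrier Q" "?z \<in> carrier Q"
    using g y_in_H by (auto simp: carrier_Q)
  have conj: "?x \<otimes>\<^bsub>Q\<^esub> ?z \<otimes>\<^bsub>Q\<^esub> inv\<^bsub>Q\<^esub> ?x = ?z [^]\<^bsub>Q\<^esub> a"
    using a g y_in_H by (simp add: Q_mult Q_inv Q_pow N_closed del: mult_FactGroup)
  have m_pow: "K #> m = ?z [^]\<^bsub>Q\<^esub> j"
    using j y_in_H by (simp add: Q_pow)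
  have "K #> (g \<otimes> m \<otimes> inv g) = ?x \<otimes>\<^bsub>Q\<^esub> (K #> m) \<otimes>\<^bsub>Q\<^esub> inv\<^bsub>Q\<^esub> ?x"
    using g mH by (simp add: Q_mult Q_inv N_closed del: mult_FactGroup)
  also have "\<dots> = (K #> m) [^]\<^bsub>Q\<^esub> a"
    unfolding m_pow Q.conj_nat_pow[OF xz] conj Q.nat_pow_pow[OF xz(2)] by (simp only: mult.commute)
  also have "\<dots> = K #> (m [^] a)"
    using mH by (intro Q_pow) simp
  finally have "(g \<otimes> m \<otimes> inv g) \<otimes> inv (m [^] a) \<in> K"
    using coset_eq_iff[OF subgroup_K] g mH by simp
  moreover have "m [^] a \<in> M"
    using subgroup_int_pow_closed[OF M(1) m, of "int a"] by (simp add: int_pow_int)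
  ultimately have "(g \<otimes> m \<otimes> inv g) \<otimes> inv (m [^] a) \<otimes> m [^] a \<in> M"
    using subgroup.m_closed[OF M(1)] M(2) by blast
  then show ?thesis
    using g mH by (simp add: m_assoc)
qed

lemma normal_above_iff:
  assumes "K \<subseteq> M"
  shows "M \<lhd> G\<lparr>carrier := H\<rparr> \<longleftrightarrow> subgroup M G \<and> M \<subseteq> H"
proof
  assume "M \<lhd> G\<lparr>carrier := H\<rparr>"
  then have "subgroup M (G\<lparr>carrier := H\<rparr>)"
    by (rule normal_imp_subgroup)
  then show "subgroup M G \<and> M \<subseteq> H"
    using incl_subgroup[OF subgroup_H] subgroup.subset by fastforce
next
  assume M: "subgroup M G \<and> M \<subseteq> H"
  interpret H: group "G\<lparr>carrier := H\<rparr>"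
    by (rule subgroup_imp_group[OF subgroup_H])
  show "M \<lhd> G\<lparr>carrier := H\<rparr>"
    using M subgroup_incl[of M H] subgroup_H conj_in_intermediate[OF _ _ assms]
    by (simp add: H.normal_inv_iff)
qed

definition intermediate :: "'a set set" where
  "intermediate = {M. subgroup M G \<and> K \<subseteq> M \<and> M \<subseteq> H}"

abbreviation "minimal \<equiv> minimal_normal_above G H K"

lemma minimal_eq:
  "minimal = {M \<in> intermediate. M \<noteq> K \<and> (\<forall>M' \<in> intermediate. M' \<noteq> K \<and> M' \<subseteq> M \<longrightarrow> M' = M)}"
proof -
  have iff: "M \<lhd> G\<lparr>carrier := H\<rparr> \<and> K \<subset> M \<longleftrightarrow> M \<in> intermediate \<and> M \<noteq> K" for M
    using normal_above_iff[of M] by (auto simp: intermediate_def)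
  show ?thesis
    by (simp only: minimal_normal_above_def conj_assoc[symmetric] iff) (auto simp: Ball_def)
qed

lemma finite_intermediate: "finite intermediate"
  by (rule finite_subset[of _ "Pow H"]) (auto simp: intermediate_def finite_H)

lemma minimal_subset_intermediate: "minimal \<subseteq> intermediate"
  by (auto simp: minimal_eq)

lemma minimal_below:
  assumes "S \<in> intermediate" "S \<noteq> K"
  obtains M where "M \<in> minimal" "M \<subseteq> S"
proof -
  let ?A = "{M \<in> intermediate. M \<noteq> K \<and> M \<subseteq> S}"
  have "finite ?A" "?A \<noteq> {}"
    using finite_intermediate assms by auto
  from finite_has_minimal[OF this] obtain M
    where M: "M \<in> ?A" and min: "\<forall>L\<in>?A. L \<subseteq> M \<longrightarrow> M = L" ..
  have "L = M" if "L \<in> intermediate" "L \<noteq> K" "L \<subseteq> M" for L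
    using bspec[OF min, of L] M that by auto
  then have "M \<in> minimal"
    using M unfolding minimal_eq by simp
  with M that show ?thesis by simp
qed

subsection \<open>The product of the factors\<close>

lemma minus_group_algebra:
  assumes "f \<in> supp (carrier G)" "g \<in> supp (carrier G)"
  shows "f \<ominus>\<^bsub>group_algebra G\<^esub> g = f - g"
proof -
  have "\<ominus>\<^bsub>group_algebra G\<^esub> g = - g"
    unfolding a_inv_def m_inv_def
  proof (rule the_equality)
    show "- g \<in> carrier (add_monoid (group_algebra G)) \<and>
      g \<otimes>\<^bsub>add_monoid (group_algebra G)\<^esub> - g = \<one>\<^bsub>add_monoid (group_algebra G)\<^esub> \<and>
      - g \<otimes>\<^bsub>add_monoid (group_algebra G)\<^esub> g = \<one>\<^bsub>add_monoid (group_algebra G)\<^esub>"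
      using assms(2) by (auto simp: carrier_group_algebra add_group_algebra zero_group_algebra supp_def)
  qed (auto simp: add_group_algebra zero_group_algebra eq_neg_iff_add_eq_0)
  then show ?thesis
    by (simp add: a_minus_def add_group_algebra)
qed

text \<open>Commuting with all of \<open>N\<close>, not only with \<open>H\<close>, makes the invariance of
  \<open>\<epsilon>\<close> under \<open>N\<close> part of the same induction as its centrality in
  \<open>\<rat>H\<close>.\<close>

definition central :: "('a \<Rightarrow> rat) \<Rightarrow> bool" where
  "central v \<longleftrightarrow> v \<in> supp H \<and> (\<forall>g\<in>N. \<delta> g \<star> v = v \<star> \<delta> g)"

lemma central_commute: "central v \<Longrightarrow> f \<in> supp H \<Longrightarrow> f \<star> v = v \<star> f"
  by (rule commute_supp[OF finite_H]) (auto simp: central_def)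

lemma supp_H_carrier: "f \<in> supp H \<Longrightarrow> f \<in> supp (carrier G)"
  by (erule supp_mono) (use subgroup.subset[OF subgroup_H] in blast)

lemma central_star: "central v \<Longrightarrow> central w \<Longrightarrow> central (v \<star> w)"
proof -
  assume "central v" "central w"
  moreover have "\<delta> h \<star> (v \<star> w) = v \<star> w \<star> \<delta> h" if "h \<in> N" for h
  proof -
    have "\<delta> h \<star> (v \<star> w) = (\<delta> h \<star> v) \<star> w"
      by (simp add: star_assoc)
    also have "\<dots> = v \<star> (\<delta> h \<star> w)"
      using \<open>central v\<close> that by (simp add: central_def star_assoc)
    also have "\<dots> = v \<star> w \<star> \<delta> h"
      using \<open>central w\<close> that by (simp add: central_def star_assoc)
    finally show ?thesis .
  qed
  ultimately show "central (v \<star> w)"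
    by (simp add: central_def supp_star[OF subgroup_H])
qed

lemma central_diff: "central v \<Longrightarrow> central w \<Longrightarrow> central (v - w)"
  by (auto simp: central_def star_diff_left star_diff_right)

lemma intermediate_carrier: "M \<in> intermediate \<Longrightarrow> M \<subseteq> carrier G"
  by (auto simp: intermediate_def)

lemma central_hat:
  assumes "M \<in> intermediate"
  shows "central (hat M)"
proof -
  have M: "subgroup M G" "K \<subseteq> M" "M \<subseteq> H" "M \<subseteq> carrier G"
    using assms intermediate_carrier by (auto simp: intermediate_def)
  have "\<delta> g \<star> hat M = hat M \<star> \<delta> g" if g: "g \<in> N" for g
  proof -
    let ?c = "\<lambda>m. g \<otimes> m \<otimes> inv g"
    have "card (?c ` M) = card M"
      using g M(4) by (intro card_image inj_onI) (auto simp: subset_iff)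
    moreover have "?c ` M \<subseteq> M"
      using conj_in_intermediate[OF g M(1,2,3)] by blast
    ultimately have "?c ` M = M"
      using card_subset_eq[OF finite_subgroup[OF M(1)]] by simp
    then have "conj_by G g (hat M) = hat M"
      using conj_by_hat[of g M] g M(4) by simp
    then show ?thesis
      using conj_by_eq_self_iff[of g "hat M"] supp_mono[OF supp_hat M(4)] g by simp
  qed
  then show ?thesis
    using supp_mono[OF supp_hat M(3)] by (auto simp: central_def)
qed

lemma K_intermediate: "K \<in> intermediate"
  using subgroup_K K_subset_H by (simp add: intermediate_def)

lemma hat_star_hat:
  assumes "M \<in> intermediate" "L \<in> intermediate" "L \<subseteq> M"
  shows "hat L \<star> hat M = hat M"
  using assms by (intro hat_star_fixed)
    (auto simp: intermediate_def finite_subgroup delta_star_hat subset_iff dest: subgroup.one_closed)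

definition factor :: "'a set \<Rightarrow> ('a \<Rightarrow> rat)" where
  "factor M = hat K - hat M"

definition eps_prod :: "'a set set \<Rightarrow> ('a \<Rightarrow> rat)" where
  "eps_prod A = (\<Otimes>\<^bsub>group_algebra G\<^esub> M \<in> A. hat K \<ominus>\<^bsub>group_algebra G\<^esub> hat M)"

lemma central_factor: "M \<in> intermediate \<Longrightarrow> central (factor M)"
  unfolding factor_def using central_diff central_hat K_intermediate by simp

lemma factor_eq: "M \<in> intermediate \<Longrightarrow> hat K \<ominus>\<^bsub>group_algebra G\<^esub> hat M = factor M"
  unfolding factor_def
  using central_hat K_intermediate by (intro minus_group_algebra supp_H_carrier) (auto simp: central_def)

text \<open>The fold over the factors can be unfolded one factor at a time because they commute with each other,
  although the group algebra is not commutative.\<close>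

lemma eps_prod_insert:
  assumes "A \<subseteq> intermediate" "M \<in> intermediate" "M \<notin> A"
  shows "eps_prod (insert M A) = factor M \<star> eps_prod A"
proof -
  interpret LCD intermediate "carrier (group_algebra G)"
    "(\<otimes>\<^bsub>group_algebra G\<^esub>) \<circ> (\<lambda>M. hat K \<ominus>\<^bsub>group_algebra G\<^esub> hat M)"
  proof
    fix x y z assume "x \<in> intermediate" "y \<in> intermediate"
    then have "factor x \<star> factor y = factor y \<star> factor x"
      using central_commute central_factor by (simp add: central_def)
    with \<open>x \<in> intermediate\<close> \<open>y \<in> intermediate\<close>
    show "((\<otimes>\<^bsub>group_algebra G\<^esub>) \<circ> (\<lambda>M. hat K \<ominus>\<^bsub>group_algebra G\<^esub> hat M)) x
        (((\<otimes>\<^bsub>group_algebra G\<^esub>) \<circ> (\<lambda>M. hat K \<ominus>\<^bsub>group_algebra G\<^esub> hat M)) y z) =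
      ((\<otimes>\<^bsub>group_algebra G\<^esub>) \<circ> (\<lambda>M. hat K \<ominus>\<^bsub>group_algebra G\<^esub> hat M)) y
        (((\<otimes>\<^bsub>group_algebra G\<^esub>) \<circ> (\<lambda>M. hat K \<ominus>\<^bsub>group_algebra G\<^esub> hat M)) x z)"
      by (simp add: factor_eq star_assoc[symmetric])
  qed (simp add: carrier_group_algebra)
  have "finite A" using assms(1) finite_intermediate finite_subset by blast
  then show ?thesis
    using foldD_insert[of A M "\<one>\<^bsub>group_algebra G\<^esub>"] assms
    by (simp add: eps_prod_def finprod_def factor_eq carrier_group_algebra one_group_algebra supp_delta)
qed

lemma eps_prod_empty: "eps_prod {} = \<delta> \<one>"
  by (simp add: eps_prod_def finprod_def carrier_group_algebra one_group_algebra supp_delta)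

lemma factor_props:
  assumes "M \<in> intermediate"
  shows "factor M \<star> factor M = factor M" "hat K \<star> factor M = factor M" "hat M \<star> factor M = 0"
proof -
  have sub: "K \<subseteq> M" using assms by (simp add: intermediate_def)
  have comm: "hat M \<star> hat K = hat K \<star> hat M"
    using central_commute[of "hat K" "hat M"] central_hat assms K_intermediate by (simp add: central_def)
  show 1: "hat K \<star> factor M = factor M" "hat M \<star> factor M = 0"
    using hat_star_hat[OF assms K_intermediate sub] hat_star_hat[OF assms assms] hat_star_hat[OF K_intermediate K_intermediate]
    by (simp_all add: factor_def star_diff_right comm)
  show "factor M \<star> factor M = factor M"
    by (subst (1) factor_def) (simp add: star_diff_left 1)
qed

text \<open>Each factor is an idempotent annihilated by the average of its subgroup. As the factors commute,
  both properties pass to their product.\<close>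

lemma eps_prod_props:
  assumes "A \<subseteq> intermediate"
  shows "central (eps_prod A) \<and> eps_prod A \<star> eps_prod A = eps_prod A \<and>
    (A \<noteq> {} \<longrightarrow> hat K \<star> eps_prod A = eps_prod A) \<and> (\<forall>M\<in>A. hat M \<star> eps_prod A = 0)"
proof -
  have "finite A" using assms finite_intermediate finite_subset by blast
  then show ?thesis
    using assms
  proof (induction A rule: finite_induct)
    case empty
    then show ?case
      by (auto simp: eps_prod_empty central_def supp_delta H_closed)
  next
    case (insert M A)
    let ?f = "factor M" and ?p = "eps_prod A"
    have M: "M \<in> intermediate" and p: "central ?p" "?p \<star> ?p = ?p" "\<forall>M\<in>A. hat M \<star> eps_prod A = 0"
      using insert by auto
    have eq: "eps_prod (insert M A) = ?f \<star> ?p"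
      using insert by (intro eps_prod_insert) auto
    have comm: "?p \<star> ?f = ?f \<star> ?p"
      using central_commute[OF central_factor[OF M]] p(1) by (simp add: central_def)
    have "(?f \<star> ?p) \<star> (?f \<star> ?p) = ?f \<star> (?p \<star> ?f) \<star> ?p"
      by (simp add: star_assoc)
    also have "\<dots> = (?f \<star> ?f) \<star> (?p \<star> ?p)"
      by (simp add: comm star_assoc)
    finally have "(?f \<star> ?p) \<star> (?f \<star> ?p) = ?f \<star> ?p"
      by (simp add: factor_props(1)[OF M] p(2))
    moreover have "hat M' \<star> (?f \<star> ?p) = 0" if "M' \<in> insert M A" for M'
    proof (cases "M' = M")
      case True
      then show ?thesis
        using factor_props(3)[OF M] by (simp add: star_assoc[symmetric])
    next
      case False
      then have "hat M' \<star> ?p = 0" using that p(3) by auto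
      then show ?thesis
        using comm by (metis star_assoc star_zero_left)
    qed
    moreover have "hat K \<star> (?f \<star> ?p) = ?f \<star> ?p"
      using factor_props(2)[OF M] by (simp add: star_assoc[symmetric])
    ultimately show ?case
      unfolding eq using central_star[OF central_factor[OF M] p(1)] by blast
  qed
qed

subsection \<open>A faithful linear character of \<open>H/K\<close>\<close>

text \<open>The linear extension of this character takes the value 1 at every factor of
  \<open>\<epsilon>\<close>, hence at \<open>\<epsilon>\<close>, which is therefore nonzero.\<close>

definition character :: "'a \<Rightarrow> complex" where
  "character h = \<zeta> ^ (SOME j::nat. K #> h = K #> (y [^] j))"

lemma root_power_eq:
  assumes "k dvd j"
  shows "\<zeta> ^ (i + j) = \<zeta> ^ i"
  using assms primitive_root by (auto simp: is_primitive_root_def power_add power_mult elim!: dvdE)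

lemma character_eqI:
  assumes h: "h \<in> H" and j: "K #> h = K #> (y [^] (j::nat))"
  shows "character h = \<zeta> ^ j"
proof -
  define i where "i = (SOME j::nat. K #> h = K #> (y [^] j))"
  have i: "K #> h = K #> (y [^] i)"
    unfolding i_def using j by (rule someI)
  have dvd: "k dvd b - a"
    if "K #> (y [^] a) = K #> (y [^] b)" "a \<le> b" for a b :: nat
  proof -
    have "y [^] b \<otimes> inv (y [^] a) \<in> K"
      using coset_eq_iff[OF subgroup_K, of "y [^] b" "y [^] a"] that(1) y_in_H by simp
    moreover have "y [^] b = y [^] (b - a) \<otimes> y [^] a"
      using that(2) y_in_H by (simp add: nat_pow_mult)
    ultimately have "y [^] (b - a) \<in> K"
      using y_in_H by (simp add: m_assoc)
    then show ?thesis
      by (simp add: y_power_in_K)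
  qed
  have "\<zeta> ^ i = \<zeta> ^ j"
  proof (cases "i \<le> j")
    case True
    then show ?thesis
      using root_power_eq[OF dvd[of i j], of i] i j by simp
  next
    case False
    then show ?thesis
      using root_power_eq[OF dvd[of j i], of j] i j by simp
  qed
  then show ?thesis
    by (simp add: character_def i_def)
qed

lemma character_mult:
  assumes "h \<in> H" "h' \<in> H"
  shows "character (h \<otimes> h') = character h * character h'"
proof -
  from coset_power_of_y[OF assms(1)] obtain i :: nat where i: "K #> h = K #> (y [^] i)" ..
  from coset_power_of_y[OF assms(2)] obtain j :: nat where j: "K #> h' = K #> (y [^] j)" ..
  have y: "y [^] n \<in> N" for n :: nat
    using y_pow_in_H by simp
  have "K #> (h \<otimes> h') = (K #> h) \<otimes>\<^bsub>Q\<^esub> (K #> h')"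
    by (rule Q_mult[symmetric]) (use assms in auto)
  also have "\<dots> = K #> (y [^] (i + j))"
    unfolding i j Q_mult[OF y y] using y_in_H by (simp add: nat_pow_mult)
  finally show ?thesis
    using character_eqI assms i j H_closed(1) by (simp add: power_add)
qed

lemma character_eq_1_iff:
  assumes "h \<in> H"
  shows "character h = 1 \<longleftrightarrow> h \<in> K"
proof -
  from coset_power_of_y[OF assms] obtain j :: nat where j: "K #> h = K #> (y [^] j)" ..
  have in_K: "g \<in> K \<longleftrightarrow> K #> g = K" if "g \<in> carrier G" for g
    using coset_join1[OF _ that subgroup_K] coset_join2[OF that subgroup_K] by (rule iffI[rotated])
  have "h \<in> K \<longleftrightarrow> K #> h = K"
    using assms by (intro in_K) simp
  also have "\<dots> \<longleftrightarrow> y [^] j \<in> K"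
    unfolding j using y_in_H by (intro in_K[symmetric]) simp
  also have "\<dots> \<longleftrightarrow> k dvd j"
    by (rule y_power_in_K)
  also have "\<dots> \<longleftrightarrow> \<zeta> ^ j = 1"
  proof
    assume "k dvd j"
    then show "\<zeta> ^ j = 1"
      using root_power_eq[of j 0] by simp
  next
    assume *: "\<zeta> ^ j = 1"
    have "\<zeta> ^ (j mod k + k * (j div k)) = \<zeta> ^ (j mod k)"
      by (rule root_power_eq) simp
    then have "\<zeta> ^ (j mod k) = 1"
      using * by simp
    moreover have "j mod k < k"
      using k_pos by simp
    moreover have "\<zeta> ^ m \<noteq> 1" if "0 < m" "m < k" for m
      using primitive_root that unfolding is_primitive_root_def by simp
    ultimately have "\<not> 0 < j mod k"
      by (metis (no_types))
    then show "k dvd j"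
      by (simp add: dvd_eq_mod_eq_0)
  qed
  finally show ?thesis
    using character_eqI[OF assms j] by simp
qed

definition char_sum :: "('a \<Rightarrow> rat) \<Rightarrow> complex" where
  "char_sum f = (\<Sum>h\<in>H. of_rat (f h) * character h)"

lemma char_sum_add: "char_sum (f + g) = char_sum f + char_sum g"
  and char_sum_diff: "char_sum (f - g) = char_sum f - char_sum g"
  and char_sum_scale: "char_sum (c *\<^sub>Q f) = of_rat c * char_sum f"
  and char_sum_zero: "char_sum 0 = 0"
  by (simp_all add: char_sum_def of_rat_add of_rat_diff of_rat_mult algebra_simps sum.distrib fun_apply_simps
      sum_subtractf sum_distrib_left)

lemma char_sum_delta:
  assumes "h \<in> H"
  shows "char_sum (\<delta> h) = character h"
proof -
  have "char_sum (\<delta> h) = (\<Sum>x\<in>H. if x = h then character x else 0)"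
    unfolding char_sum_def by (intro sum.cong) (auto simp: group_elem_def)
  then show ?thesis
    using assms finite_H by simp
qed

lemma char_sum_delta_star:
  assumes h: "h \<in> H"
  shows "char_sum (\<delta> h \<star> f) = character h * char_sum f"
proof -
  have "char_sum (\<delta> h \<star> f) = (\<Sum>x\<in>H. of_rat (f (inv h \<otimes> x)) * character x)"
    unfolding char_sum_def using h by (intro sum.cong) (auto simp: delta_star_apply)
  also have "\<dots> = (\<Sum>x\<in>H. of_rat (f x) * character (h \<otimes> x))"
    by (rule sum.reindex_bij_witness[of _ "\<lambda>x. h \<otimes> x" "\<lambda>x. inv h \<otimes> x"])
       (use h in \<open>auto simp: H_closed\<close>)
  also have "\<dots> = character h * char_sum f"
    unfolding char_sum_def sum_distrib_left using h by (intro sum.cong) (auto simp: character_mult)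
  finally show ?thesis .
qed

lemma char_sum_sum: "char_sum (sum F A) = (\<Sum>i\<in>A. char_sum (F i))"
  using sum_comp_morphism[of char_sum F A] by (simp add: char_sum_add char_sum_zero o_def)

lemma char_sum_star:
  assumes "f \<in> supp H"
  shows "char_sum (f \<star> g) = char_sum f * char_sum g"
proof -
  have "f \<star> g = (\<Sum>s\<in>H. f s *\<^sub>Q (\<delta> s \<star> g))"
    by (subst supp_expand[OF finite_H assms]) (simp add: star_sum_left star_scale_left)
  then show ?thesis
    by (simp add: char_sum_sum char_sum_scale char_sum_delta_star sum_distrib_right char_sum_def[of f] mult.assoc)
qed

lemma char_sum_hat_K: "char_sum (hat K) = 1"
proof -
  have "character h = 1" if "h \<in> K" for h
    using that character_eq_1_iff[of h] by simp
  then have "char_sum (hat K) = of_rat (1 / of_nat (card K)) * of_nat (card K)"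
    by (simp add: hat_expand finite_K char_sum_scale char_sum_sum char_sum_delta)
  moreover have "card K \<noteq> 0"
    using finite_K K_closed(3) card_gt_0_iff[of K] by blast
  ultimately show ?thesis
    by (simp add: of_rat_divide)
qed

text \<open>A nontrivial character sums to zero over a subgroup.\<close>

lemma char_sum_hat_above:
  assumes "M \<in> intermediate" "M \<noteq> K"
  shows "char_sum (hat M) = 0"
proof -
  obtain m where m: "m \<in> M" "m \<notin> K" "m \<in> H"
    using assms by (auto simp: intermediate_def)
  have "\<delta> m \<star> hat M = hat M"
    using assms m by (simp add: intermediate_def delta_star_hat)
  then have "character m * char_sum (hat M) = char_sum (hat M)"
    using char_sum_delta_star[OF m(3), of "hat M"] by simp
  then show ?thesis
    using character_eq_1_iff[OF m(3)] m(2) by simp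
qed

lemma char_sum_eps_prod:
  assumes "A \<subseteq> intermediate" "K \<notin> A"
  shows "char_sum (eps_prod A) = 1"
proof -
  have "finite A" using assms finite_intermediate finite_subset by blast
  then show ?thesis
    using assms
  proof (induction A rule: finite_induct)
    case empty
    have "character \<one> = 1"
      using character_eq_1_iff[of \<one>] by (simp add: K_closed)
    then show ?case
      by (simp add: eps_prod_empty char_sum_delta H_closed)
  next
    case (insert M A)
    have M: "M \<in> intermediate" "M \<noteq> K" using insert by auto
    have "char_sum (factor M) = 1"
      using char_sum_hat_above[OF M] by (simp add: factor_def char_sum_diff char_sum_hat_K)
    moreover have "factor M \<in> supp H"
      using central_factor[OF M(1)] by (simp add: central_def)
    ultimately show ?case
      using insert by (simp add: eps_prod_insert char_sum_star)
  qed
qed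

subsection \<open>Properties of \<open>\<epsilon>\<close>\<close>

lemma eps_cases: "(minimal = {} \<and> \<epsilon> = hat K) \<or> (minimal \<noteq> {} \<and> \<epsilon> = eps_prod minimal)"
proof (cases "H = K")
  case True
  have "M \<notin> minimal" for M
  proof
    assume "M \<in> minimal"
    then have "K \<subseteq> M" "M \<subseteq> H" "M \<noteq> K"
      unfolding minimal_eq intermediate_def by auto
    then show False
      using True by blast
  qed
  then have "minimal = {}"
    by blast
  moreover have "\<epsilon> = hat K"
    unfolding shoda_eps_def using True by simp
  ultimately show ?thesis by simp
next
  case False
  have "H \<in> intermediate"
    using subgroup_H K_subset_H by (simp add: intermediate_def)
  then obtain M where "M \<in> minimal"
    using minimal_below False by metis
  with False show ?thesis
    by (auto simp: shoda_eps_def eps_prod_def)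
qed

lemmas eps_prod_minimal = eps_prod_props[OF minimal_subset_intermediate]

lemma central_eps: "central \<epsilon>"
  and eps_idem: "\<epsilon> \<star> \<epsilon> = \<epsilon>"
  and hat_K_eps: "hat K \<star> \<epsilon> = \<epsilon>"
  and hat_minimal_eps: "M \<in> minimal \<Longrightarrow> hat M \<star> \<epsilon> = 0"
  and char_sum_eps: "char_sum \<epsilon> = 1"
proof -
  have K: "K \<notin> minimal" by (simp add: minimal_eq)
  have "central \<epsilon> \<and> \<epsilon> \<star> \<epsilon> = \<epsilon> \<and> hat K \<star> \<epsilon> = \<epsilon> \<and> (\<forall>M\<in>minimal. hat M \<star> \<epsilon> = 0) \<and> char_sum \<epsilon> = 1"
    using eps_cases
  proof
    assume "minimal = {} \<and> \<epsilon> = hat K"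
    then show ?thesis
      using central_hat[OF K_intermediate] hat_star_hat[OF K_intermediate K_intermediate]
        char_sum_hat_K by simp
  next
    assume "minimal \<noteq> {} \<and> \<epsilon> = eps_prod minimal"
    then show ?thesis
      using eps_prod_minimal char_sum_eps_prod[OF minimal_subset_intermediate K] by simp
  qed
  then show "central \<epsilon>" "\<epsilon> \<star> \<epsilon> = \<epsilon>" "hat K \<star> \<epsilon> = \<epsilon>"
    "M \<in> minimal \<Longrightarrow> hat M \<star> \<epsilon> = 0" "char_sum \<epsilon> = 1"
    by auto
qed

lemma eps_supp_H: "\<epsilon> \<in> supp H"
  using central_eps by (simp add: central_def)

lemma eps_supp: "\<epsilon> \<in> supp (carrier G)"
  using eps_supp_H by (rule supp_H_carrier)

lemma eps_nonzero: "\<epsilon> \<noteq> 0"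
  using char_sum_eps char_sum_zero by auto

lemma eps_commute: "g \<in> N \<Longrightarrow> \<delta> g \<star> \<epsilon> = \<epsilon> \<star> \<delta> g"
  using central_eps by (simp add: central_def)

lemma conj_by_eps: "g \<in> N \<Longrightarrow> conj_by G g \<epsilon> = \<epsilon>"
  using conj_by_eq_self_iff[of g \<epsilon>] eps_commute[of g] eps_supp by simp

lemma K_fixes_eps:
  assumes "h \<in> K"
  shows "\<delta> h \<star> \<epsilon> = \<epsilon>"
proof -
  have "\<delta> h \<star> \<epsilon> = (\<delta> h \<star> hat K) \<star> \<epsilon>"
    by (simp add: star_assoc hat_K_eps)
  also have "\<dots> = \<epsilon>"
    by (simp add: delta_star_hat[OF subgroup_K assms] hat_K_eps)
  finally show ?thesis .
qed

lemma delta_eps_cong: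
  assumes "g \<in> N" "g' \<in> N" "g \<otimes> inv g' \<in> K"
  shows "\<delta> g \<star> \<epsilon> = \<delta> g' \<star> \<epsilon>"
proof -
  have "\<delta> g \<star> \<epsilon> = \<delta> (g \<otimes> inv g') \<star> (\<delta> g' \<star> \<epsilon>)"
    using assms by (simp add: m_assoc)
  also have "\<dots> = (\<delta> (g \<otimes> inv g') \<star> \<epsilon>) \<star> \<delta> g'"
    by (simp add: eps_commute[OF assms(2)] star_assoc)
  also have "\<dots> = \<delta> g' \<star> \<epsilon>"
    by (simp add: K_fixes_eps[OF assms(3)] eps_commute[OF assms(2)])
  finally show ?thesis .
qed

text \<open>An element of \<open>H\<close> outside \<open>K\<close> has no fixed vectors in \<open>\<epsilon>\<close>\<open>\<rat>G\<close>: the stabilizer of such a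
  vector would contain some minimal \<open>M\<close>, but \<open>\<epsilon>\<close> is annihilated by the factor of \<open>M\<close>.\<close>

lemma no_fixed_vector:
  assumes z: "z \<in> H" "z \<notin> K" and v: "\<epsilon> \<star> v = v" and fixed: "\<delta> z \<star> v = v"
  shows "v = 0"
proof -
  define S where "S = {h \<in> H. \<delta> h \<star> v = v}"
  have KS: "K \<subseteq> S"
  proof
    fix h assume h: "h \<in> K"
    then have "\<delta> h \<star> (\<epsilon> \<star> v) = \<epsilon> \<star> v"
      by (simp add: star_assoc[symmetric] K_fixes_eps)
    then show "h \<in> S"
      using h v by (simp add: S_def)
  qed
  have "subgroup S G"
  proof (rule subgroupI)
    show "S \<subseteq> carrier G" "S \<noteq> {}"
      using z fixed by (auto simp: S_def)
  next
    fix a assume "a \<in> S"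
    then have a: "a \<in> H" "\<delta> a \<star> v = v" by (auto simp: S_def)
    have "v \<in> supp (carrier G)"
      using v star_in_carrier[of \<epsilon> v] by simp
    then have "\<delta> (inv a) \<star> (\<delta> a \<star> v) = v"
      using a(1) by (simp add: delta_one_star)
    then have "\<delta> (inv a) \<star> v = v"
      using a(2) by simp
    then show "inv a \<in> S"
      using a by (simp add: S_def H_closed)
  next
    fix a b assume ab: "a \<in> S" "b \<in> S"
    then have "\<delta> (a \<otimes> b) \<star> v = v"
      using delta_delta_star[of a b v] by (simp add: S_def del: delta_delta_star)
    then show "a \<otimes> b \<in> S"
      using ab by (simp add: S_def H_closed)
  qed
  then have "S \<in> intermediate" "S \<noteq> K"
    using KS z fixed by (auto simp: intermediate_def S_def)
  from minimal_below[OF this] obtain M where M: "M \<in> minimal" "M \<subseteq> S" .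
  have M_sub: "subgroup M G"
    using M(1) minimal_subset_intermediate by (auto simp: intermediate_def)
  have "hat M \<star> v = v"
    using M(2) finite_subgroup[OF M_sub] subgroup.one_closed[OF M_sub]
    by (intro hat_star_fixed) (auto simp: S_def)
  then have "v = hat M \<star> \<epsilon> \<star> v"
    by (simp add: star_assoc v)
  then show ?thesis
    by (simp add: hat_minimal_eps[OF M(1)])
qed

text \<open>As \<open>\<epsilon>\<close> is nonzero and supported on \<open>H\<close>, an element that fixes it
  lies in \<open>H\<close>. If it were not in \<open>K\<close>, then \<open>\<epsilon>\<close> would be a fixed
  vector of the kind excluded above.\<close>

lemma fixes_eps_iff:
  assumes "g \<in> carrier G"
  shows "\<delta> g \<star> \<epsilon> = \<epsilon> \<longleftrightarrow> g \<in> K"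
proof
  assume fixed: "\<delta> g \<star> \<epsilon> = \<epsilon>"
  obtain z where z: "\<epsilon> z \<noteq> 0"
    using eps_nonzero by (auto simp: fun_eq_iff fun_apply_simps)
  then have zH: "z \<in> H"
    using eps_supp_H by (auto simp: supp_def)
  have "\<epsilon> (inv g \<otimes> z) \<noteq> 0"
    using fun_cong[OF fixed, of z] z zH assms by (simp add: delta_star_apply)
  then have "inv g \<otimes> z \<in> H"
    using eps_supp_H by (auto simp: supp_def)
  then have "z \<otimes> inv (inv g \<otimes> z) \<in> H"
    using zH by (simp add: H_closed)
  then have "g \<in> H"
    using zH assms by (simp add: inv_mult_group)
  then show "g \<in> K"
    using no_fixed_vector[OF _ _ eps_idem fixed] eps_nonzero by blast
qed (rule K_fixes_eps)

text \<open>Since \<open>K\<close> is the stabilizer of \<open>\<epsilon>\<close> under left multiplication,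
  whatever commutes with \<open>\<epsilon>\<close> normalizes \<open>K\<close>.\<close>

lemma in_N_if_commutes_eps:
  assumes g: "g \<in> carrier G" and comm: "conj_by G g \<epsilon> = \<epsilon>"
  shows "g \<in> N"
proof (rule in_N_I[OF g])
  fix h assume h: "h \<in> K"
  have "\<delta> (g \<otimes> h \<otimes> inv g) \<star> \<epsilon> = conj_by G g (\<delta> h) \<star> conj_by G g \<epsilon>"
    using g h by (simp add: conj_by_delta comm)
  also have "\<dots> = conj_by G g (\<delta> h \<star> \<epsilon>)"
    using conj_by_star[OF g] by simp
  also have "\<dots> = \<epsilon>"
    by (simp add: K_fixes_eps[OF h] comm)
  finally show "g \<otimes> h \<otimes> inv g \<in> K"
    using fixes_eps_iff[of "g \<otimes> h \<otimes> inv g"] g h by simp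
qed

text \<open>For \<open>g\<close> outside \<open>N\<close> the conjugate of \<open>\<epsilon>\<close> by
  \<open>g\<close> differs from \<open>\<epsilon>\<close>, so the two are orthogonal by the definition of a strong
  Shoda pair.\<close>

lemma eps_orthogonal:
  assumes g: "g \<in> carrier G" "g \<notin> N"
  shows "\<epsilon> \<star> (\<delta> g \<star> \<epsilon>) = 0"
proof -
  have "conj_by G \<one> \<epsilon> \<in> conjugates G \<epsilon>" "conj_by G g \<epsilon> \<in> conjugates G \<epsilon>"
    using g by (auto simp: conjugates_def)
  moreover have "\<epsilon> \<noteq> conj_by G g \<epsilon>"
    using in_N_if_commutes_eps[OF g(1)] g(2) by metis
  moreover note conj_by_one[OF eps_supp]
  ultimately have "\<epsilon> \<star> conj_by G g \<epsilon> = 0"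
    using strong_shoda_pair unfolding strong_shoda_pair_def zero_group_algebra by metis
  then have "\<epsilon> \<star> conj_by G g \<epsilon> \<star> \<delta> g = 0"
    by simp
  then show ?thesis
    using delta_star_eq_conj[OF g(1) eps_supp] by (simp add: star_assoc)
qed

lemma Q_commute_H:
  assumes "a \<in> H" "b \<in> H"
  shows "(K #> a) \<otimes>\<^bsub>Q\<^esub> (K #> b) = (K #> b) \<otimes>\<^bsub>Q\<^esub> (K #> a)"
  using commutator_in_K[OF assms] coset_eq_iff[OF subgroup_K] assms by (simp add: Q_mult del: mult_FactGroup)

end

text \<open>Used in \<open>N/K\<close>, where the hypotheses hold for \<open>b\<close> and \<open>h\<close> in
  \<open>H/K\<close>: multiplication by the commutator of \<open>b\<close> and \<open>x\<close> turns the
  conjugate of \<open>x\<close> by \<open>h\<close> into its conjugate by \<open>b \<otimes> h\<close>.\<close>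

lemma (in group) conj_shift:
  assumes c: "x \<in> carrier G" "b \<in> carrier G" "h \<in> carrier G"
    and 1: "inv b \<otimes> h = h \<otimes> inv b" and 2: "x \<otimes> inv b \<otimes> inv x \<otimes> h = h \<otimes> (x \<otimes> inv b \<otimes> inv x)"
  shows "(b \<otimes> x \<otimes> inv b \<otimes> inv x) \<otimes> (h \<otimes> x \<otimes> inv h) = (b \<otimes> h) \<otimes> x \<otimes> inv (b \<otimes> h)"
proof -
  have "inv h \<otimes> (inv b \<otimes> h) \<otimes> inv h = inv h \<otimes> (h \<otimes> inv b) \<otimes> inv h"
    by (simp only: 1)
  then have 3: "inv b \<otimes> inv h = inv h \<otimes> inv b"
    using c by (simp add: m_assoc)
  have "(b \<otimes> x \<otimes> inv b \<otimes> inv x) \<otimes> (h \<otimes> x \<otimes> inv h) = b \<otimes> (x \<otimes> inv b \<otimes> inv x \<otimes> h) \<otimes> x \<otimes> inv h"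
    using c by (simp add: m_assoc)
  also have "\<dots> = b \<otimes> h \<otimes> x \<otimes> (inv b \<otimes> inv h)"
    unfolding 2 using c by (simp add: m_assoc)
  also have "\<dots> = (b \<otimes> h) \<otimes> x \<otimes> inv (b \<otimes> h)"
    unfolding 3 using c by (simp add: m_assoc inv_mult_group)
  finally show ?thesis .
qed

context shoda_pair
begin

text \<open>Conjugates under \<open>H\<close> average to zero outside \<open>H\<close>: left multiplication by the commutator of
  \<open>y\<close> and \<open>g\<close>, which lies in \<open>H\<close> but not in \<open>K\<close>, permutes the terms of the sum.\<close>

lemma sum_conj_H_zero:
  assumes g: "g \<in> N" "g \<notin> H"
  shows "(\<Sum>h\<in>H. \<delta> (h \<otimes> g \<otimes> inv h)) \<star> \<epsilon> = 0"
proof -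
  define z where "z = y \<otimes> g \<otimes> inv y \<otimes> inv g"
  have z_alt: "z = y \<otimes> (g \<otimes> inv y \<otimes> inv g)"
    using g y_in_H by (simp add: z_def m_assoc)
  have W: "g \<otimes> inv y \<otimes> inv g \<in> H"
    using conj_in_H[OF g(1)] y_in_H by (simp add: H_closed)
  have zH: "z \<in> H"
    unfolding z_alt using y_in_H W by (rule H_closed(1))
  have zK: "z \<notin> K"
  proof
    assume "z \<in> K"
    then have "inv z \<in> K" by (rule K_closed(2))
    moreover have "inv z = (g \<otimes> y) \<otimes> inv (y \<otimes> g)"
      using g y_in_H by (simp add: z_def inv_mult_group m_assoc)
    ultimately show False
      using in_H_if_centralizes_y g by simp
  qed
  have conj_N: "h \<otimes> g \<otimes> inv h \<in> N" if "h \<in> H" for h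
    using that g by (simp add: N_closed)
  \<comment> \<open>both sides agree in \<open>N/K\<close>, and \<open>\<epsilon>\<close> does not see \<open>K\<close>\<close>
  have shift: "\<delta> z \<star> (\<delta> (h \<otimes> g \<otimes> inv h) \<star> \<epsilon>) = \<delta> ((y \<otimes> h) \<otimes> g \<otimes> inv (y \<otimes> h)) \<star> \<epsilon>" if h: "h \<in> H" for h
  proof -
    interpret Q: group Q by (rule group_Q)
    let ?c = "\<lambda>g. K #> g"
    have cos: "?c x \<in> carrier Q" if "x \<in> N" for x
      using that by (simp add: carrier_Q)
    have inv_y: "inv y \<in> H" "y \<in> N" "inv y \<in> N" "h \<in> N" "inv h \<in> N" "inv g \<in> N"
      using y_in_H h g by (auto simp: H_closed N_closed)
    have "?c (z \<otimes> (h \<otimes> g \<otimes> inv h)) = ?c ((y \<otimes> h) \<otimes> g \<otimes> inv (y \<otimes> h))"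
      using Q.conj_shift[OF cos[OF g(1)] cos[of y] cos[of h]] inv_y g
        Q_commute_H[OF inv_y(1) h] Q_commute_H[OF W h]
      by (simp add: z_def Q_mult Q_inv N_closed del: mult_FactGroup)
    then have "(z \<otimes> (h \<otimes> g \<otimes> inv h)) \<otimes> inv ((y \<otimes> h) \<otimes> g \<otimes> inv (y \<otimes> h)) \<in> K"
      using coset_eq_iff[OF subgroup_K] zH h g y_in_H by simp
    then have "\<delta> (z \<otimes> (h \<otimes> g \<otimes> inv h)) \<star> \<epsilon> = \<delta> ((y \<otimes> h) \<otimes> g \<otimes> inv (y \<otimes> h)) \<star> \<epsilon>"
      using zH h g y_in_H by (intro delta_eps_cong) (auto simp: N_closed)
    then show ?thesis
      using zH h g by simp
  qed
  let ?S = "(\<Sum>h\<in>H. \<delta> (h \<otimes> g \<otimes> inv h)) \<star> \<epsilon>"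
  have S_eq: "?S = (\<Sum>h\<in>H. \<delta> (h \<otimes> g \<otimes> inv h) \<star> \<epsilon>)"
    by (simp add: star_sum_left)
  have "\<delta> z \<star> ?S = (\<Sum>h\<in>H. \<delta> ((y \<otimes> h) \<otimes> g \<otimes> inv (y \<otimes> h)) \<star> \<epsilon>)"
    unfolding S_eq star_sum_right by (intro sum.cong) (simp_all add: shift)
  also have "\<dots> = ?S"
    unfolding S_eq
    by (rule sum.reindex_bij_witness[of _ "\<lambda>h. inv y \<otimes> h" "\<lambda>h. y \<otimes> h"])
       (use y_in_H in \<open>auto simp: H_closed\<close>)
  finally have fixed: "\<delta> z \<star> ?S = ?S" .
  have "\<epsilon> \<star> ?S = ?S"
    unfolding S_eq star_sum_right
    by (intro sum.cong) (simp_all add: eps_commute conj_N star_assoc[symmetric] eps_idem)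
  then show ?thesis
    using no_fixed_vector[OF zH zK _ fixed] by simp
qed

end

section \<open>The crossed product with trivial twisting\<close>

locale untwisted_shoda_pair = shoda_pair G H K y \<zeta>
  for G :: "('a, 'b) monoid_scheme" (structure) and H K y \<zeta> +
  fixes \<phi> :: "'a set \<Rightarrow> 'a set" and T1 :: "'a set"
  assumes section_phi: "is_section G H K \<phi>"
    and twisting_1: "\<And>g g'. g \<in> N \<Longrightarrow> g' \<in> N \<Longrightarrow> twisting G H K y \<zeta> \<phi> (H #> g) (H #> g') = 1"
    and transversal_T1: "transversal G N H T1"
    and phi_T1: "\<And>t. t \<in> T1 \<Longrightarrow> K #> t = \<phi> (H #> t)"
begin

lemma T1_subset: "T1 \<subseteq> N"
  using transversal_T1 by (simp add: transversal_def)

lemma T1_N [simp]: "t \<in> T1 \<Longrightarrow> t \<in> N"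
  using T1_subset by auto

lemma finite_T1: "finite T1"
  using T1_subset finite_N finite_subset by blast

definition rep :: "'a \<Rightarrow> 'a" where
  "rep g = (THE t. t \<in> T1 \<inter> (g <# H))"

lemma in_left_coset_iff:
  assumes "g \<in> N" "t \<in> N"
  shows "t \<in> g <# H \<longleftrightarrow> t \<otimes> inv g \<in> H"
proof
  assume "t \<in> g <# H"
  then obtain h where h: "h \<in> H" "t = g \<otimes> h" by (auto simp: l_coset_def)
  then show "t \<otimes> inv g \<in> H"
    using conj_in_H[OF assms(1) h(1)] by simp
next
  assume *: "t \<otimes> inv g \<in> H"
  have "inv g \<otimes> (t \<otimes> inv g) \<otimes> inv (inv g) \<in> H"
    by (rule conj_in_H[OF _ *]) (use assms in \<open>simp add: N_closed\<close>)
  then have "inv g \<otimes> t \<in> H"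
    using assms by (simp add: m_assoc)
  moreover have "t = g \<otimes> (inv g \<otimes> t)"
    using assms by simp
  ultimately show "t \<in> g <# H"
    unfolding l_coset_def by blast
qed

lemma rep_unique_ex: "g \<in> N \<Longrightarrow> \<exists>!t. t \<in> T1 \<inter> (g <# H)"
  using transversal_T1 by (simp add: transversal_def)

lemma
  assumes "g \<in> N"
  shows rep_in_T1: "rep g \<in> T1" and rep_coset: "rep g \<otimes> inv g \<in> H"
proof -
  have "rep g \<in> T1 \<inter> (g <# H)"
    unfolding rep_def by (rule theI'[OF rep_unique_ex[OF assms]])
  then show "rep g \<in> T1" "rep g \<otimes> inv g \<in> H"
    using in_left_coset_iff[OF assms, of "rep g"] by auto
qed

lemma rep_eqI:
  assumes "g \<in> N" "t \<in> T1" "t \<otimes> inv g \<in> H"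
  shows "rep g = t"
  unfolding rep_def
  by (rule the1_equality[OF rep_unique_ex[OF assms(1)]])
     (use assms in_left_coset_iff[of g t] in auto)

lemma T1_eqI:
  assumes "t \<in> T1" "t' \<in> T1" "t \<otimes> inv t' \<in> H"
  shows "t = t'"
  using rep_eqI[of t' t] rep_eqI[of t' t'] assms by (simp add: H_closed)

lemma T1_nonempty: "T1 \<noteq> {}"
  using rep_in_T1[of \<one>] N_closed(3) by auto

abbreviation "n \<equiv> card T1"

lemma n_pos: "n > 0"
  using finite_T1 T1_nonempty by (simp add: card_gt_0_iff)

text \<open>The group \<open>N\<close> permutes its cosets modulo \<open>H\<close>.\<close>

lemma bij_betw_rep_left:
  assumes "g \<in> N"
  shows "bij_betw (\<lambda>t. rep (g \<otimes> t)) T1 T1"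
proof -
  have "inj_on (\<lambda>t. rep (g \<otimes> t)) T1"
  proof (rule inj_onI)
    fix t t' assume t: "t \<in> T1" "t' \<in> T1" "rep (g \<otimes> t) = rep (g \<otimes> t')"
    let ?r = "rep (g \<otimes> t)"
    have gt: "g \<otimes> t \<in> N" "g \<otimes> t' \<in> N"
      using assms t by (auto simp: N_closed)
    have r: "?r \<in> N" using rep_in_T1[OF gt(1)] by simp
    have "inv (?r \<otimes> inv (g \<otimes> t)) \<otimes> (?r \<otimes> inv (g \<otimes> t')) \<in> H"
      using rep_coset[OF gt(1)] rep_coset[OF gt(2)] t(3) by (simp add: H_closed)
    moreover have "inv (?r \<otimes> inv (g \<otimes> t)) \<otimes> (?r \<otimes> inv (g \<otimes> t')) = g \<otimes> (t \<otimes> inv t') \<otimes> inv g"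
      using assms t r by (simp add: inv_mult_group m_assoc)
    ultimately have "g \<otimes> (t \<otimes> inv t') \<otimes> inv g \<in> H" by simp
    then have "inv g \<otimes> (g \<otimes> (t \<otimes> inv t') \<otimes> inv g) \<otimes> inv (inv g) \<in> H"
      using conj_in_H[of "inv g"] assms by (simp add: N_closed)
    moreover have "inv g \<otimes> (g \<otimes> (t \<otimes> inv t') \<otimes> inv g) \<otimes> inv (inv g) = t \<otimes> inv t'"
      using assms t by (simp add: m_assoc)
    ultimately show "t = t'"
      using T1_eqI t by simp
  qed
  moreover have "(\<lambda>t. rep (g \<otimes> t)) ` T1 \<subseteq> T1"
    using rep_in_T1 assms by (auto simp: N_closed)
  ultimately show ?thesis
    using finite_T1 by (simp add: bij_betw_def endo_inj_surj)
qed

lemma H_cosets: "H #> g = H #> g' \<longleftrightarrow> g \<otimes> inv g' \<in> H" if "g \<in> N" "g' \<in> N" for g g'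
  using coset_eq_iff[OF subgroup_H] that by simp

text \<open>The twisting of a pair of cosets is the value of the faithful character at the corresponding
  element of \<open>H/K\<close>, so trivial twisting means that the section is a homomorphism.\<close>

lemma rep_mult:
  assumes t: "t \<in> T1" "t' \<in> T1"
  shows "(t \<otimes> t') \<otimes> inv (rep (t \<otimes> t')) \<in> K"
proof -
  let ?s = "rep (t \<otimes> t')"
  have tt: "t \<otimes> t' \<in> N" using t by (simp add: N_closed)
  have s: "?s \<in> T1" "?s \<in> N" using rep_in_T1[OF tt] by auto
  have sH: "?s \<otimes> inv (t \<otimes> t') \<in> H" by (rule rep_coset[OF tt])
  define u where "u = inv ?s \<otimes> t \<otimes> t'"
  have "inv ?s \<otimes> inv (?s \<otimes> inv (t \<otimes> t')) \<otimes> inv (inv ?s) \<in> H"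
    using sH s by (intro conj_in_H) (auto simp: N_closed H_closed)
  then have uH: "u \<in> H"
    using s t by (simp add: u_def inv_mult_group m_assoc)
  have prod: "(H #> t) \<otimes>\<^bsub>norm_group G K Mod H\<^esub> (H #> t') = H #> ?s"
    using normal.rcos_sum[OF H_normal_N, of t t'] t H_cosets[OF s(2) tt] sH by simp
  have eq: "inv\<^bsub>Q\<^esub> \<phi> ((H #> t) \<otimes>\<^bsub>norm_group G K Mod H\<^esub> (H #> t')) \<otimes>\<^bsub>Q\<^esub> \<phi> (H #> t) \<otimes>\<^bsub>Q\<^esub> \<phi> (H #> t')
      = K #> u"
    unfolding prod using s t by (simp add: phi_T1[symmetric] Q_inv Q_mult u_def N_closed del: mult_FactGroup)
  have "twisting G H K y \<zeta> \<phi> (H #> t) (H #> t') = character u"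
    unfolding twisting_def Let_def eq
  proof (rule the_equality)
    from coset_power_of_y[OF uH] obtain j :: nat where j: "K #> u = K #> (y [^] j)" ..
    then show "\<exists>j::nat. character u = \<zeta> ^ j \<and> K #> u = (K #> y) [^]\<^bsub>Q\<^esub> j"
      using character_eqI[OF uH j] y_in_H Q_pow[of y j] by auto
  next
    fix z assume "\<exists>j::nat. z = \<zeta> ^ j \<and> K #> u = (K #> y) [^]\<^bsub>Q\<^esub> j"
    then obtain j :: nat where "z = \<zeta> ^ j" "K #> u = K #> (y [^] j)"
      using y_in_H Q_pow[of y] by auto
    then show "z = character u"
      using character_eqI[OF uH] by simp
  qed
  then have "character u = 1"
    using twisting_1[of t t'] t by simp
  then have "u \<in> K"
    using character_eq_1_iff[OF uH] by simp
  then have "?s \<otimes> u \<otimes> inv ?s \<in> K"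
    using conj_in_K s by simp
  then show ?thesis
    using s t by (simp add: u_def m_assoc)
qed

lemma delta_rep_mult:
  assumes "t \<in> T1" "t' \<in> T1"
  shows "\<delta> (t \<otimes> t') \<star> \<epsilon> = \<delta> (rep (t \<otimes> t')) \<star> \<epsilon>"
proof (rule delta_eps_cong[OF _ _ rep_mult[OF assms]])
  show "t \<otimes> t' \<in> N"
    using assms by (simp add: N_closed)
  then show "rep (t \<otimes> t') \<in> N"
    using rep_in_T1 by simp
qed

text \<open>The representative of the trivial coset is idempotent modulo \<open>K\<close>, as the section is a
  homomorphism.\<close>

lemma T1_H_in_K:
  assumes "t \<in> T1" "t \<in> H"
  shows "t \<in> K"
proof -
  have "rep (t \<otimes> t) = t"
    using assms by (intro rep_eqI) (auto simp: N_closed H_closed)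
  then show ?thesis
    using rep_mult[OF assms(1,1)] assms by (simp add: m_assoc)
qed

lemma T1_commute:
  assumes "t \<in> T1" "t' \<in> T1"
  shows "\<delta> (t \<otimes> t') \<star> \<epsilon> = \<delta> (t' \<otimes> t) \<star> \<epsilon>"
proof -
  have N: "t \<otimes> t' \<in> N" "t' \<otimes> t \<in> N"
    using assms by (auto simp: N_closed)
  have "(rep (t \<otimes> t') \<otimes> inv (t \<otimes> t')) \<otimes> ((t \<otimes> t') \<otimes> inv (t' \<otimes> t)) \<in> H"
    using H_closed(1)[OF rep_coset[OF N(1)] N_mod_H_abelian[of t t']] assms by simp
  moreover have "(r \<otimes> inv a) \<otimes> (a \<otimes> inv b) = r \<otimes> inv b"
    if "r \<in> carrier G" "a \<in> carrier G" "b \<in> carrier G" for r a b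
    using that by (simp add: m_assoc)
  ultimately have "rep (t \<otimes> t') \<otimes> inv (t' \<otimes> t) \<in> H"
    using N_carrier[OF T1_N[OF rep_in_T1[OF N(1)]]] N_carrier[OF N(1)] N_carrier[OF N(2)] by metis
  then have "rep (t' \<otimes> t) = rep (t \<otimes> t')"
    using rep_in_T1[OF N(1)] N by (intro rep_eqI) auto
  then show ?thesis
    using delta_rep_mult assms by simp
qed

lemma T1_cosets_bij: "bij_betw (\<lambda>t. H #> t) T1 (carrier (norm_group G K Mod H))"
proof -
  have "inj_on (\<lambda>t. H #> t) T1"
    by (intro inj_onI T1_eqI) (auto simp: H_cosets)
  moreover have "H #> g \<in> (\<lambda>t. H #> t) ` T1" if "g \<in> N" for g
    using rep_in_T1[OF that] rep_coset[OF that] H_cosets[of "rep g" g] that by (auto intro!: image_eqI[of _ _ "rep g"])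
  ultimately show ?thesis
    by (auto simp: bij_betw_def carrier_FactGroup)
qed

lemma degree_eq: "degree_NH G H K = n"
  using bij_betw_same_card[OF T1_cosets_bij] by (simp add: degree_NH_def)

subsection \<open>The idempotent \<open>\<theta>\<close>\<close>

text \<open>This is the idempotent of the group \<open>{t\<epsilon> | t \<in> T\<^sub>1}\<close>, a copy of
  \<open>N/H\<close> inside the crossed product.\<close>

definition \<theta> :: "'a \<Rightarrow> rat" where
  "\<theta> = hat T1 \<star> \<epsilon>"

lemma theta_eq: "\<theta> = (1 / of_nat n) *\<^sub>Q (\<Sum>t\<in>T1. \<delta> t \<star> \<epsilon>)"
  by (simp add: \<theta>_def hat_expand finite_T1 star_scale_left star_sum_left)

lemma theta_eps: "\<theta> \<star> \<epsilon> = \<theta>"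
  by (simp add: \<theta>_def star_assoc eps_idem)

lemma eps_theta: "\<epsilon> \<star> \<theta> = \<theta>"
  by (simp add: theta_eq star_scale_right star_sum_right eps_commute star_assoc[symmetric] eps_idem)

lemma T1_theta:
  assumes "t \<in> T1"
  shows "\<delta> t \<star> \<theta> = \<theta>"
proof -
  have "(\<Sum>s\<in>T1. \<delta> t \<star> (\<delta> s \<star> \<epsilon>)) = (\<Sum>s\<in>T1. \<delta> (rep (t \<otimes> s)) \<star> \<epsilon>)"
    using assms by (intro sum.cong) (auto simp: delta_rep_mult)
  also have "\<dots> = (\<Sum>s\<in>T1. \<delta> s \<star> \<epsilon>)"
    using assms by (intro sum.reindex_bij_betw bij_betw_rep_left) simp
  finally show ?thesis
    by (simp only: theta_eq star_scale_right star_sum_right)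
qed

lemma theta_idem: "\<theta> \<star> \<theta> = \<theta>"
proof -
  have "\<theta> \<star> \<theta> = hat T1 \<star> \<theta>"
    by (simp add: \<theta>_def[of] star_assoc) (simp add: \<theta>_def[symmetric] eps_theta)
  also have "\<dots> = \<theta>"
    by (rule hat_star_fixed) (auto simp: finite_T1 T1_nonempty T1_theta)
  finally show ?thesis .
qed

text \<open>Averaging \<open>\<theta>\<close> over \<open>H\<close> gives a multiple of \<open>\<epsilon>\<close>. This one identity does the work of
  the linear independence of automorphisms and of a count of dimensions: it shows that \<open>\<rat>N\<epsilon>\<close> acts faithfully
  on the left ideal generated by \<open>\<theta>\<close>, and that every map of that ideal that is linear over the fixed
  ring comes from \<open>\<rat>N\<epsilon>\<close>.\<close>

definition ratio :: rat where
  "ratio = of_nat n / of_nat (card H)"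

lemma average_theta: "\<epsilon> = ratio *\<^sub>Q (\<Sum>h\<in>H. \<delta> h \<star> \<theta> \<star> \<delta> (inv h))"
proof -
  have conj: "\<delta> (h \<otimes> t) \<star> \<epsilon> \<star> \<delta> (inv h) = \<delta> (h \<otimes> t \<otimes> inv h) \<star> \<epsilon>" if "h \<in> H" "t \<in> T1" for h t
    using that eps_commute[of "inv h"] by (simp add: star_assoc H_closed eps_commute[symmetric] m_assoc)
  define s where "s = rep \<one>"
  have s1: "s \<in> T1"
    unfolding s_def by (rule rep_in_T1[OF N_closed(3)])
  have "s \<in> H"
    using rep_coset[OF N_closed(3)] s1 by (simp add: s_def)
  then have s: "s \<in> T1" "s \<in> K"
    using s1 T1_H_in_K by simp_all
  \<comment> \<open>only the representative of the trivial coset contributes to the average\<close>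
  have term0: "(\<Sum>h\<in>H. \<delta> (h \<otimes> t \<otimes> inv h)) \<star> \<epsilon> = (if t = s then of_nat (card H) *\<^sub>Q \<epsilon> else 0)"
    if t: "t \<in> T1" for t
  proof (cases "t = s")
    case True
    have "(\<Sum>h\<in>H. \<delta> (h \<otimes> t \<otimes> inv h)) \<star> \<epsilon> = (\<Sum>h\<in>H. \<epsilon>)"
      unfolding star_sum_left using True s conj_in_K by (intro sum.cong) (auto simp: K_fixes_eps)
    then show ?thesis
      unfolding sum_constant_scale using True by simp
  next
    case False
    have "t \<notin> H"
    proof
      assume "t \<in> H"
      then have "t \<otimes> inv s \<in> H"
        using s by (simp add: H_closed)
      then show False
        using T1_eqI t s False by blast
    qed
    then show ?thesis
      using sum_conj_H_zero[of t] t False by simp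
  qed
  have "(\<Sum>h\<in>H. \<delta> h \<star> \<theta> \<star> \<delta> (inv h)) =
      (1 / of_nat n) *\<^sub>Q (\<Sum>h\<in>H. \<Sum>t\<in>T1. \<delta> (h \<otimes> t \<otimes> inv h) \<star> \<epsilon>)"
    by (simp add: theta_eq star_scale_right star_scale_left star_sum_right star_sum_left conj
        rat_fun.scale_sum_right)
  also have "(\<Sum>h\<in>H. \<Sum>t\<in>T1. \<delta> (h \<otimes> t \<otimes> inv h) \<star> \<epsilon>) = (\<Sum>t\<in>T1. (\<Sum>h\<in>H. \<delta> (h \<otimes> t \<otimes> inv h)) \<star> \<epsilon>)"
    by (subst sum.swap) (simp add: star_sum_left)
  also have "\<dots> = (\<Sum>t\<in>T1. if t = s then of_nat (card H) *\<^sub>Q \<epsilon> else 0)"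
    by (intro sum.cong) (simp_all add: term0)
  also have "\<dots> = of_nat (card H) *\<^sub>Q \<epsilon>"
    using s finite_T1 by simp
  finally show ?thesis
    using n_pos finite_H y_in_H by (auto simp: ratio_def)
qed

subsection \<open>The coefficient ring and its fixed ring\<close>

text \<open>The underlying sets of \<open>\<rat>H\<epsilon>\<close>, of its fixed ring and of
  \<open>\<rat>N\<epsilon>\<close>. As \<open>\<epsilon>\<close> is idempotent, the multiples of
  \<open>\<epsilon>\<close> are the elements that \<open>\<epsilon>\<close> does not change.\<close>

definition coeffs :: "('a \<Rightarrow> rat) set" ("\<E>") where
  "\<E> = {v \<in> supp H. v \<star> \<epsilon> = v}"

definition fixeds :: "('a \<Rightarrow> rat) set" ("\<F>") where
  "\<F> = {v \<in> \<E>. \<forall>g\<in>N. conj_by G g v = v}"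

definition crossed :: "('a \<Rightarrow> rat) set" ("\<A>") where
  "\<A> = {\<alpha> \<in> supp N. \<alpha> \<star> \<epsilon> = \<alpha>}"

lemma E_supp_H: "v \<in> \<E> \<Longrightarrow> v \<in> supp H"
  and E_eps: "v \<in> \<E> \<Longrightarrow> v \<star> \<epsilon> = v"
  by (auto simp: coeffs_def)

lemma E_supp: "v \<in> \<E> \<Longrightarrow> v \<in> supp (carrier G)"
  using E_supp_H supp_H_carrier by blast

lemma E_supp_N: "v \<in> \<E> \<Longrightarrow> v \<in> supp N"
  using E_supp_H supp_mono[OF _ H_subset_N] by blast

lemma eps_E: "v \<in> \<E> \<Longrightarrow> \<epsilon> \<star> v = v"
  using central_commute[OF central_eps, of v] by (simp add: coeffs_def)

lemma E_zero: "0 \<in> \<E>"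
  and E_add: "v \<in> \<E> \<Longrightarrow> w \<in> \<E> \<Longrightarrow> v + w \<in> \<E>"
  and E_diff: "v \<in> \<E> \<Longrightarrow> w \<in> \<E> \<Longrightarrow> v - w \<in> \<E>"
  and E_scale: "v \<in> \<E> \<Longrightarrow> c *\<^sub>Q v \<in> \<E>"
  and E_star: "v \<in> \<E> \<Longrightarrow> w \<in> \<E> \<Longrightarrow> v \<star> w \<in> \<E>"
  and E_one: "\<epsilon> \<in> \<E>"
  by (auto simp: coeffs_def star_add_left star_diff_left star_scale_left eps_idem eps_supp_H
      star_assoc supp_star[OF subgroup_H])

lemma E_sum: "(\<And>i. i \<in> A \<Longrightarrow> f i \<in> \<E>) \<Longrightarrow> sum f A \<in> \<E>"
  by (induction A rule: infinite_finite_induct) (auto intro: E_zero E_add)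

lemma delta_eps_E: "h \<in> H \<Longrightarrow> \<delta> h \<star> \<epsilon> \<in> \<E>"
  by (simp add: coeffs_def star_assoc eps_idem supp_star[OF subgroup_H] supp_delta eps_supp_H)

text \<open>Multiplication by \<open>\<epsilon>\<close> trivializes \<open>K\<close>, which contains the
  commutators of \<open>H\<close>.\<close>

lemma E_commute_H:
  assumes v: "v \<in> \<E>" and h: "h \<in> H"
  shows "\<delta> h \<star> v = v \<star> \<delta> h"
proof -
  have "\<delta> h \<star> (\<delta> s \<star> \<epsilon>) = \<delta> s \<star> \<epsilon> \<star> \<delta> h" if s: "s \<in> H" for s
  proof -
    have "\<delta> (h \<otimes> s) \<star> \<epsilon> = \<delta> (s \<otimes> h) \<star> \<epsilon>"
      using commutator_in_K[OF h s] h s by (intro delta_eps_cong) (auto simp: N_closed)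
    then show ?thesis
      using h s by (simp add: star_assoc eps_commute[symmetric])
  qed
  then have "\<delta> h \<star> (\<Sum>s\<in>H. v s *\<^sub>Q (\<delta> s \<star> \<epsilon>)) = (\<Sum>s\<in>H. v s *\<^sub>Q (\<delta> s \<star> \<epsilon>)) \<star> \<delta> h"
    unfolding star_sum_left star_sum_right star_scale_left star_scale_right
    by (intro sum.cong) simp_all
  moreover have "v = (\<Sum>s\<in>H. v s *\<^sub>Q (\<delta> s \<star> \<epsilon>))"
    using arg_cong[OF supp_expand[OF finite_H E_supp_H[OF v]], of "\<lambda>u. u \<star> \<epsilon>"] E_eps[OF v]
    by (simp add: star_sum_left star_scale_left)
  ultimately show ?thesis
    by (simp only:)
qed

lemma E_commute: "v \<in> \<E> \<Longrightarrow> w \<in> \<E> \<Longrightarrow> v \<star> w = w \<star> v"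
  by (rule commute_supp[OF finite_H]) (auto simp: E_commute_H E_supp_H)

lemma conj_E:
  assumes v: "v \<in> \<E>" and g: "g \<in> N"
  shows "conj_by G g v \<in> \<E>"
proof -
  have "conj_by G g v \<in> supp H"
  proof -
    have "v (inv g \<otimes> z \<otimes> g) = 0" if "z \<in> carrier G" "z \<notin> H" for z
    proof (rule ccontr)
      assume "v (inv g \<otimes> z \<otimes> g) \<noteq> 0"
      then have "inv g \<otimes> z \<otimes> g \<in> H"
        using E_supp_H[OF v] by (auto simp: supp_def)
      from conj_in_H[OF g this] show False
        using that g by (simp add: m_assoc)
    qed
    then show ?thesis
      using g by (auto simp: supp_def conj_by_apply)
  qed
  moreover have "conj_by G g v \<star> \<epsilon> = conj_by G g v"
    using conj_by_star[of g v \<epsilon>] g conj_by_eps[OF g] E_eps[OF v] by simp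
  ultimately show ?thesis
    by (simp add: coeffs_def)
qed

lemma conj_E_H:
  assumes "v \<in> \<E>" "h \<in> H"
  shows "conj_by G h v = v"
  using conj_by_eq_self_iff[of h v] E_commute_H assms E_supp by simp

lemma conj_E_cong:
  assumes v: "v \<in> \<E>" and g: "g \<in> N" "g' \<in> N" "g \<otimes> inv g' \<in> H"
  shows "conj_by G g v = conj_by G g' v"
proof -
  have "conj_by G g v = conj_by G (g \<otimes> inv g') (conj_by G g' v)"
    using g by (simp add: conj_by_conj_by m_assoc)
  then show ?thesis
    using conj_E_H[OF conj_E[OF v g(2)] g(3)] by simp
qed

lemma conj_E_commute:
  assumes "v \<in> \<E>" "g \<in> N" "g' \<in> N"
  shows "conj_by G g (conj_by G g' v) = conj_by G g' (conj_by G g v)"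
  using conj_E_cong[OF assms(1) _ _ N_mod_H_abelian[OF assms(2,3)]] assms
  by (simp add: conj_by_conj_by N_closed)

lemma F_E: "a \<in> \<F> \<Longrightarrow> a \<in> \<E>"
  by (simp add: fixeds_def)

lemma F_commute_N: "a \<in> \<F> \<Longrightarrow> g \<in> N \<Longrightarrow> \<delta> g \<star> a = a \<star> \<delta> g"
  using conj_by_eq_self_iff[of g a] E_supp by (auto simp: fixeds_def)

lemma F_commute: "a \<in> \<F> \<Longrightarrow> \<beta> \<in> supp N \<Longrightarrow> \<beta> \<star> a = a \<star> \<beta>"
  by (rule commute_supp[OF finite_N]) (auto simp: F_commute_N)

lemma F_zero: "0 \<in> \<F>"
  and F_add: "a \<in> \<F> \<Longrightarrow> b \<in> \<F> \<Longrightarrow> a + b \<in> \<F>"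
  and F_diff: "a \<in> \<F> \<Longrightarrow> b \<in> \<F> \<Longrightarrow> a - b \<in> \<F>"
  and F_scale: "a \<in> \<F> \<Longrightarrow> c *\<^sub>Q a \<in> \<F>"
  and F_star: "a \<in> \<F> \<Longrightarrow> b \<in> \<F> \<Longrightarrow> a \<star> b \<in> \<F>"
  and F_one: "\<epsilon> \<in> \<F>"
  by (auto simp: fixeds_def E_zero E_add E_diff E_scale E_star E_one conj_by_add conj_by_diff
      conj_by_scale conj_by_star conj_by_eps)

lemma F_sum: "(\<And>i. i \<in> A \<Longrightarrow> f i \<in> \<F>) \<Longrightarrow> sum f A \<in> \<F>"
  by (induction A rule: infinite_finite_induct) (auto intro: F_zero F_add)

lemma A_add: "\<alpha> \<in> \<A> \<Longrightarrow> \<beta> \<in> \<A> \<Longrightarrow> \<alpha> + \<beta> \<in> \<A>"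
  and A_diff: "\<alpha> \<in> \<A> \<Longrightarrow> \<beta> \<in> \<A> \<Longrightarrow> \<alpha> - \<beta> \<in> \<A>"
  and A_zero: "0 \<in> \<A>"
  and A_scale: "\<alpha> \<in> \<A> \<Longrightarrow> c *\<^sub>Q \<alpha> \<in> \<A>"
  and A_star: "\<alpha> \<in> \<A> \<Longrightarrow> \<beta> \<in> \<A> \<Longrightarrow> \<alpha> \<star> \<beta> \<in> \<A>"
  by (auto simp: crossed_def star_add_left star_diff_left star_scale_left star_assoc
      supp_star[OF subgroup_N])

lemma A_sum: "(\<And>i. i \<in> A \<Longrightarrow> f i \<in> \<A>) \<Longrightarrow> sum f A \<in> \<A>"
  by (induction A rule: infinite_finite_induct) (auto intro: A_zero A_add)

lemma E_A: "v \<in> \<E> \<Longrightarrow> v \<in> \<A>"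
  by (simp add: crossed_def E_supp_N E_eps)

lemma A_supp_N: "\<alpha> \<in> \<A> \<Longrightarrow> \<alpha> \<in> supp N"
  and A_eps: "\<alpha> \<in> \<A> \<Longrightarrow> \<alpha> \<star> \<epsilon> = \<alpha>"
  by (auto simp: crossed_def)

lemma eps_A: "\<alpha> \<in> \<A> \<Longrightarrow> \<epsilon> \<star> \<alpha> = \<alpha>"
  using F_commute[OF F_one A_supp_N, of \<alpha>] A_eps[of \<alpha>] by simp

lemma delta_A: "g \<in> N \<Longrightarrow> \<delta> g \<star> \<epsilon> \<in> \<A>"
  using E_A[OF E_one] by (simp add: crossed_def star_assoc eps_idem supp_star[OF subgroup_N] supp_delta)

lemma theta_A: "\<theta> \<in> \<A>"
  unfolding theta_eq by (intro A_scale A_sum delta_A) simp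

lemma F_commute_A: "a \<in> \<F> \<Longrightarrow> \<alpha> \<in> \<A> \<Longrightarrow> \<alpha> \<star> a = a \<star> \<alpha>"
  using F_commute A_supp_N by blast

definition trace :: "('a \<Rightarrow> rat) \<Rightarrow> ('a \<Rightarrow> rat)" where
  "trace v = (\<Sum>t\<in>T1. conj_by G t v)"

lemma trace_F:
  assumes v: "v \<in> \<E>"
  shows "trace v \<in> \<F>"
proof -
  have "trace v \<in> \<E>"
    unfolding trace_def using conj_E[OF v] by (intro E_sum) simp
  moreover have "conj_by G g (trace v) = trace v" if g: "g \<in> N" for g
  proof -
    have "conj_by G g (conj_by G t v) = conj_by G (rep (g \<otimes> t)) v" if t: "t \<in> T1" for t
    proof -
      have gt: "g \<otimes> t \<in> N" using g t by (simp add: N_closed)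
      then have "conj_by G (rep (g \<otimes> t)) v = conj_by G (g \<otimes> t) v"
        using rep_coset[OF gt] rep_in_T1[OF gt] by (intro conj_E_cong[OF v]) auto
      then show ?thesis
        using g t by (simp add: conj_by_conj_by)
    qed
    then have "conj_by G g (trace v) = (\<Sum>t\<in>T1. conj_by G (rep (g \<otimes> t)) v)"
      unfolding trace_def conj_by_sum by (intro sum.cong) auto
    also have "\<dots> = trace v"
      unfolding trace_def by (rule sum.reindex_bij_betw[OF bij_betw_rep_left[OF g]])
    finally show ?thesis .
  qed
  ultimately show ?thesis
    by (simp add: fixeds_def)
qed

text \<open>The left ideal generated by \<open>\<theta>\<close> is a copy of the coefficient ring on which the group acts
  by conjugation.\<close>

lemma T1_E_theta:
  assumes "v \<in> \<E>" "t \<in> T1"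
  shows "\<delta> t \<star> (v \<star> \<theta>) = conj_by G t v \<star> \<theta>"
proof -
  have "\<delta> t \<star> (v \<star> \<theta>) = conj_by G t v \<star> (\<delta> t \<star> \<theta>)"
    using delta_star_eq_conj[of t v] assms E_supp by (simp add: star_assoc[symmetric])
  then show ?thesis
    using T1_theta[OF assms(2)] by simp
qed

text \<open>On the copy of the coefficient ring, \<open>\<theta>\<close> acts as the trace to the fixed ring
  divided by \<open>n\<close>.\<close>

lemma theta_E_theta:
  assumes "v \<in> \<E>"
  shows "\<theta> \<star> (v \<star> \<theta>) = (1 / of_nat n) *\<^sub>Q (trace v \<star> \<theta>)"
proof -
  have "\<theta> \<star> (v \<star> \<theta>) = (1 / of_nat n) *\<^sub>Q (\<Sum>t\<in>T1. \<delta> t \<star> (\<epsilon> \<star> v \<star> \<theta>))"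
    by (simp add: theta_eq star_scale_left star_sum_left star_assoc)
  also have "(\<Sum>t\<in>T1. \<delta> t \<star> (\<epsilon> \<star> v \<star> \<theta>)) = (\<Sum>t\<in>T1. conj_by G t v \<star> \<theta>)"
    using assms by (intro sum.cong) (simp_all add: eps_E T1_E_theta)
  finally show ?thesis
    unfolding trace_def star_sum_left .
qed

text \<open>By the averaging identity, \<open>\<alpha> = \<alpha>\<epsilon>\<close> is a combination of products
  that each contain a factor \<open>\<alpha>v\<theta>\<close> with \<open>v\<close> in the coefficient
  ring.\<close>

lemma faithful:
  assumes "\<alpha> \<star> \<epsilon> = \<alpha>" and zero: "\<And>v. v \<in> \<E> \<Longrightarrow> \<alpha> \<star> (v \<star> \<theta>) = 0"
  shows "\<alpha> = 0"
proof -
  have "\<alpha> \<star> (\<delta> h \<star> \<theta> \<star> \<delta> (inv h)) = 0" if h: "h \<in> H" for h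
  proof -
    have "\<alpha> \<star> (\<delta> h \<star> \<epsilon> \<star> \<theta>) \<star> \<delta> (inv h) = 0"
      using zero[OF delta_eps_E[OF h]] by simp
    then show ?thesis
      by (simp add: star_assoc eps_theta)
  qed
  then have "\<alpha> \<star> (\<Sum>h\<in>H. \<delta> h \<star> \<theta> \<star> \<delta> (inv h)) = 0"
    by (simp add: star_sum_right)
  then have "\<alpha> \<star> \<epsilon> = 0"
    by (subst average_theta) (simp add: star_scale_right)
  then show ?thesis
    using assms(1) by simp
qed

lemma E_theta_inj:
  assumes "v \<in> \<E>" "w \<in> \<E>" "v \<star> \<theta> = w \<star> \<theta>"
  shows "v = w"
proof -
  have "v - w = 0"
  proof (rule faithful)
    show "(v - w) \<star> \<epsilon> = v - w"
      using assms by (simp add: star_diff_left E_eps)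
    fix u assume u: "u \<in> \<E>"
    have "(v - w) \<star> (u \<star> \<theta>) = u \<star> ((v - w) \<star> \<theta>)"
      using E_commute[OF E_diff[OF assms(1,2)] u] by (simp add: star_assoc[symmetric])
    then show "(v - w) \<star> (u \<star> \<theta>) = 0"
      using assms(3) by (simp add: star_diff_left)
  qed
  then show ?thesis by simp
qed

text \<open>The crossed product decomposition: group the support of \<open>\<alpha>\<close> by the cosets of
  \<open>H\<close> in \<open>N\<close>.\<close>

lemma A_expand:
  assumes \<alpha>: "\<alpha> \<in> \<A>"
  obtains \<xi> where "\<And>t. t \<in> T1 \<Longrightarrow> \<xi> t \<in> \<E>" "\<alpha> = (\<Sum>t\<in>T1. \<xi> t \<star> (\<delta> t \<star> \<epsilon>))"
proof
  define \<xi> where "\<xi> t = (\<Sum>h\<in>H. \<alpha> (h \<otimes> t) *\<^sub>Q (\<delta> h \<star> \<epsilon>))" for t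
  show "\<xi> t \<in> \<E>" for t
    unfolding \<xi>_def by (intro E_sum E_scale delta_eps_E)
  have rep_h: "rep (h \<otimes> t) = t" if "h \<in> H" "t \<in> T1" for h t
    using that by (intro rep_eqI) (auto simp: N_closed H_closed inv_mult_group m_assoc[symmetric])
  have "\<alpha> = (\<Sum>g\<in>N. \<alpha> g *\<^sub>Q (\<delta> g \<star> \<epsilon>))"
    using arg_cong[OF supp_expand[OF finite_N A_supp_N[OF \<alpha>]], of "\<lambda>u. u \<star> \<epsilon>"] A_eps[OF \<alpha>]
    by (simp add: star_sum_left star_scale_left)
  also have "\<dots> = (\<Sum>(t, h)\<in>T1 \<times> H. \<alpha> (h \<otimes> t) *\<^sub>Q (\<delta> (h \<otimes> t) \<star> \<epsilon>))"
  proof (rule sum.reindex_bij_witness[of _ "\<lambda>(t, h). h \<otimes> t" "\<lambda>g. (rep g, g \<otimes> inv (rep g))"])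
    fix g assume g: "g \<in> N"
    have r: "rep g \<in> T1" "rep g \<in> N" using rep_in_T1[OF g] by auto
    have "inv (rep g \<otimes> inv g) \<in> H"
      using rep_coset[OF g] by (rule H_closed(2))
    then show "(rep g, g \<otimes> inv (rep g)) \<in> T1 \<times> H"
      using r g by (simp add: inv_mult_group)
    show "(case (rep g, g \<otimes> inv (rep g)) of (t, h) \<Rightarrow> h \<otimes> t) = g"
      using r g by (simp add: m_assoc)
    then show "(case (rep g, g \<otimes> inv (rep g)) of (t, h) \<Rightarrow> \<alpha> (h \<otimes> t) *\<^sub>Q (\<delta> (h \<otimes> t) \<star> \<epsilon>)) = \<alpha> g *\<^sub>Q (\<delta> g \<star> \<epsilon>)"
      by simp
  next
    fix p assume "p \<in> T1 \<times> H"
    then obtain t h where p: "p = (t, h)" "t \<in> T1" "h \<in> H" by auto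
    then show "(case p of (t, h) \<Rightarrow> h \<otimes> t) \<in> N"
      by (simp add: N_closed)
    show "(rep (case p of (t, h) \<Rightarrow> h \<otimes> t), (case p of (t, h) \<Rightarrow> h \<otimes> t) \<otimes> inv (rep (case p of (t, h) \<Rightarrow> h \<otimes> t))) = p"
      using p by (simp add: rep_h m_assoc)
  qed
  also have "\<dots> = (\<Sum>t\<in>T1. \<Sum>h\<in>H. \<alpha> (h \<otimes> t) *\<^sub>Q (\<delta> (h \<otimes> t) \<star> \<epsilon>))"
    by (simp add: sum.cartesian_product)
  also have "\<dots> = (\<Sum>t\<in>T1. \<xi> t \<star> (\<delta> t \<star> \<epsilon>))"
  proof (intro sum.cong refl)
    fix t assume t: "t \<in> T1"
    have "\<delta> h \<star> \<epsilon> \<star> (\<delta> t \<star> \<epsilon>) = \<delta> (h \<otimes> t) \<star> \<epsilon>" if "h \<in> H" for h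
      using that t by (simp add: star_assoc eps_A[OF delta_A])
    then show "(\<Sum>h\<in>H. \<alpha> (h \<otimes> t) *\<^sub>Q (\<delta> (h \<otimes> t) \<star> \<epsilon>)) = \<xi> t \<star> (\<delta> t \<star> \<epsilon>)"
      by (simp add: \<xi>_def star_sum_left star_scale_left)
  qed
  finally show "\<alpha> = (\<Sum>t\<in>T1. \<xi> t \<star> (\<delta> t \<star> \<epsilon>))" .
qed

lemma expansion_action:
  assumes \<xi>: "\<And>t. t \<in> T1 \<Longrightarrow> \<xi> t \<in> \<E>" and v: "v \<in> \<E>"
  shows "(\<Sum>t\<in>T1. \<xi> t \<star> (\<delta> t \<star> \<epsilon>)) \<star> (v \<star> \<theta>) = (\<Sum>t\<in>T1. \<xi> t \<star> conj_by G t v) \<star> \<theta>"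
  unfolding star_sum_left
proof (intro sum.cong refl)
  fix t assume t: "t \<in> T1"
  have "\<xi> t \<star> (\<delta> t \<star> \<epsilon>) \<star> (v \<star> \<theta>) = \<xi> t \<star> (\<delta> t \<star> (\<epsilon> \<star> v \<star> \<theta>))"
    by (simp only: star_assoc)
  then show "\<xi> t \<star> (\<delta> t \<star> \<epsilon>) \<star> (v \<star> \<theta>) = \<xi> t \<star> conj_by G t v \<star> \<theta>"
    using t v by (simp add: eps_E T1_E_theta star_assoc)
qed

text \<open>Replacing the left factor \<open>h\<epsilon>\<close> by \<open>f(h\<epsilon>)\<close> in the averaging identity gives the required element:
  applied to \<open>v\<theta>\<close>, the identity writes \<open>v\<close> as a combination of the \<open>h\<epsilon>\<close> with coefficients in the
  fixed ring, through which \<open>f\<close> passes.\<close>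

lemma realize_linear:
  assumes fE: "\<And>v. v \<in> \<E> \<Longrightarrow> f v \<in> \<E>"
    and add: "\<And>v w. v \<in> \<E> \<Longrightarrow> w \<in> \<E> \<Longrightarrow> f (v + w) = f v + f w"
    and lin: "\<And>a v. a \<in> \<F> \<Longrightarrow> v \<in> \<E> \<Longrightarrow> f (a \<star> v) = a \<star> f v"
  shows "\<exists>\<alpha>\<in>\<A>. \<forall>v\<in>\<E>. \<alpha> \<star> (v \<star> \<theta>) = f v \<star> \<theta>"
proof
  define \<alpha> where "\<alpha> = ratio *\<^sub>Q (\<Sum>h\<in>H. f (\<delta> h \<star> \<epsilon>) \<star> \<theta> \<star> (\<delta> (inv h) \<star> \<epsilon>))"
  show "\<alpha> \<in> \<A>"
    unfolding \<alpha>_def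
    by (intro A_scale A_sum A_star theta_A E_A fE delta_eps_E) (auto simp: H_closed)
  have f_zero: "f 0 = 0"
    using add[OF E_zero E_zero] by simp
  have f_sum: "f (sum u S) = (\<Sum>h\<in>S. f (u h))" if "finite S" "\<And>h. h \<in> S \<Longrightarrow> u h \<in> \<E>" for u and S :: "'a set"
    using that
  proof (induction S rule: finite_induct)
    case (insert h S)
    have "sum u S \<in> \<E>" using insert.prems by (intro E_sum) simp
    then show ?case
      using insert add by simp
  qed (simp add: f_zero)
  show "\<forall>v\<in>\<E>. \<alpha> \<star> (v \<star> \<theta>) = f v \<star> \<theta>"
  proof
    fix v assume v: "v \<in> \<E>"
    define b where "b h = \<delta> (inv h) \<star> v" for h
    define a where "a h = (ratio / of_nat n) *\<^sub>Q trace (b h)" for h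
    have bE: "b h \<in> \<E>" if "h \<in> H" for h
    proof -
      have "b h = \<delta> (inv h) \<star> \<epsilon> \<star> v"
        using eps_E[OF v] by (simp add: b_def star_assoc)
      then show ?thesis
        using E_star[OF delta_eps_E v] that by (simp add: H_closed)
    qed
    have aF: "a h \<in> \<F>" if "h \<in> H" for h
      unfolding a_def using trace_F[OF bE[OF that]] by (rule F_scale)
    have action: "ratio *\<^sub>Q (\<theta> \<star> (\<delta> (inv h) \<star> (v \<star> \<theta>))) = a h \<star> \<theta>" if "h \<in> H" for h
      using theta_E_theta[OF bE[OF that]]
      by (simp add: a_def b_def star_scale_left star_assoc)
    have "(\<Sum>h\<in>H. a h \<star> (\<delta> h \<star> \<epsilon>)) \<star> \<theta> = v \<star> \<theta>"
    proof -
      have "v \<star> \<theta> = \<epsilon> \<star> (v \<star> \<theta>)"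
        using eps_E[OF v] by (simp add: star_assoc[symmetric])
      also have "\<dots> = (\<Sum>h\<in>H. \<delta> h \<star> (ratio *\<^sub>Q (\<theta> \<star> (\<delta> (inv h) \<star> (v \<star> \<theta>)))))"
        by (subst average_theta)
           (simp add: star_scale_left star_scale_right star_sum_left star_assoc rat_fun.scale_sum_right)
      also have "\<dots> = (\<Sum>h\<in>H. a h \<star> (\<delta> h \<star> \<epsilon>) \<star> \<theta>)"
      proof (intro sum.cong refl)
        fix h assume h: "h \<in> H"
        have "\<delta> h \<star> (a h \<star> \<theta>) = a h \<star> \<delta> h \<star> \<theta>"
          using F_commute_N[OF aF[OF h]] h by (simp add: star_assoc[symmetric])
        then show "\<delta> h \<star> (ratio *\<^sub>Q (\<theta> \<star> (\<delta> (inv h) \<star> (v \<star> \<theta>)))) = a h \<star> (\<delta> h \<star> \<epsilon>) \<star> \<theta>"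
          unfolding action[OF h] by (simp add: star_assoc eps_theta)
      qed
      finally show ?thesis
        by (simp add: star_sum_left)
    qed
    then have v_eq: "v = (\<Sum>h\<in>H. a h \<star> (\<delta> h \<star> \<epsilon>))"
      by (intro E_theta_inj[OF v] E_sum E_star F_E[OF aF] delta_eps_E) simp_all
    have "\<alpha> \<star> (v \<star> \<theta>) = (\<Sum>h\<in>H. f (\<delta> h \<star> \<epsilon>) \<star> (ratio *\<^sub>Q (\<theta> \<star> (\<delta> (inv h) \<star> (\<epsilon> \<star> v \<star> \<theta>)))))"
      by (simp add: \<alpha>_def star_scale_left star_scale_right star_sum_left star_assoc rat_fun.scale_sum_right)
    also have "\<dots> = (\<Sum>h\<in>H. f (a h \<star> (\<delta> h \<star> \<epsilon>)) \<star> \<theta>)"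
    proof (intro sum.cong refl)
      fix h assume h: "h \<in> H"
      have "f (\<delta> h \<star> \<epsilon>) \<star> (ratio *\<^sub>Q (\<theta> \<star> (\<delta> (inv h) \<star> (\<epsilon> \<star> v \<star> \<theta>)))) = f (\<delta> h \<star> \<epsilon>) \<star> a h \<star> \<theta>"
        unfolding eps_E[OF v] action[OF h] by (simp add: star_assoc)
      also have "f (\<delta> h \<star> \<epsilon>) \<star> a h = f (a h \<star> (\<delta> h \<star> \<epsilon>))"
        using E_commute[OF fE[OF delta_eps_E[OF h]] F_E[OF aF[OF h]]] lin[OF aF[OF h] delta_eps_E[OF h]]
        by simp
      finally show "f (\<delta> h \<star> \<epsilon>) \<star> (ratio *\<^sub>Q (\<theta> \<star> (\<delta> (inv h) \<star> (\<epsilon> \<star> v \<star> \<theta>)))) = f (a h \<star> (\<delta> h \<star> \<epsilon>)) \<star> \<theta>" .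
    qed
    also have "\<dots> = f v \<star> \<theta>"
      using f_sum[OF finite_H, of "\<lambda>h. a h \<star> (\<delta> h \<star> \<epsilon>)"] E_star F_E[OF aF] delta_eps_E v_eq
      by (simp add: star_sum_left)
    finally show "\<alpha> \<star> (v \<star> \<theta>) = f v \<star> \<theta>" .
  qed
qed

end

section \<open>The normal basis\<close>

context rat_group_algebra
begin

lemma ring_of_functions:
  fixes R :: "('a \<Rightarrow> rat, 'c) ring_scheme"
  assumes R: "carrier R = S" "\<And>f g. f \<oplus>\<^bsub>R\<^esub> g = f + g" "\<zero>\<^bsub>R\<^esub> = 0"
      "\<And>f g. f \<otimes>\<^bsub>R\<^esub> g = f \<star> g" "\<one>\<^bsub>R\<^esub> = u"
    and closed: "0 \<in> S" "\<And>f g. f \<in> S \<Longrightarrow> g \<in> S \<Longrightarrow> f - g \<in> S"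
      "\<And>f g. f \<in> S \<Longrightarrow> g \<in> S \<Longrightarrow> f \<star> g \<in> S"
    and unit: "u \<in> S" "\<And>f. f \<in> S \<Longrightarrow> u \<star> f = f" "\<And>f. f \<in> S \<Longrightarrow> f \<star> u = f"
  shows "ring R"
proof -
  have neg: "- f \<in> S" if "f \<in> S" for f
    using closed(2)[OF closed(1) that] by simp
  have add: "f + g \<in> S" if "f \<in> S" "g \<in> S" for f g
    using closed(2)[OF that(1) neg[OF that(2)]] by simp
  have "\<exists>g\<in>S. g + f = 0" if "f \<in> S" for f
    by (rule bexI[of _ "- f"]) (use neg that in auto)
  then show ?thesis
    by (intro ringI abelian_groupI monoidI)
       (simp_all add: R closed unit add neg star_assoc star_add_left star_add_right add.assoc add.commute)
qed

lemma idem_algebra_simps [simp]: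
  "f \<oplus>\<^bsub>idem_algebra G S e\<^esub> g = f + g" "\<zero>\<^bsub>idem_algebra G S e\<^esub> = 0"
  "f \<otimes>\<^bsub>idem_algebra G S e\<^esub> g = f \<star> g" "\<one>\<^bsub>idem_algebra G S e\<^esub> = e"
  by (simp_all add: idem_algebra_def add_group_algebra zero_group_algebra)

lemma carrier_idem_algebra:
  assumes "subgroup S G" "e \<in> supp S" "e \<star> e = e"
  shows "carrier (idem_algebra G S e) = {v \<in> supp S. v \<star> e = v}"
proof -
  have "carrier (idem_algebra G S e) = (\<lambda>\<alpha>. \<alpha> \<star> e) ` supp S"
    by (simp add: idem_algebra_def carrier_group_algebra)
  also have "\<dots> = {v \<in> supp S. v \<star> e = v}"
  proof
    show "(\<lambda>\<alpha>. \<alpha> \<star> e) ` supp S \<subseteq> {v \<in> supp S. v \<star> e = v}"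
      using assms supp_star[OF assms(1)] by (auto simp: star_assoc)
    show "{v \<in> supp S. v \<star> e = v} \<subseteq> (\<lambda>\<alpha>. \<alpha> \<star> e) ` supp S"
    proof
      fix v assume "v \<in> {v \<in> supp S. v \<star> e = v}"
      then have "v = v \<star> e" "v \<in> supp S" by auto
      then show "v \<in> (\<lambda>\<alpha>. \<alpha> \<star> e) ` supp S" by (rule image_eqI)
    qed
  qed
  finally show ?thesis .
qed

end

context untwisted_shoda_pair
begin

abbreviation "cf \<equiv> coeff_field G H K"
abbreviation "ff \<equiv> fixed_field G H K"
abbreviation "na \<equiv> norm_algebra G H K"

lemma carrier_cf: "carrier cf = \<E>"
  unfolding coeff_field_def coeffs_def
  by (rule carrier_idem_algebra[OF subgroup_H eps_supp_H eps_idem])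

lemma carrier_na: "carrier na = \<A>"
  unfolding norm_algebra_def crossed_def
  by (rule carrier_idem_algebra[OF subgroup_N supp_mono[OF eps_supp_H H_subset_N] eps_idem])

lemma carrier_ff: "carrier ff = \<F>"
  by (simp add: fixed_field_def fixeds_def carrier_cf)

lemma cf_simps [simp]:
  "f \<oplus>\<^bsub>cf\<^esub> g = f + g" "\<zero>\<^bsub>cf\<^esub> = 0" "f \<otimes>\<^bsub>cf\<^esub> g = f \<star> g" "\<one>\<^bsub>cf\<^esub> = \<epsilon>"
  by (simp_all add: coeff_field_def)

lemma ff_simps [simp]:
  "f \<oplus>\<^bsub>ff\<^esub> g = f + g" "\<zero>\<^bsub>ff\<^esub> = 0" "f \<otimes>\<^bsub>ff\<^esub> g = f \<star> g" "\<one>\<^bsub>ff\<^esub> = \<epsilon>"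
  by (simp_all add: fixed_field_def coeff_field_def idem_algebra_def add_group_algebra zero_group_algebra)

lemma na_simps [simp]:
  "f \<oplus>\<^bsub>na\<^esub> g = f + g" "\<zero>\<^bsub>na\<^esub> = 0" "f \<otimes>\<^bsub>na\<^esub> g = f \<star> g" "\<one>\<^bsub>na\<^esub> = \<epsilon>"
  by (simp_all add: norm_algebra_def)

lemma ring_cf: "ring cf"
  by (rule ring_of_functions[where S = \<E> and u = \<epsilon>])
     (simp_all add: carrier_cf E_zero E_diff E_star E_one eps_E E_eps)

lemma ring_ff: "ring ff"
  by (rule ring_of_functions[where S = \<F> and u = \<epsilon>])
     (simp_all add: carrier_ff F_zero F_diff F_star F_one eps_E E_eps F_E)

lemma ring_na: "ring na"
  by (rule ring_of_functions[where S = \<A> and u = \<epsilon>])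
     (simp_all add: carrier_na A_zero A_diff A_star E_A[OF E_one] eps_A A_eps)

lemma Span_Nil: "ring.Span cf \<F> [] = {0}"
  using ring.Span.simps[OF ring_cf, of \<F> "[]"] by simp

lemma Span_Cons: "ring.Span cf \<F> (u # us) = {a \<star> u + v | a v. a \<in> \<F> \<and> v \<in> ring.Span cf \<F> us}"
proof -
  have "ring.Span cf \<F> (u # us) = ring.line_extension cf \<F> u (ring.Span cf \<F> us)"
    using ring.Span.simps[OF ring_cf, of \<F>] by simp
  also have "\<dots> = {a \<star> u + v | a v. a \<in> \<F> \<and> v \<in> ring.Span cf \<F> us}"
    by (auto simp: ring.line_extension_def[OF ring_cf] set_add_def set_mult_def r_coset_def)
  finally show ?thesis .
qed

lemma Span_coefficients:
  assumes "v \<in> ring.Span cf \<F> us"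
  shows "\<exists>c. (\<forall>u. c u \<in> \<F>) \<and> v = (\<Sum>u\<in>set us. c u \<star> u)"
  using assms
proof (induction us arbitrary: v)
  case Nil
  then show ?case
    using F_zero by (auto simp: Span_Nil)
next
  case (Cons u us)
  then obtain a v' where av: "v = a \<star> u + v'" "a \<in> \<F>" "v' \<in> ring.Span cf \<F> us"
    by (auto simp: Span_Cons)
  from Cons.IH[OF av(3)] obtain c where c: "\<forall>u. c u \<in> \<F>" "v' = (\<Sum>u\<in>set us. c u \<star> u)"
    by blast
  show ?case
  proof (cases "u \<in> set us")
    case True
    have "(\<Sum>x\<in>set us. (c(u := a + c u)) x \<star> x) = (a + c u) \<star> u + (\<Sum>x\<in>set us - {u}. c x \<star> x)"
      using True by (subst sum.remove[of _ u]) (auto intro!: sum.cong)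
    also have "\<dots> = v"
      using True by (simp add: av(1) c(2) star_add_left add.assoc sum.remove[of "set us" u])
    finally show ?thesis
      using True c(1) av(2) by (intro exI[of _ "c(u := a + c u)"]) (simp add: insert_absorb F_add)
  next
    case False
    have "(\<Sum>x\<in>set us. (c(u := a)) x \<star> x) = v'"
      unfolding c(2) using False by (intro sum.cong) auto
    then show ?thesis
      using False c(1) av by (intro exI[of _ "c(u := a)"]) simp
  qed
qed

lemma rational_combination_Span:
  "(\<Sum>u\<in>set us. q u *\<^sub>Q u) \<in> ring.Span cf \<F> us" if "set us \<subseteq> \<E>"
  using that
proof (induction us)
  case Nil
  then show ?case by (simp add: Span_Nil)
next
  case (Cons u us)
  have u: "u \<in> \<E>" using Cons.prems by simp
  let ?s = "\<Sum>u\<in>set us. q u *\<^sub>Q u"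
  have IH: "?s \<in> ring.Span cf \<F> us" using Cons by simp
  show ?case
  proof (cases "u \<in> set us")
    case True
    then have "(\<Sum>u\<in>set (u # us). q u *\<^sub>Q u) = 0 \<star> u + ?s"
      by (simp add: insert_absorb)
    then show ?thesis
      unfolding Span_Cons using F_zero IH by blast
  next
    case False
    then have "(\<Sum>u\<in>set (u # us). q u *\<^sub>Q u) = (q u *\<^sub>Q \<epsilon>) \<star> u + ?s"
      by (simp add: star_scale_left eps_E[OF u])
    then show ?thesis
      unfolding Span_Cons using F_scale[OF F_one] IH by blast
  qed
qed

text \<open>Independence says that no member of the list lies in the span of the later ones. A linear relation
  contradicts this as soon as its first nonzero coefficient is invertible, which is automatic for
  rational coefficients.\<close>

lemma independent_rational:
  assumes "ring.independent cf \<F> us" "(\<Sum>u\<in>set us. q u *\<^sub>Q u) = 0" "u \<in> set us"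
  shows "q u = 0"
  using assms
proof (induction us arbitrary: u)
  case (Cons a us)
  have ind: "a \<in> \<E>" "a \<notin> ring.Span cf \<F> us" "ring.independent cf \<F> us"
    using Cons.prems(1) by (auto simp: carrier_cf elim: ring.independent.cases[OF ring_cf])
  have us: "set us \<subseteq> \<E>"
    using ind(3)
  proof (induction us)
    case (Cons b us)
    then show ?case
      by (auto simp: carrier_cf elim: ring.independent.cases[OF ring_cf])
  qed simp
  have "a \<notin> set us"
  proof
    assume "a \<in> set us"
    then have "(\<Sum>u\<in>set us. (if u = a then 1 else 0) *\<^sub>Q u) = a"
      by (subst sum.remove[of _ a]) (auto intro!: sum.neutral)
    then show False
      using rational_combination_Span[OF us, of "\<lambda>u. if u = a then 1 else 0"] ind(2) by simp
  qed
  then have sum: "q a *\<^sub>Q a + (\<Sum>u\<in>set us. q u *\<^sub>Q u) = 0"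
    using Cons.prems(2) by simp
  have "q a = 0"
  proof (rule ccontr)
    assume nz: "q a \<noteq> 0"
    have "q a *\<^sub>Q a = - (\<Sum>u\<in>set us. q u *\<^sub>Q u)"
      using sum by (simp add: eq_neg_iff_add_eq_0)
    then have "(1 / q a) *\<^sub>Q (q a *\<^sub>Q a) = (1 / q a) *\<^sub>Q (- (\<Sum>u\<in>set us. q u *\<^sub>Q u))"
      by (simp only:)
    then have "a = - (\<Sum>u\<in>set us. (1 / q a) *\<^sub>Q (q u *\<^sub>Q u))"
      using nz by (simp add: rat_fun.scale_sum_right)
    also have "\<dots> = (\<Sum>u\<in>set us. (- q u / q a) *\<^sub>Q u)"
      by (simp add: sum_negf)
    finally have "a = (\<Sum>u\<in>set us. (- q u / q a) *\<^sub>Q u)" .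
    then show False
      using rational_combination_Span[OF us, of "\<lambda>u. - q u / q a"] ind(2) by simp
  qed
  then show ?case
    using Cons.IH[OF ind(3)] sum Cons.prems(3) by auto
qed simp

text \<open>Conjugations are among the automorphisms that enter the definition of the normal basis.\<close>

lemma conj_galois:
  assumes g: "g \<in> N"
  shows "conj_by G g \<in> galois_group cf \<F>"
proof -
  have "conj_by G (inv g) (conj_by G g v) = v" "conj_by G g (conj_by G (inv g) v) = v" if "v \<in> \<E>" for v
    using that g E_supp by (simp_all add: conj_by_conj_by conj_by_one)
  then have "bij_betw (conj_by G g) \<E> \<E>"
    using conj_E g by (intro bij_betwI[of _ _ _ "conj_by G (inv g)"]) (auto simp: N_closed)
  moreover have "conj_by G g \<in> ring_hom cf cf"
    using g by (intro ring_hom_memI) (auto simp: carrier_cf conj_E conj_by_star conj_by_add conj_by_eps)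
  ultimately show ?thesis
    using g by (auto simp: galois_group_def ring_iso_def carrier_cf fixeds_def)
qed

lemma galois_closed: "\<sigma> \<in> galois_group cf \<F> \<Longrightarrow> v \<in> \<E> \<Longrightarrow> \<sigma> v \<in> \<E>"
  by (auto simp: galois_group_def ring_iso_def ring_hom_def carrier_cf)

lemma galois_add: "\<sigma> \<in> galois_group cf \<F> \<Longrightarrow> v \<in> \<E> \<Longrightarrow> u \<in> \<E> \<Longrightarrow> \<sigma> (v + u) = \<sigma> v + \<sigma> u"
  by (auto simp: galois_group_def ring_iso_def ring_hom_def carrier_cf)

lemma galois_sum:
  assumes \<sigma>: "\<sigma> \<in> galois_group cf \<F>" and "finite A" "\<And>i. i \<in> A \<Longrightarrow> f i \<in> \<E>"
  shows "\<sigma> (sum f A) = (\<Sum>i\<in>A. \<sigma> (f i))"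
  using assms(2,3)
proof (induction A rule: finite_induct)
  case empty
  have "\<sigma> 0 = \<sigma> 0 + \<sigma> 0"
    using galois_add[OF \<sigma> E_zero E_zero] by simp
  then show ?case by simp
next
  case (insert i A)
  have "sum f A \<in> \<E>"
    using insert.prems by (intro E_sum) simp
  then show ?case
    using insert galois_add[OF \<sigma>] by simp
qed

lemma galois_comp:
  assumes "\<sigma> \<in> galois_group cf \<F>" "\<rho> \<in> galois_group cf \<F>"
  shows "(\<lambda>v. \<sigma> (\<rho> v)) \<in> galois_group cf \<F>"
proof -
  have "(\<lambda>v. \<sigma> (\<rho> v)) = \<sigma> \<circ> \<rho>" by auto
  then show ?thesis
    using assms by (auto simp: galois_group_def intro: ring_iso_set_trans)
qed

end

locale normal_basis_pair = untwisted_shoda_pair G H K y \<zeta> \<phi> T1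
  for G :: "('a, 'b) monoid_scheme" (structure) and H K y \<zeta> \<phi> T1 +
  fixes w :: "'a \<Rightarrow> rat" and bs :: "('a \<Rightarrow> rat) list"
  assumes normal_w: "normal_element (coeff_field G H K) (carrier (fixed_field G H K)) w"
    and distinct_bs: "distinct bs"
    and set_bs: "set bs = normal_basis (coeff_field G H K) (carrier (fixed_field G H K)) w"
begin

lemma w_E: "w \<in> \<E>"
  using normal_w by (simp add: normal_element_def carrier_cf)

lemma set_bs_eq: "set bs = (\<lambda>\<sigma>. \<sigma> w) ` galois_group cf \<F>"
  using set_bs by (simp add: normal_basis_def carrier_ff)

lemma ordered_basis:
  obtains us where "set us = set bs" "ring.independent cf \<F> us" "ring.Span cf \<F> us = \<E>"
  using normal_w set_bs unfolding normal_element_def carrier_cf carrier_ff by auto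

lemma set_bs_E: "set bs \<subseteq> \<E>"
  using galois_closed w_E by (auto simp: set_bs_eq)

lemma spanned:
  assumes "v \<in> \<E>"
  shows "\<exists>c. (\<forall>u. c u \<in> \<F>) \<and> v = (\<Sum>u\<in>set bs. c u \<star> u)"
proof -
  obtain us where us: "set us = set bs" "ring.independent cf \<F> us" "ring.Span cf \<F> us = \<E>"
    by (rule ordered_basis)
  show ?thesis
    using Span_coefficients[of v us] assms by (simp add: us)
qed

text \<open>An abstract automorphism fixes the sum of the conjugates of \<open>w\<close>. This is a rational relation
  between elements of the normal basis, so by independence the automorphism
  permutes these conjugates.\<close>

lemma set_bs_conj: "set bs = (\<lambda>t. conj_by G t w) ` T1"
proof
  show "(\<lambda>t. conj_by G t w) ` T1 \<subseteq> set bs"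
    using conj_galois by (auto simp: set_bs_eq)
  show "set bs \<subseteq> (\<lambda>t. conj_by G t w) ` T1"
  proof
    fix b assume "b \<in> set bs"
    then obtain \<sigma> where \<sigma>: "\<sigma> \<in> galois_group cf \<F>" "b = \<sigma> w"
      by (auto simp: set_bs_eq)
    \<comment> \<open>the multiplicities with which \<open>x\<close> occurs among the conjugates of \<open>w\<close> and among their images\<close>
    define c d where "c x = card {t \<in> T1. conj_by G t w = x}"
      and "d x = card {t \<in> T1. \<sigma> (conj_by G t w) = x}" for x
    have group: "(\<Sum>x\<in>set bs. of_nat (card {t \<in> T1. f t = x}) *\<^sub>Q x) = (\<Sum>t\<in>T1. f t)"
      if "\<And>t. t \<in> T1 \<Longrightarrow> f t \<in> set bs" for f :: "'a \<Rightarrow> 'a \<Rightarrow> rat"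
    proof -
      have "(\<Sum>t\<in>T1. f t) = (\<Sum>x\<in>set bs. \<Sum>t\<in>{t \<in> T1. f t = x}. f t)"
        using that finite_T1 by (intro sum.group[symmetric]) auto
      also have "\<dots> = (\<Sum>x\<in>set bs. \<Sum>t\<in>{t \<in> T1. f t = x}. x)"
        by (intro sum.cong) auto
      finally show ?thesis
        by (simp only: sum_constant_scale)
    qed
    have in_bs: "conj_by G t w \<in> set bs" "\<sigma> (conj_by G t w) \<in> set bs" if "t \<in> T1" for t
      using conj_galois[of t] galois_comp[OF \<sigma>(1) conj_galois[of t]] that by (auto simp: set_bs_eq)
    have "(\<Sum>x\<in>set bs. of_nat (d x) *\<^sub>Q x) = (\<Sum>t\<in>T1. \<sigma> (conj_by G t w))"
      unfolding d_def by (rule group) (rule in_bs)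
    also have "\<dots> = \<sigma> (trace w)"
      unfolding trace_def using galois_sum[OF \<sigma>(1) finite_T1] conj_E[OF w_E] by simp
    also have "\<dots> = trace w"
      using \<sigma>(1) trace_F[OF w_E] by (auto simp: galois_group_def)
    also have "\<dots> = (\<Sum>x\<in>set bs. of_nat (c x) *\<^sub>Q x)"
      unfolding c_def trace_def by (rule group[symmetric]) (rule in_bs)
    finally have "(\<Sum>x\<in>set bs. (of_nat (d x) - of_nat (c x)) *\<^sub>Q x) = 0"
      by (simp add: rat_fun.scale_left_diff_distrib sum_subtractf)
    moreover obtain us where us: "set us = set bs" "ring.independent cf \<F> us" "ring.Span cf \<F> us = \<E>"
      by (rule ordered_basis)
    ultimately have "rat_of_nat (d b) - of_nat (c b) = 0"
      using independent_rational[OF us(2), of "\<lambda>x. of_nat (d x) - of_nat (c x)" b] \<open>b \<in> set bs\<close>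
      by (simp add: us(1))
    then have "c b = d b" by simp
    \<comment> \<open>the representative of the trivial coset shows that the multiplicity of \<open>b\<close> is positive\<close>
    moreover have "rep \<one> \<in> {t \<in> T1. \<sigma> (conj_by G t w) = b}"
    proof -
      have "rep \<one> \<in> T1" "rep \<one> \<in> H"
        using rep_in_T1[OF N_closed(3)] rep_coset[OF N_closed(3)] by auto
      then show ?thesis
        using conj_E_H[OF w_E] \<sigma>(2) by simp
    qed
    then have "d b > 0"
      using finite_T1 by (auto simp: d_def card_gt_0_iff)
    ultimately have "card {t \<in> T1. conj_by G t w = b} \<noteq> 0"
      by (simp add: c_def)
    then have "{t \<in> T1. conj_by G t w = b} \<noteq> {}"
      by (metis card.empty)
    then show "b \<in> (\<lambda>t. conj_by G t w) ` T1" by auto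
  qed
qed

text \<open>As \<open>N/H\<close> is abelian, an element that fixes \<open>w\<close> fixes all conjugates of
  \<open>w\<close>, hence everything that they span. In particular it centralizes \<open>H/K\<close>.\<close>

lemma conj_w_inj: "inj_on (\<lambda>t. conj_by G t w) T1"
proof (rule inj_onI)
  fix t t' assume t: "t \<in> T1" "t' \<in> T1" and eq: "conj_by G t w = conj_by G t' w"
  define g where "g = inv t' \<otimes> t"
  have g: "g \<in> N" using t by (simp add: g_def N_closed)
  have "conj_by G g w = conj_by G (inv t') (conj_by G t w)"
    using t by (simp add: g_def conj_by_conj_by)
  also have "\<dots> = w"
    unfolding eq using t E_supp[OF w_E] by (simp add: conj_by_conj_by conj_by_one)
  finally have gw: "conj_by G g w = w" .
  have "conj_by G g u = u" if "u \<in> set bs" for u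
  proof -
    from that obtain s where s: "s \<in> T1" "u = conj_by G s w"
      by (auto simp: set_bs_conj)
    then show ?thesis
      using conj_E_commute[OF w_E g, of s] gw by simp
  qed
  then have fix_all: "conj_by G g v = v" if "v \<in> \<E>" for v
  proof -
    from spanned[OF that] obtain c where c: "\<forall>u. c u \<in> \<F>" "v = (\<Sum>u\<in>set bs. c u \<star> u)"
      by blast
    have "conj_by G g (c u) = c u" for u
      using c(1) g by (simp add: fixeds_def)
    then show ?thesis
      unfolding c(2) conj_by_sum using g \<open>\<And>u. u \<in> set bs \<Longrightarrow> conj_by G g u = u\<close>
      by (intro sum.cong) (simp_all add: conj_by_star)
  qed
  have "\<delta> (g \<otimes> y \<otimes> inv g) \<star> \<epsilon> = conj_by G g (\<delta> y \<star> \<epsilon>)"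
    using g y_in_H by (simp add: conj_by_star conj_by_delta conj_by_eps)
  also have "\<dots> = \<delta> y \<star> \<epsilon>"
    by (rule fix_all[OF delta_eps_E[OF y_in_H]])
  finally have "\<delta> (inv y) \<star> (\<delta> (g \<otimes> y \<otimes> inv g) \<star> \<epsilon>) = \<epsilon>"
    using y_in_H by (simp add: delta_one_star eps_supp)
  then have "inv y \<otimes> (g \<otimes> y \<otimes> inv g) \<in> K"
    using fixes_eps_iff[of "inv y \<otimes> (g \<otimes> y \<otimes> inv g)"] g y_in_H by simp
  then have "y \<otimes> (inv y \<otimes> (g \<otimes> y \<otimes> inv g)) \<otimes> inv y \<in> K"
    using conj_in_K y_in_H by simp
  then have "(g \<otimes> y) \<otimes> inv (y \<otimes> g) \<in> K"
    using g y_in_H by (simp add: m_assoc inv_mult_group)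
  then have "g \<in> H"
    using in_H_if_centralizes_y g by blast
  then have "t' \<otimes> g \<otimes> inv t' \<in> H"
    using conj_in_H t by simp
  then show "t = t'"
    using t T1_eqI[of t t'] by (simp add: g_def m_assoc)
qed

text \<open>Replacing each conjugate of \<open>w\<close> in the relation by the corresponding element of
  \<open>T\<^sub>1\<close> gives an element \<open>\<alpha>\<close> that kills \<open>w\<theta>\<close>. It
  commutes with \<open>T\<^sub>1\<close> because \<open>N/H\<close> is abelian, so it kills the other conjugates
  as well and vanishes by faithfulness. Averaging \<open>\<alpha>s\<inverse>\<close> over \<open>H\<close> then
  isolates the coefficient of \<open>s\<close>.\<close>

lemma unique_coefficients:
  assumes a: "\<And>t. t \<in> T1 \<Longrightarrow> a t \<in> \<F>" and zero: "(\<Sum>t\<in>T1. a t \<star> conj_by G t w) = 0" and s: "s \<in> T1"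
  shows "a s = 0"
proof -
  define \<alpha> where "\<alpha> = (\<Sum>t\<in>T1. a t \<star> (\<delta> t \<star> \<epsilon>))"
  have \<alpha>A: "\<alpha> \<in> \<A>"
    unfolding \<alpha>_def using E_A[OF F_E[OF a]] by (intro A_sum A_star delta_A) auto
  have \<alpha>w: "\<alpha> \<star> (w \<star> \<theta>) = 0"
    unfolding \<alpha>_def using expansion_action[OF F_E[OF a] w_E] zero by simp
  have commute: "\<alpha> \<star> \<delta> r = \<delta> r \<star> \<alpha>" if r: "r \<in> T1" for r
    unfolding \<alpha>_def star_sum_left star_sum_right
  proof (intro sum.cong refl)
    fix t assume t: "t \<in> T1"
    have "a t \<star> (\<delta> t \<star> \<epsilon>) \<star> \<delta> r = a t \<star> (\<delta> (t \<otimes> r) \<star> \<epsilon>)"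
      using t r by (simp add: star_assoc eps_commute[symmetric])
    also have "\<dots> = a t \<star> (\<delta> r \<star> (\<delta> t \<star> \<epsilon>))"
      using t r T1_commute[OF t r] by simp
    also have "\<dots> = \<delta> r \<star> (a t \<star> (\<delta> t \<star> \<epsilon>))"
      using F_commute_N[OF a[OF t] T1_N[OF r]] by (simp only: star_assoc[symmetric])
    finally show "a t \<star> (\<delta> t \<star> \<epsilon>) \<star> \<delta> r = \<delta> r \<star> (a t \<star> (\<delta> t \<star> \<epsilon>))" .
  qed
  have kills: "\<alpha> \<star> (u \<star> \<theta>) = 0" if "u \<in> set bs" for u
  proof -
    from that obtain r where r: "r \<in> T1" "u = conj_by G r w"
      by (auto simp: set_bs_conj)
    have "\<alpha> \<star> (u \<star> \<theta>) = \<alpha> \<star> \<delta> r \<star> (w \<star> \<theta>)"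
      unfolding r(2) T1_E_theta[OF w_E r(1), symmetric] by (simp only: star_assoc)
    also have "\<dots> = 0"
      unfolding commute[OF r(1)] by (simp add: star_assoc \<alpha>w)
    finally show ?thesis .
  qed
  have "\<alpha> = 0"
  proof (rule faithful[OF A_eps[OF \<alpha>A]])
    fix v assume "v \<in> \<E>"
    from spanned[OF this] obtain c where c: "\<forall>u. c u \<in> \<F>" "v = (\<Sum>u\<in>set bs. c u \<star> u)"
      by blast
    have "\<alpha> \<star> (c u \<star> u \<star> \<theta>) = 0" if "u \<in> set bs" for u
    proof -
      have "\<alpha> \<star> (c u \<star> u \<star> \<theta>) = c u \<star> (\<alpha> \<star> (u \<star> \<theta>))"
        using F_commute_A[OF _ \<alpha>A, of "c u"] c(1) by (simp add: star_assoc[symmetric])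
      then show ?thesis
        using kills[OF that] by simp
    qed
    then show "\<alpha> \<star> (v \<star> \<theta>) = 0"
      unfolding c(2) star_sum_left star_sum_right by (intro sum.neutral) simp
  qed
  then have "0 = (\<Sum>h\<in>H. \<delta> h \<star> (\<alpha> \<star> \<delta> (inv s)) \<star> \<delta> (inv h))"
    by simp
  also have "\<dots> = (\<Sum>h\<in>H. \<Sum>t\<in>T1. a t \<star> (\<delta> (h \<otimes> (t \<otimes> inv s) \<otimes> inv h) \<star> \<epsilon>))"
    unfolding \<alpha>_def star_sum_left star_sum_right
  proof (intro sum.cong refl)
    fix h t assume h: "h \<in> H" and t: "t \<in> T1"
    have eps_right: "\<epsilon> \<star> \<delta> (inv g) = \<delta> (inv g) \<star> \<epsilon>" if "g \<in> N" for g
      using eps_commute[OF N_closed(2)[OF that]] by simp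
    have "\<delta> h \<star> (a t \<star> (\<delta> t \<star> \<epsilon>) \<star> \<delta> (inv s)) \<star> \<delta> (inv h) =
        \<delta> h \<star> a t \<star> (\<delta> t \<star> (\<delta> (inv s) \<star> (\<delta> (inv h) \<star> \<epsilon>)))"
      using eps_right[of s] eps_right[of h] h s by (simp add: star_assoc)
    also have "\<dots> = a t \<star> (\<delta> h \<star> (\<delta> t \<star> (\<delta> (inv s) \<star> (\<delta> (inv h) \<star> \<epsilon>))))"
      using F_commute_N[OF a[OF t], of h] h by (simp add: star_assoc)
    finally show "\<delta> h \<star> (a t \<star> (\<delta> t \<star> \<epsilon>) \<star> \<delta> (inv s)) \<star> \<delta> (inv h) =
        a t \<star> (\<delta> (h \<otimes> (t \<otimes> inv s) \<otimes> inv h) \<star> \<epsilon>)"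
      using h t s by (simp add: m_assoc)
  qed
  also have "\<dots> = (\<Sum>t\<in>T1. a t \<star> ((\<Sum>h\<in>H. \<delta> (h \<otimes> (t \<otimes> inv s) \<otimes> inv h)) \<star> \<epsilon>))"
    by (subst sum.swap) (simp only: star_sum_left star_sum_right)
  also have "\<dots> = (\<Sum>t\<in>T1. if t = s then of_nat (card H) *\<^sub>Q a s else 0)"
  proof (intro sum.cong refl)
    fix t assume t: "t \<in> T1"
    show "a t \<star> ((\<Sum>h\<in>H. \<delta> (h \<otimes> (t \<otimes> inv s) \<otimes> inv h)) \<star> \<epsilon>) = (if t = s then of_nat (card H) *\<^sub>Q a s else 0)"
    proof (cases "t = s")
      case True
      have "(\<Sum>h\<in>H. \<delta> (h \<otimes> (t \<otimes> inv s) \<otimes> inv h)) \<star> \<epsilon> = (\<Sum>h\<in>H. \<epsilon>)"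
        unfolding star_sum_left using True s by (intro sum.cong) (auto simp: delta_one_star eps_supp)
      then show ?thesis
        using True E_eps[OF F_E[OF a[OF s]]] by (simp only: sum_constant_scale star_scale_right) simp
    next
      case False
      then have "t \<otimes> inv s \<notin> H"
        using T1_eqI t s by blast
      then show ?thesis
        using sum_conj_H_zero[of "t \<otimes> inv s"] t s False by (simp add: N_closed)
    qed
  qed
  also have "\<dots> = of_nat (card H) *\<^sub>Q a s"
    using s finite_T1 by simp
  finally show ?thesis
    using finite_H y_in_H by auto
qed

lemma length_bs: "length bs = n"
  using distinct_card[OF distinct_bs] card_image[OF conj_w_inj] by (simp add: set_bs_conj)

definition basis_rep :: "nat \<Rightarrow> 'a" where
  "basis_rep i = (THE t. t \<in> T1 \<and> conj_by G t w = bs ! i)"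

lemma basis_rep:
  assumes "i < n"
  shows "basis_rep i \<in> T1" "conj_by G (basis_rep i) w = bs ! i"
proof -
  have "bs ! i \<in> (\<lambda>t. conj_by G t w) ` T1"
    using nth_mem[of i bs] assms by (simp add: length_bs set_bs_conj)
  then have "\<exists>!t. t \<in> T1 \<and> conj_by G t w = bs ! i"
    using conj_w_inj by (auto simp: inj_on_def)
  from theI'[OF this] show "basis_rep i \<in> T1" "conj_by G (basis_rep i) w = bs ! i"
    unfolding basis_rep_def by auto
qed

lemma basis_rep_bij: "bij_betw basis_rep {..<n} T1"
proof -
  have "inj_on basis_rep {..<n}"
  proof (rule inj_onI)
    fix i j assume ij: "i \<in> {..<n}" "j \<in> {..<n}" "basis_rep i = basis_rep j"
    then have "bs ! i = bs ! j"
      using basis_rep(2)[of i] basis_rep(2)[of j] by simp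
    then show "i = j"
      using ij distinct_bs by (simp add: nth_eq_iff_index_eq length_bs)
  qed
  moreover have "basis_rep ` {..<n} \<subseteq> T1"
    using basis_rep by auto
  ultimately show ?thesis
    using finite_T1 by (simp add: bij_betw_def card_image card_subset_eq)
qed

lemma basis_E: "i < n \<Longrightarrow> bs ! i \<in> \<E>"
  using nth_mem[of i bs] set_bs_E by (auto simp: length_bs)

lemma basis_exists:
  assumes "v \<in> \<E>"
  shows "\<exists>c. (\<forall>i. c i \<in> \<F>) \<and> v = (\<Sum>i<n. c i \<star> (bs ! i))"
proof -
  from spanned[OF assms] obtain c where c: "\<forall>u. c u \<in> \<F>" "v = (\<Sum>u\<in>set bs. c u \<star> u)"
    by blast
  have "(\<Sum>i<n. c (bs ! i) \<star> (bs ! i)) = v"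
    unfolding c(2) using bij_betw_nth[OF distinct_bs, of "{..<n}" "set bs"]
    by (intro sum.reindex_bij_betw) (simp add: length_bs)
  then show ?thesis
    using c(1) by (intro exI[of _ "\<lambda>i. c (bs ! i)"]) simp
qed

lemma basis_unique:
  assumes c: "\<And>i. i < n \<Longrightarrow> c i \<in> \<F>" and d: "\<And>i. i < n \<Longrightarrow> d i \<in> \<F>"
    and eq: "(\<Sum>i<n. c i \<star> (bs ! i)) = (\<Sum>i<n. d i \<star> (bs ! i))" and i: "i < n"
  shows "c i = d i"
proof -
  define r where "r = the_inv_into {..<n} basis_rep"
  have inj: "inj_on basis_rep {..<n}" and img: "basis_rep ` {..<n} = T1"
    using basis_rep_bij by (auto simp: bij_betw_def)
  have r: "r (basis_rep j) = j" if "j < n" for j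
    unfolding r_def using that by (intro the_inv_into_f_f[OF inj]) simp
  have "c (r t) - d (r t) \<in> \<F>" if "t \<in> T1" for t
  proof -
    from that img obtain j where "j < n" "t = basis_rep j" by blast
    then show ?thesis
      using F_diff[OF c d] r by simp
  qed
  moreover have "(\<Sum>t\<in>T1. (c (r t) - d (r t)) \<star> conj_by G t w) = (\<Sum>j<n. (c j - d j) \<star> (bs ! j))"
    unfolding sum.reindex_bij_betw[OF basis_rep_bij, symmetric]
    by (intro sum.cong) (simp_all add: r basis_rep(2))
  moreover have "\<dots> = 0"
    using eq by (simp add: star_diff_left sum_subtractf)
  ultimately have "c (r (basis_rep i)) - d (r (basis_rep i)) = 0"
    using unique_coefficients[of "\<lambda>t. c (r t) - d (r t)" "basis_rep i"] basis_rep(1)[OF i] by simp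
  then show ?thesis
    using r[OF i] by simp
qed

lemma trace_basis:
  assumes "i < n"
  shows "trace (bs ! i) = (\<Sum>j<n. bs ! j)"
proof -
  let ?s = "basis_rep i"
  have s: "?s \<in> N" using basis_rep(1)[OF assms] by simp
  have "trace (bs ! i) = conj_by G ?s (trace w)"
    unfolding trace_def conj_by_sum basis_rep(2)[OF assms, symmetric]
    by (intro sum.cong refl conj_E_commute[OF w_E _ s]) simp
  also have "\<dots> = trace w"
    using trace_F[OF w_E] s by (simp add: fixeds_def)
  also have "\<dots> = (\<Sum>j<n. bs ! j)"
    unfolding trace_def sum.reindex_bij_betw[OF basis_rep_bij, symmetric]
    by (intro sum.cong) (simp_all add: basis_rep(2))
  finally show ?thesis .
qed

end

section \<open>Matrices over the fixed ring\<close>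

context untwisted_shoda_pair
begin

abbreviation "MF \<equiv> mat_ring ff n"

lemma finsum_ff: "(\<And>i. i \<in> A \<Longrightarrow> f i \<in> \<F>) \<Longrightarrow> finsum ff f A = sum f A"
  by (rule finsum_pointwise[where S = \<F>]) (auto simp: carrier_ff F_zero F_add)

lemma mat_carrier:
  "M \<in> carrier MF \<longleftrightarrow> (\<forall>i j. if i < n \<and> j < n then M i j \<in> \<F> else M i j = 0)"
  by (simp add: mat_ring_def carrier_ff)

lemma mat_F: "M \<in> carrier MF \<Longrightarrow> i < n \<Longrightarrow> j < n \<Longrightarrow> M i j \<in> \<F>"
  unfolding mat_carrier by (elim allE[of _ i] allE[of _ j]) simp

lemma mat_eqI:
  assumes "M \<in> carrier MF" "M' \<in> carrier MF" "\<And>i j. i < n \<Longrightarrow> j < n \<Longrightarrow> M i j = M' i j"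
  shows "M = M'"
proof (rule ext, rule ext)
  fix i j
  show "M i j = M' i j"
  proof (cases "i < n \<and> j < n")
    case False
    then have "M i j = 0" "M' i j = 0"
      using assms(1,2) unfolding mat_carrier by presburger+
    then show ?thesis by simp
  qed (use assms(3) in simp)
qed

lemma mat_entries_carrier:
  assumes "\<And>i j. i < n \<Longrightarrow> j < n \<Longrightarrow> f i j \<in> \<F>"
  shows "mat_entries ff n f \<in> carrier MF"
  using assms by (simp add: mat_carrier mat_entries_def)

lemma mat_mult_entry:
  assumes "M \<in> carrier MF" "M' \<in> carrier MF" "i < n" "j < n"
  shows "(M \<otimes>\<^bsub>MF\<^esub> M') i j = (\<Sum>l<n. M i l \<star> M' l j)"
proof -
  have "(M \<otimes>\<^bsub>MF\<^esub> M') i j = finsum ff (\<lambda>l. M i l \<star> M' l j) {..<n}"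
    using assms(3,4) by (simp add: mat_ring_def mat_entries_def)
  also have "\<dots> = (\<Sum>l<n. M i l \<star> M' l j)"
    using assms by (intro finsum_ff F_star mat_F) auto
  finally show ?thesis .
qed

lemma mat_mult_closed:
  assumes "M \<in> carrier MF" "M' \<in> carrier MF"
  shows "M \<otimes>\<^bsub>MF\<^esub> M' \<in> carrier MF"
proof -
  have "(M \<otimes>\<^bsub>MF\<^esub> M') i j = 0" if "\<not> (i < n \<and> j < n)" for i j
    using that by (auto simp: mat_ring_def mat_entries_def)
  moreover have "(M \<otimes>\<^bsub>MF\<^esub> M') i j \<in> \<F>" if "i < n" "j < n" for i j
    unfolding mat_mult_entry[OF assms that] using assms that by (intro F_sum F_star mat_F) auto
  ultimately show ?thesis
    by (auto simp: mat_carrier)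
qed

lemma mat_one_entry: "i < n \<Longrightarrow> j < n \<Longrightarrow> \<one>\<^bsub>MF\<^esub> i j = (if i = j then \<epsilon> else 0)"
  by (simp add: mat_ring_def mat_entries_def)

lemma mat_one_closed: "\<one>\<^bsub>MF\<^esub> \<in> carrier MF"
  by (simp add: mat_carrier mat_ring_def mat_entries_def carrier_ff F_one F_zero)

lemma monoid_MF: "monoid MF"
proof (rule monoidI)
  fix L M M' assume M: "L \<in> carrier MF" "M \<in> carrier MF" "M' \<in> carrier MF"
  show "L \<otimes>\<^bsub>MF\<^esub> M \<otimes>\<^bsub>MF\<^esub> M' = L \<otimes>\<^bsub>MF\<^esub> (M \<otimes>\<^bsub>MF\<^esub> M')"
  proof (rule mat_eqI)
    fix i j assume ij: "i < n" "j < n"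
    have "(L \<otimes>\<^bsub>MF\<^esub> M \<otimes>\<^bsub>MF\<^esub> M') i j = (\<Sum>l<n. \<Sum>m<n. L i m \<star> (M m l \<star> M' l j))"
      using M ij by (simp add: mat_mult_entry mat_mult_closed star_sum_left star_assoc)
    also have "\<dots> = (\<Sum>m<n. \<Sum>l<n. L i m \<star> (M m l \<star> M' l j))"
      by (rule sum.swap)
    also have "\<dots> = (L \<otimes>\<^bsub>MF\<^esub> (M \<otimes>\<^bsub>MF\<^esub> M')) i j"
      using M ij by (simp add: mat_mult_entry mat_mult_closed star_sum_right)
    finally show "(L \<otimes>\<^bsub>MF\<^esub> M \<otimes>\<^bsub>MF\<^esub> M') i j = (L \<otimes>\<^bsub>MF\<^esub> (M \<otimes>\<^bsub>MF\<^esub> M')) i j" .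
  qed (use M in \<open>simp_all add: mat_mult_closed\<close>)
next
  fix M assume M: "M \<in> carrier MF"
  have F_eps: "M i j \<star> \<epsilon> = M i j" "\<epsilon> \<star> M i j = M i j" if "i < n" "j < n" for i j
    using F_E[OF mat_F[OF M that]] by (simp_all add: E_eps eps_E)
  show "\<one>\<^bsub>MF\<^esub> \<otimes>\<^bsub>MF\<^esub> M = M"
  proof (rule mat_eqI)
    fix i j assume ij: "i < n" "j < n"
    have "(\<Sum>l<n. \<one>\<^bsub>MF\<^esub> i l \<star> M l j) = (\<Sum>l<n. if i = l then M i j else 0)"
      using ij by (intro sum.cong) (auto simp: mat_one_entry F_eps)
    then show "(\<one>\<^bsub>MF\<^esub> \<otimes>\<^bsub>MF\<^esub> M) i j = M i j"
      using M ij by (simp add: mat_mult_entry mat_one_closed)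
  qed (use M in \<open>simp_all add: mat_mult_closed mat_one_closed\<close>)
  show "M \<otimes>\<^bsub>MF\<^esub> \<one>\<^bsub>MF\<^esub> = M"
  proof (rule mat_eqI)
    fix i j assume ij: "i < n" "j < n"
    have "(\<Sum>l<n. M i l \<star> \<one>\<^bsub>MF\<^esub> l j) = (\<Sum>l<n. if l = j then M i j else 0)"
      using ij by (intro sum.cong) (auto simp: mat_one_entry F_eps)
    then show "(M \<otimes>\<^bsub>MF\<^esub> \<one>\<^bsub>MF\<^esub>) i j = M i j"
      using M ij by (simp add: mat_mult_entry mat_one_closed)
  qed (use M in \<open>simp_all add: mat_mult_closed mat_one_closed\<close>)
qed (simp_all add: mat_mult_closed mat_one_closed)

definition scalar_mat :: "(nat \<Rightarrow> nat \<Rightarrow> rat) \<Rightarrow> nat \<Rightarrow> nat \<Rightarrow> 'a \<Rightarrow> rat" where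
  "scalar_mat a = mat_entries ff n (\<lambda>i j. a i j *\<^sub>Q \<epsilon>)"

lemma scalar_mat_entry: "i < n \<Longrightarrow> j < n \<Longrightarrow> scalar_mat a i j = a i j *\<^sub>Q \<epsilon>"
  by (simp add: scalar_mat_def mat_entries_def)

lemma scalar_mat_closed: "scalar_mat a \<in> carrier MF"
  unfolding scalar_mat_def by (intro mat_entries_carrier F_scale F_one)

lemma scalar_mat_mult_one:
  assumes "\<And>i j. i < n \<Longrightarrow> j < n \<Longrightarrow> (\<Sum>l<n. a i l * b l j) = (if i = j then 1 else 0)"
  shows "scalar_mat a \<otimes>\<^bsub>MF\<^esub> scalar_mat b = \<one>\<^bsub>MF\<^esub>"
proof (rule mat_eqI)
  fix i j assume ij: "i < n" "j < n"
  have "(scalar_mat a \<otimes>\<^bsub>MF\<^esub> scalar_mat b) i j = (\<Sum>l<n. (a i l * b l j) *\<^sub>Q \<epsilon>)"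
    using ij by (simp add: mat_mult_entry scalar_mat_closed scalar_mat_entry star_scale_left
        star_scale_right eps_idem mult.commute)
  also have "\<dots> = (\<Sum>l<n. a i l * b l j) *\<^sub>Q \<epsilon>"
    by (rule rat_fun.scale_sum_left[symmetric])
  finally show "(scalar_mat a \<otimes>\<^bsub>MF\<^esub> scalar_mat b) i j = \<one>\<^bsub>MF\<^esub> i j"
    using ij by (simp add: assms mat_one_entry)
qed (simp_all add: mat_mult_closed scalar_mat_closed mat_one_closed)

definition p_entry :: "nat \<Rightarrow> nat \<Rightarrow> rat" where
  "p_entry i j = (if i = 0 \<or> j = 0 then 1 else if i = j then - 1 else 0)"

text \<open>The inverse of \<open>P\<close>: the sum of the columns of \<open>P\<close> is \<open>n\<close>
  times the first unit vector, and the difference of the first unit vector and any other one is a column of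
  \<open>P\<close>.\<close>

definition p_inv_entry :: "nat \<Rightarrow> nat \<Rightarrow> rat" where
  "p_inv_entry i j = 1 / of_nat n - (if i = j \<and> j \<noteq> 0 then 1 else 0)"

lemma minus_one_ff: "\<ominus>\<^bsub>ff\<^esub> \<one>\<^bsub>ff\<^esub> = (- 1) *\<^sub>Q \<epsilon>"
proof -
  interpret ff: ring ff by (rule ring_ff)
  have "(- 1) *\<^sub>Q \<epsilon> + \<epsilon> = 0"
    by simp
  then show ?thesis
    using ff.minus_equality[of "(- 1) *\<^sub>Q \<epsilon>" \<epsilon>] F_scale[OF F_one, of "- 1"] F_one by (simp add: carrier_ff)
qed

lemma mat_P_eq: "mat_P ff n = scalar_mat p_entry"
  using minus_one_ff by (auto simp: mat_P_def scalar_mat_def p_entry_def mat_entries_def fun_eq_iff)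

lemma sum_p_entry: "j < n \<Longrightarrow> (\<Sum>l<n. f l * p_entry l j) = (if j = 0 then (\<Sum>l<n. f l) else f 0 - f j)"
  for f :: "nat \<Rightarrow> rat"
proof -
  assume j: "j < n"
  show ?thesis
  proof (cases "j = 0")
    case False
    have "(\<Sum>l<n. f l * p_entry l j) = (\<Sum>l<n. (if l = 0 then f l else 0) - (if l = j then f l else 0))"
      using False by (intro sum.cong) (auto simp: p_entry_def)
    then show ?thesis
      using j False n_pos by (simp add: sum_subtractf)
  qed (simp add: p_entry_def)
qed

lemma p_entry_sym: "p_entry i j = p_entry j i"
  by (simp add: p_entry_def)

lemma p_inv_mult_p:
  assumes "i < n" "j < n"
  shows "(\<Sum>l<n. p_inv_entry i l * p_entry l j) = (if i = j then 1 else 0)"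
proof (cases "j = 0")
  case True
  have "(\<Sum>l<n. p_inv_entry i l) = (\<Sum>l<n. 1 / of_nat n) - (\<Sum>l<n. if l = i then (if i \<noteq> 0 then 1 else 0) else 0)"
    unfolding p_inv_entry_def sum_subtractf by (intro arg_cong2[where f = "(-)"] sum.cong) auto
  also have "\<dots> = (if i = 0 then 1 else 0)"
    using n_pos assms(1) by simp
  finally show ?thesis
    using True assms by (simp add: sum_p_entry)
next
  case False
  have "(\<Sum>l<n. p_inv_entry i l * p_entry l j) = p_inv_entry i 0 - p_inv_entry i j"
    using assms False by (simp add: sum_p_entry)
  then show ?thesis
    using False by (simp add: p_inv_entry_def)
qed

lemma p_mult_p_inv:
  assumes "i < n" "j < n"
  shows "(\<Sum>l<n. p_entry i l * p_inv_entry l j) = (if i = j then 1 else 0)"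
proof -
  have "p_inv_entry l j = p_inv_entry j l" for l
    by (auto simp: p_inv_entry_def)
  then have "(\<Sum>l<n. p_entry i l * p_inv_entry l j) = (\<Sum>l<n. p_inv_entry j l * p_entry l i)"
    by (intro sum.cong) (simp_all add: p_entry_sym[of i] mult.commute)
  then show ?thesis
    using p_inv_mult_p[OF assms(2,1)] by auto
qed

lemma mat_P_unit: "mat_P ff n \<in> Units MF"
proof -
  have "scalar_mat p_inv_entry \<otimes>\<^bsub>MF\<^esub> scalar_mat p_entry = \<one>\<^bsub>MF\<^esub>"
    by (rule scalar_mat_mult_one) (rule p_inv_mult_p)
  moreover have "scalar_mat p_entry \<otimes>\<^bsub>MF\<^esub> scalar_mat p_inv_entry = \<one>\<^bsub>MF\<^esub>"
    by (rule scalar_mat_mult_one) (rule p_mult_p_inv)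
  ultimately show ?thesis
    unfolding mat_P_eq Units_def using scalar_mat_closed by auto
qed

lemma mat_A_closed: "mat_A ff n \<in> carrier MF"
  unfolding mat_A_def by (intro mat_entries_carrier) (simp add: F_one F_zero)

lemma mat_A_entry:
  assumes "i < n" "j < n"
  shows "mat_A ff n i j = (if i = (j + 1) mod n then \<epsilon> else 0)"
proof (cases "j + 1 = n")
  case True
  then show ?thesis
    using assms by (auto simp: mat_A_def mat_entries_def)
next
  case False
  then have "j + 1 < n" using assms by simp
  then show ?thesis
    using assms by (auto simp: mat_A_def mat_entries_def)
qed

end

section \<open>The isomorphism with the matrix ring\<close>

context normal_basis_pair
begin

text \<open>An element represents a matrix when it acts by this matrix on the copy of the normal basis
  inside the left ideal generated by \<open>\<theta>\<close>.\<close>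

definition column :: "(nat \<Rightarrow> nat \<Rightarrow> 'a \<Rightarrow> rat) \<Rightarrow> nat \<Rightarrow> 'a \<Rightarrow> rat" where
  "column M j = (\<Sum>i<n. M i j \<star> (bs ! i))"

definition represents :: "('a \<Rightarrow> rat) \<Rightarrow> (nat \<Rightarrow> nat \<Rightarrow> 'a \<Rightarrow> rat) \<Rightarrow> bool" where
  "represents \<alpha> M \<longleftrightarrow> (\<forall>j<n. \<alpha> \<star> (bs ! j \<star> \<theta>) = column M j \<star> \<theta>)"

lemma column_E:
  assumes "M \<in> carrier MF" "j < n"
  shows "column M j \<in> \<E>"
  unfolding column_def using assms by (intro E_sum E_star F_E mat_F basis_E) auto

lemma represented_unique:
  assumes M: "M \<in> carrier MF" "M' \<in> carrier MF" and "represents \<alpha> M" "represents \<alpha> M'"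
  shows "M = M'"
proof (rule mat_eqI[OF M])
  fix i j assume ij: "i < n" "j < n"
  have 1: "\<alpha> \<star> (bs ! j \<star> \<theta>) = column M j \<star> \<theta>"
    using assms(3) ij(2) unfolding represents_def by simp
  have 2: "\<alpha> \<star> (bs ! j \<star> \<theta>) = column M' j \<star> \<theta>"
    using assms(4) ij(2) unfolding represents_def by simp
  have "column M j = column M' j"
    by (rule E_theta_inj[OF column_E[OF M(1) ij(2)] column_E[OF M(2) ij(2)] trans[OF 1[symmetric] 2]])
  then show "M i j = M' i j"
    using basis_unique[of "\<lambda>i. M i j" "\<lambda>i. M' i j" i] mat_F[OF M(1)] mat_F[OF M(2)] ij
    by (simp add: column_def)
qed

lemma coset_elem_eq:
  assumes t: "t \<in> T1"
  shows "coset_elem G H K (\<phi> (H #> t)) = \<delta> t \<star> \<epsilon>"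
proof -
  define s where "s = (SOME s. s \<in> K #> t)"
  have "s \<in> K #> t"
    unfolding s_def using rcos_self[OF _ subgroup_K, of t] t by (intro someI) auto
  then obtain h where "h \<in> K" "s = h \<otimes> t"
    by (auto simp: r_coset_def)
  then have "s \<in> N" "s \<otimes> inv t \<in> K"
    using t by (auto simp: N_closed m_assoc)
  then have "\<delta> s \<star> \<epsilon> = \<delta> t \<star> \<epsilon>"
    using t by (intro delta_eps_cong) auto
  then show ?thesis
    unfolding coset_elem_def phi_T1[OF t, symmetric] s_def .
qed

lemma coset_aut_eq:
  assumes t: "t \<in> T1" and v: "v \<in> \<E>"
  shows "coset_aut G (H #> t) v = conj_by G t v"
proof -
  define s where "s = (SOME s. s \<in> H #> t)"
  have "s \<in> H #> t"
    unfolding s_def using rcos_self[OF _ subgroup_H, of t] t by (intro someI) auto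
  then obtain h where "h \<in> H" "s = h \<otimes> t"
    by (auto simp: r_coset_def)
  then have "s \<in> N" "s \<otimes> inv t \<in> H"
    using t by (auto simp: N_closed m_assoc)
  then show ?thesis
    unfolding coset_aut_def s_def[symmetric] using t by (intro conj_E_cong[OF v]) auto
qed

abbreviation "NH \<equiv> carrier (norm_group G K Mod H)"

lemma sum_cosets:
  "finsum (group_algebra G) f NH = (\<Sum>t\<in>T1. f (H #> t))"
  if "\<And>C. C \<in> NH \<Longrightarrow> f C \<in> supp (carrier G)"
  using that by (simp add: finsum_group_algebra sum.reindex_bij_betw[OF T1_cosets_bij])

text \<open>The condition that defines \<open>\<psi>(\<alpha>) = M\<close>.\<close>

definition expanded_action :: "('a \<Rightarrow> rat) \<Rightarrow> (nat \<Rightarrow> nat \<Rightarrow> 'a \<Rightarrow> rat) \<Rightarrow> bool" where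
  "expanded_action \<alpha> M \<longleftrightarrow> (\<exists>\<xi> \<in> NH \<rightarrow> \<E>.
      \<alpha> = finsum (group_algebra G) (\<lambda>C. \<xi> C \<star> coset_elem G H K (\<phi> C)) NH \<and>
      (\<forall>j<n. finsum (group_algebra G) (\<lambda>C. \<xi> C \<star> coset_aut G C (bs ! j)) NH =
             finsum (group_algebra G) (\<lambda>i. M i j \<star> (bs ! i)) {..<n}))"

text \<open>The operator \<open>v \<mapsto> \<Sum>\<^sub>C \<xi>\<^sub>C \<sigma>\<^sub>C(v)\<close> attached to
  an expansion of \<open>\<alpha>\<close> is left multiplication by \<open>\<alpha>\<close> on the elements
  \<open>v\<theta>\<close>. As \<open>v\<theta>\<close> determines \<open>v\<close>, the choice of the expansion
  does not matter.\<close>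

lemma expanded_action_iff:
  assumes \<alpha>: "\<alpha> \<in> \<A>" and M: "M \<in> carrier MF"
  shows "expanded_action \<alpha> M \<longleftrightarrow> represents \<alpha> M"
    (is "?lhs \<longleftrightarrow> _")
proof -
  have T1_NH: "H #> t \<in> NH" if "t \<in> T1" for t
    using T1_cosets_bij that by (auto simp: bij_betw_def)
  have sum1: "finsum (group_algebra G) (\<lambda>C. \<xi> C \<star> coset_elem G H K (\<phi> C)) NH =
      (\<Sum>t\<in>T1. \<xi> (H #> t) \<star> (\<delta> t \<star> \<epsilon>))" for \<xi>
    by (subst sum_cosets) (simp_all add: coset_elem_eq)
  have sum2: "finsum (group_algebra G) (\<lambda>C. \<xi> C \<star> coset_aut G C (bs ! j)) NH =
      (\<Sum>t\<in>T1. \<xi> (H #> t) \<star> conj_by G t (bs ! j))" if "j < n" for \<xi> j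
    using that by (subst sum_cosets) (simp_all add: coset_aut_eq basis_E)
  have sum3: "finsum (group_algebra G) (\<lambda>i. M i j \<star> (bs ! i)) {..<n} = column M j" for j
    unfolding column_def by (rule finsum_group_algebra) simp
  show ?thesis
  proof
    assume ?lhs
    then obtain \<xi> where \<xi>: "\<xi> \<in> NH \<rightarrow> \<E>"
      and 1: "\<alpha> = (\<Sum>t\<in>T1. \<xi> (H #> t) \<star> (\<delta> t \<star> \<epsilon>))"
      and 2: "\<And>j. j < n \<Longrightarrow> (\<Sum>t\<in>T1. \<xi> (H #> t) \<star> conj_by G t (bs ! j)) = column M j"
      unfolding expanded_action_def sum1 sum3 using sum2 by auto
    have "\<xi> (H #> t) \<in> \<E>" if "t \<in> T1" for t
      using \<xi> T1_NH[OF that] by auto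
    then show "represents \<alpha> M"
      unfolding represents_def 1 using 2 by (simp add: expansion_action basis_E)
  next
    assume rep: "represents \<alpha> M"
    obtain \<eta> where \<eta>: "\<And>t. t \<in> T1 \<Longrightarrow> \<eta> t \<in> \<E>" "\<alpha> = (\<Sum>t\<in>T1. \<eta> t \<star> (\<delta> t \<star> \<epsilon>))"
      using A_expand[OF \<alpha>] by blast
    define \<xi> where "\<xi> C = \<eta> (the_inv_into T1 (\<lambda>t. H #> t) C)" for C
    have inj: "inj_on (\<lambda>t. H #> t) T1" and img: "(\<lambda>t. H #> t) ` T1 = NH"
      using T1_cosets_bij by (auto simp: bij_betw_def)
    have \<xi>_T1: "\<xi> (H #> t) = \<eta> t" if "t \<in> T1" for t
      unfolding \<xi>_def using the_inv_into_f_f[OF inj that] by simp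
    have "\<xi> C \<in> \<E>" if "C \<in> NH" for C
      using that \<xi>_T1 \<eta>(1) unfolding img[symmetric] by auto
    moreover have "\<alpha> = (\<Sum>t\<in>T1. \<xi> (H #> t) \<star> (\<delta> t \<star> \<epsilon>))"
      unfolding \<eta>(2) by (intro sum.cong) (simp_all add: \<xi>_T1)
    moreover have "(\<Sum>t\<in>T1. \<xi> (H #> t) \<star> conj_by G t (bs ! j)) = column M j" if j: "j < n" for j
    proof (rule E_theta_inj)
      show "(\<Sum>t\<in>T1. \<xi> (H #> t) \<star> conj_by G t (bs ! j)) \<in> \<E>"
        using \<eta>(1) conj_E[OF basis_E[OF j]] by (intro E_sum E_star) (auto simp: \<xi>_T1)
      show "column M j \<in> \<E>"
        by (rule column_E[OF M j])
      have "(\<Sum>t\<in>T1. \<xi> (H #> t) \<star> conj_by G t (bs ! j)) = (\<Sum>t\<in>T1. \<eta> t \<star> conj_by G t (bs ! j))"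
        by (intro sum.cong) (simp_all add: \<xi>_T1)
      then show "(\<Sum>t\<in>T1. \<xi> (H #> t) \<star> conj_by G t (bs ! j)) \<star> \<theta> = column M j \<star> \<theta>"
        using rep j expansion_action[of \<eta>, OF \<eta>(1) basis_E[OF j]] by (simp add: represents_def \<eta>(2))
    qed
    ultimately show ?lhs
      unfolding expanded_action_def sum1 sum3 using sum2 by (intro bexI[of _ \<xi>]) auto
  qed
qed

definition coord :: "('a \<Rightarrow> rat) \<Rightarrow> nat \<Rightarrow> 'a \<Rightarrow> rat" where
  "coord v = (SOME c. (\<forall>i. c i \<in> \<F>) \<and> v = (\<Sum>i<n. c i \<star> (bs ! i)))"

lemma coord:
  assumes "v \<in> \<E>"
  shows "coord v i \<in> \<F>" "(\<Sum>i<n. coord v i \<star> (bs ! i)) = v"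
  using someI_ex[OF basis_exists[OF assms]] unfolding coord_def by auto

lemma represented_exists:
  assumes \<alpha>: "\<alpha> \<in> \<A>"
  shows "\<exists>M\<in>carrier MF. represents \<alpha> M"
proof -
  obtain \<eta> where \<eta>: "\<And>t. t \<in> T1 \<Longrightarrow> \<eta> t \<in> \<E>" "\<alpha> = (\<Sum>t\<in>T1. \<eta> t \<star> (\<delta> t \<star> \<epsilon>))"
    using A_expand[OF \<alpha>] by blast
  define v where "v j = (\<Sum>t\<in>T1. \<eta> t \<star> conj_by G t (bs ! j))" for j
  have v: "v j \<in> \<E>" if "j < n" for j
    unfolding v_def using \<eta>(1) conj_E[OF basis_E[OF that]] by (intro E_sum E_star) auto
  let ?M = "mat_entries ff n (\<lambda>i j. coord (v j) i)"
  have "column ?M j = v j" if "j < n" for j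
    using coord(2)[OF v[OF that]] that by (simp add: column_def mat_entries_def)
  then have "represents \<alpha> ?M"
    unfolding represents_def \<eta>(2) using expansion_action[of \<eta>, OF \<eta>(1) basis_E]
    by (simp add: v_def)
  moreover have "?M \<in> carrier MF"
    using coord(1)[OF v] by (intro mat_entries_carrier) auto
  ultimately show ?thesis by blast
qed

lemma psi_expanded: "psi G H K \<phi> bs \<alpha> = (THE M. M \<in> carrier MF \<and> expanded_action \<alpha> M)"
  unfolding psi_def Let_def degree_eq expanded_action_def carrier_cf by (rule refl)

lemma psi_eq_iff:
  assumes \<alpha>: "\<alpha> \<in> \<A>" and M: "M \<in> carrier MF"
  shows "psi G H K \<phi> bs \<alpha> = M \<longleftrightarrow> represents \<alpha> M"
proof -
  obtain M' where M': "M' \<in> carrier MF" "represents \<alpha> M'"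
    using represented_exists[OF \<alpha>] by (rule bexE)
  have "psi G H K \<phi> bs \<alpha> = M'"
    unfolding psi_expanded
  proof (rule the_equality)
    show "M' \<in> carrier MF \<and> expanded_action \<alpha> M'"
      using M' expanded_action_iff[OF \<alpha> M'(1)] by simp
    fix L assume "L \<in> carrier MF \<and> expanded_action \<alpha> L"
    then have "L \<in> carrier MF" "represents \<alpha> L"
      using expanded_action_iff[OF \<alpha>, of L] by simp_all
    then show "L = M'"
      by (rule represented_unique[OF _ M'(1) _ M'(2)])
  qed
  moreover have "M' = M \<longleftrightarrow> represents \<alpha> M"
    using M' represented_unique[OF M'(1) M M'(2)] by (intro iffI) simp_all
  ultimately show ?thesis by simp
qed

lemma coord_eqI:
  assumes "v \<in> \<E>" "\<And>i. i < n \<Longrightarrow> c i \<in> \<F>" "v = (\<Sum>i<n. c i \<star> (bs ! i))" "i < n"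
  shows "coord v i = c i"
  by (rule basis_unique[OF coord(1)[OF assms(1)] assms(2) trans[OF coord(2)[OF assms(1)] assms(3)] assms(4)])

lemma represents_surj:
  assumes M: "M \<in> carrier MF"
  shows "\<exists>\<alpha>\<in>\<A>. represents \<alpha> M"
proof -
  define f where "f v = (\<Sum>j<n. coord v j \<star> column M j)" for v
  have "\<exists>\<alpha>\<in>\<A>. \<forall>v\<in>\<E>. \<alpha> \<star> (v \<star> \<theta>) = f v \<star> \<theta>"
  proof (rule realize_linear)
    show "f v \<in> \<E>" if "v \<in> \<E>" for v
      unfolding f_def by (intro E_sum E_star[OF F_E[OF coord(1)[OF that]] column_E[OF M]]) simp
    show "f (v + u) = f v + f u" if v: "v \<in> \<E>" "u \<in> \<E>" for v u
    proof -
      have "coord (v + u) j = coord v j + coord u j" if "j < n" for j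
        using v that coord by (intro coord_eqI) (simp_all add: E_add F_add star_add_left sum.distrib)
      then show ?thesis
        by (simp add: f_def star_add_left sum.distrib)
    qed
    show "f (a \<star> v) = a \<star> f v" if a: "a \<in> \<F>" "v \<in> \<E>" for a v
    proof -
      have "coord (a \<star> v) j = a \<star> coord v j" if "j < n" for j
      proof (rule coord_eqI[OF _ _ _ that])
        have "(\<Sum>i<n. a \<star> coord v i \<star> (bs ! i)) = a \<star> (\<Sum>i<n. coord v i \<star> (bs ! i))"
          by (simp add: star_sum_right star_assoc)
        then show "a \<star> v = (\<Sum>i<n. a \<star> coord v i \<star> (bs ! i))"
          using coord(2)[OF a(2)] by simp
      qed (use a coord in \<open>auto simp: E_star F_E F_star\<close>)
      then show ?thesis
        by (simp add: f_def star_sum_right star_assoc)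
    qed
  qed
  then obtain \<alpha> where \<alpha>: "\<alpha> \<in> \<A>" "\<And>v. v \<in> \<E> \<Longrightarrow> \<alpha> \<star> (v \<star> \<theta>) = f v \<star> \<theta>"
    by blast
  have "f (bs ! j) = column M j" if j: "j < n" for j
  proof -
    have "coord (bs ! j) i = (if i = j then \<epsilon> else 0)" if i: "i < n" for i
    proof (rule coord_eqI[OF basis_E[OF j] _ _ i])
      have "(\<Sum>i<n. (if i = j then \<epsilon> else 0) \<star> (bs ! i)) = (\<Sum>i<n. if i = j then bs ! i else 0)"
        by (intro sum.cong) (auto simp: eps_E basis_E)
      then show "bs ! j = (\<Sum>i<n. (if i = j then \<epsilon> else 0) \<star> (bs ! i))"
        using j by simp
    qed (simp add: F_one F_zero)
    then have "f (bs ! j) = (\<Sum>i<n. if i = j then column M i else 0)"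
      unfolding f_def by (intro sum.cong) (auto simp: eps_E column_E[OF M])
    then show ?thesis
      using j by simp
  qed
  then show ?thesis
    using \<alpha> by (intro bexI[of _ \<alpha>]) (auto simp: represents_def basis_E)
qed

lemma represents_mult:
  assumes \<alpha>: "\<alpha> \<in> \<A>" "represents \<alpha> M" and M: "M \<in> carrier MF" "M' \<in> carrier MF" and j: "j < n"
  shows "\<alpha> \<star> (column M' j \<star> \<theta>) = column (M \<otimes>\<^bsub>MF\<^esub> M') j \<star> \<theta>"
proof -
  have "\<alpha> \<star> (M' i j \<star> (bs ! i) \<star> \<theta>) = (\<Sum>l<n. M l i \<star> M' i j \<star> (bs ! l)) \<star> \<theta>" if i: "i < n" for i
  proof -
    have a: "M' i j \<in> \<F>" by (rule mat_F[OF M(2) i j])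
    have "\<alpha> \<star> (M' i j \<star> (bs ! i) \<star> \<theta>) = M' i j \<star> (\<alpha> \<star> (bs ! i \<star> \<theta>))"
      using F_commute_A[OF a \<alpha>(1)] by (simp add: star_assoc[symmetric])
    also have "\<dots> = M' i j \<star> column M i \<star> \<theta>"
      using \<alpha>(2) i by (simp add: represents_def star_assoc)
    also have "M' i j \<star> column M i = (\<Sum>l<n. M l i \<star> M' i j \<star> (bs ! l))"
      unfolding column_def star_sum_right
    proof (intro sum.cong refl)
      fix l assume "l \<in> {..<n}"
      then have "M' i j \<star> M l i = M l i \<star> M' i j"
        using i by (intro E_commute F_E a mat_F[OF M(1)]) auto
      then show "M' i j \<star> (M l i \<star> (bs ! l)) = M l i \<star> M' i j \<star> (bs ! l)"
        by (simp add: star_assoc[symmetric])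
    qed
    finally show ?thesis .
  qed
  then have "\<alpha> \<star> (column M' j \<star> \<theta>) = (\<Sum>i<n. \<Sum>l<n. M l i \<star> M' i j \<star> (bs ! l)) \<star> \<theta>"
    by (simp add: column_def star_sum_left star_sum_right)
  also have "(\<Sum>i<n. \<Sum>l<n. M l i \<star> M' i j \<star> (bs ! l)) = column (M \<otimes>\<^bsub>MF\<^esub> M') j"
    unfolding column_def using M j by (subst sum.swap) (simp add: mat_mult_entry star_sum_left)
  finally show ?thesis .
qed

end

section \<open>Powers of \<open>x\<^sub>e\<close>\<close>

lemma mod_diff_eq_0_iff:
  fixes j r m :: nat
  assumes "j < m" "r < m"
  shows "(j + (m - r)) mod m = 0 \<longleftrightarrow> r = j"
proof (cases "r \<le> j")
  case True
  then have "j + (m - r) = m + (j - r)"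
    using assms by simp
  then have "(j + (m - r)) mod m = j - r"
    using assms by (simp only: mod_add_self1) simp
  then show ?thesis
    using True by auto
next
  case False
  then have "(j + (m - r)) mod m = j + (m - r)"
    using assms by (intro mod_less) simp
  then show ?thesis
    using False assms by simp
qed

context normal_basis_pair
begin

abbreviation "xe \<equiv> x_elem G H K \<phi> bs"
abbreviation "u j \<equiv> column (mat_P ff n) j"

lemma mat_P_closed: "mat_P ff n \<in> carrier MF"
  unfolding mat_P_eq by (rule scalar_mat_closed)

lemma xe_represents:
  shows xe_A: "xe \<in> \<A>"
    and "represents xe (mat_P ff n \<otimes>\<^bsub>MF\<^esub> mat_A ff n \<otimes>\<^bsub>MF\<^esub> inv\<^bsub>MF\<^esub> mat_P ff n)"
proof -
  interpret MF: monoid MF by (rule monoid_MF)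
  let ?M = "mat_P ff n \<otimes>\<^bsub>MF\<^esub> mat_A ff n \<otimes>\<^bsub>MF\<^esub> inv\<^bsub>MF\<^esub> mat_P ff n"
  have M: "?M \<in> carrier MF"
    by (intro mat_mult_closed mat_P_closed mat_A_closed MF.Units_inv_closed mat_P_unit)
  obtain \<alpha> where \<alpha>: "\<alpha> \<in> \<A>" "represents \<alpha> ?M"
    using represents_surj[OF M] by (rule bexE)
  then have "psi G H K \<phi> bs \<alpha> = ?M"
    using psi_eq_iff[OF \<alpha>(1) M] by simp
  then have img: "?M \<in> psi G H K \<phi> bs ` \<A>"
    using \<alpha>(1) by (intro image_eqI[of _ _ \<alpha>]) simp_all
  have xe: "xe = inv_into \<A> (psi G H K \<phi> bs) ?M"
    by (simp only: x_elem_def Let_def degree_eq carrier_na)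
  show "xe \<in> \<A>"
    unfolding xe by (rule inv_into_into[OF img])
  have "psi G H K \<phi> bs xe = ?M"
    unfolding xe by (rule f_inv_into_f[OF img])
  then show "represents xe ?M"
    using psi_eq_iff[OF \<open>xe \<in> \<A>\<close> M] by simp
qed

lemma column_P_A:
  assumes j: "j < n"
  shows "column (mat_P ff n \<otimes>\<^bsub>MF\<^esub> mat_A ff n) j = u ((j + 1) mod n)"
proof -
  let ?j = "(j + 1) mod n"
  have j': "?j < n" using n_pos by simp
  have "(mat_P ff n \<otimes>\<^bsub>MF\<^esub> mat_A ff n) i j = mat_P ff n i ?j" if i: "i < n" for i
  proof -
    have "(\<Sum>l<n. mat_P ff n i l \<star> mat_A ff n l j) = (\<Sum>l<n. if l = ?j then mat_P ff n i l else 0)"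
    proof (intro sum.cong refl)
      fix l assume "l \<in> {..<n}"
      then have l: "l < n" by simp
      show "mat_P ff n i l \<star> mat_A ff n l j = (if l = ?j then mat_P ff n i l else 0)"
        by (simp only: mat_A_entry[OF l j] if_distrib[of "\<lambda>z. mat_P ff n i l \<star> z"]
            E_eps[OF F_E[OF mat_F[OF mat_P_closed i l]]] star_zero_right)
    qed
    then show ?thesis
      using i j j' by (simp add: mat_mult_entry mat_P_closed mat_A_closed)
  qed
  then show ?thesis
    unfolding column_def by (intro sum.cong) simp_all
qed

text \<open>Conjugation by \<open>P\<close> turns the cyclic shift of the standard basis into the cyclic shift of the
  columns of \<open>P\<close>.\<close>

lemma xe_shift:
  assumes j: "j < n"
  shows "xe \<star> (u j \<star> \<theta>) = u ((j + 1) mod n) \<star> \<theta>"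
proof -
  interpret MF: monoid MF by (rule monoid_MF)
  have inv: "inv\<^bsub>MF\<^esub> mat_P ff n \<in> carrier MF"
    by (rule MF.Units_inv_closed[OF mat_P_unit])
  have PA: "mat_P ff n \<otimes>\<^bsub>MF\<^esub> mat_A ff n \<in> carrier MF"
    by (rule mat_mult_closed[OF mat_P_closed mat_A_closed])
  have "mat_P ff n \<otimes>\<^bsub>MF\<^esub> mat_A ff n \<otimes>\<^bsub>MF\<^esub> inv\<^bsub>MF\<^esub> mat_P ff n \<otimes>\<^bsub>MF\<^esub> mat_P ff n =
      mat_P ff n \<otimes>\<^bsub>MF\<^esub> mat_A ff n"
    by (simp only: MF.m_assoc[OF PA inv mat_P_closed] MF.Units_l_inv[OF mat_P_unit] MF.r_one[OF PA])
  then show ?thesis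
    using represents_mult[OF xe_A xe_represents(2) mat_mult_closed[OF PA inv] mat_P_closed j]
    by (simp only: column_P_A[OF j])
qed

lemma u_eq: "j < n \<Longrightarrow> u j = (\<Sum>i<n. p_entry i j *\<^sub>Q (bs ! i))"
  unfolding column_def mat_P_eq
  by (intro sum.cong) (simp_all add: scalar_mat_entry star_scale_left eps_E basis_E)

lemma u_0: "u 0 = (\<Sum>i<n. bs ! i)"
  using n_pos by (simp add: u_eq p_entry_def)

text \<open>All members of the normal basis have the same trace, which is the first column of \<open>P\<close>.
  The entries in every other column of \<open>P\<close> add up to zero.\<close>

lemma theta_u:
  assumes j: "j < n"
  shows "\<theta> \<star> (u j \<star> \<theta>) = (if j = 0 then u 0 \<star> \<theta> else 0)"
proof -
  have "\<theta> \<star> (bs ! i \<star> \<theta>) = (1 / of_nat n) *\<^sub>Q (u 0 \<star> \<theta>)" if "i < n" for i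
    using theta_E_theta[OF basis_E[OF that]] trace_basis[OF that] by (simp only: u_0)
  then have "\<theta> \<star> (u j \<star> \<theta>) = (\<Sum>i<n. (1 / of_nat n * p_entry i j) *\<^sub>Q (u 0 \<star> \<theta>))"
    unfolding u_eq[OF j]
    by (simp add: star_sum_left star_sum_right star_scale_left star_scale_right mult.commute)
  also have "\<dots> = (\<Sum>i<n. 1 / of_nat n * p_entry i j) *\<^sub>Q (u 0 \<star> \<theta>)"
    by (rule rat_fun.scale_sum_left[symmetric])
  also have "(\<Sum>i<n. 1 / of_nat n * p_entry i j) = (if j = 0 then 1 else 0)"
    using sum_p_entry[OF j, of "\<lambda>_. 1 / of_nat n"] n_pos by simp
  finally show ?thesis
    by simp
qed

text \<open>As \<open>P\<close> is invertible, its columns span the coefficient ring, so faithfulness can be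
  tested on them.\<close>

lemma eq_by_action:
  assumes \<alpha>: "\<alpha> \<in> \<A>" "\<beta> \<in> \<A>" and eq: "\<And>j. j < n \<Longrightarrow> \<alpha> \<star> (u j \<star> \<theta>) = \<beta> \<star> (u j \<star> \<theta>)"
  shows "\<alpha> = \<beta>"
proof -
  let ?\<gamma> = "\<alpha> - \<beta>"
  have \<gamma>: "?\<gamma> \<in> \<A>" by (rule A_diff[OF \<alpha>])
  have zero: "?\<gamma> \<star> (u j \<star> \<theta>) = 0" if "j < n" for j
    using eq[OF that] by (simp add: star_diff_left)
  have basis: "bs ! i = (\<Sum>j<n. p_inv_entry j i *\<^sub>Q u j)" if i: "i < n" for i
  proof -
    have "(\<Sum>j<n. p_inv_entry j i *\<^sub>Q u j) = (\<Sum>j<n. \<Sum>l<n. (p_entry l j * p_inv_entry j i) *\<^sub>Q (bs ! l))"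
      by (intro sum.cong) (simp_all add: u_eq rat_fun.scale_sum_right mult.commute)
    also have "\<dots> = (\<Sum>l<n. (\<Sum>j<n. p_entry l j * p_inv_entry j i) *\<^sub>Q (bs ! l))"
      by (subst sum.swap) (simp add: rat_fun.scale_sum_left)
    also have "\<dots> = (\<Sum>l<n. if l = i then bs ! l else 0)"
      using i by (intro sum.cong) (simp_all add: p_mult_p_inv)
    also have "\<dots> = bs ! i"
      using i by simp
    finally show ?thesis by (rule sym)
  qed
  have basis_zero: "?\<gamma> \<star> (bs ! i \<star> \<theta>) = 0" if "i < n" for i
  proof -
    have "?\<gamma> \<star> ((\<Sum>j<n. p_inv_entry j i *\<^sub>Q u j) \<star> \<theta>) = (\<Sum>j<n. p_inv_entry j i *\<^sub>Q (?\<gamma> \<star> (u j \<star> \<theta>)))"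
      by (simp only: star_sum_left star_sum_right star_scale_left star_scale_right)
    then show ?thesis
      unfolding basis[OF that, symmetric] by (simp add: zero)
  qed
  have "?\<gamma> = 0"
  proof (rule faithful[OF A_eps[OF \<gamma>]])
    fix v assume v: "v \<in> \<E>"
    have "?\<gamma> \<star> (coord v i \<star> (bs ! i) \<star> \<theta>) = 0" if "i < n" for i
    proof -
      have "?\<gamma> \<star> (coord v i \<star> (bs ! i) \<star> \<theta>) = coord v i \<star> (?\<gamma> \<star> (bs ! i \<star> \<theta>))"
        using F_commute_A[OF coord(1)[OF v] \<gamma>, of i] by (simp only: star_assoc[symmetric])
      then show ?thesis
        by (simp add: basis_zero[OF that])
    qed
    then have "?\<gamma> \<star> ((\<Sum>i<n. coord v i \<star> (bs ! i)) \<star> \<theta>) = 0"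
      unfolding star_sum_left star_sum_right by (intro sum.neutral) simp
    then show "?\<gamma> \<star> (v \<star> \<theta>) = 0"
      by (simp only: coord(2)[OF v])
  qed
  then show ?thesis by simp
qed

abbreviation xp :: "nat \<Rightarrow> 'a \<Rightarrow> rat" where
  "xp m \<equiv> xe [^]\<^bsub>na\<^esub> m"

lemma monoid_na: "monoid na"
  using ring_na by (rule ring.is_monoid)

lemma xp_A: "xp m \<in> \<A>"
  using monoid.nat_pow_closed[OF monoid_na, of xe m] xe_A by (simp add: carrier_na)

lemma xp_0: "xp 0 = \<epsilon>"
  by simp

lemma xp_add: "xp a \<star> xp b = xp (a + b)"
  using monoid.nat_pow_mult[OF monoid_na, of xe a b] xe_A by (simp add: carrier_na)

lemma xp_shift:
  assumes "j < n"
  shows "xp m \<star> (u j \<star> \<theta>) = u ((j + m) mod n) \<star> \<theta>"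
  using assms
proof (induction m arbitrary: j)
  case 0
  have "\<epsilon> \<star> (u j \<star> \<theta>) = u j \<star> \<theta>"
    using eps_E[OF column_E[OF mat_P_closed 0]] by (simp only: star_assoc[symmetric])
  then show ?case
    using 0 by simp
next
  case (Suc m)
  have "xp (Suc m) \<star> (u j \<star> \<theta>) = xp m \<star> (xe \<star> (u j \<star> \<theta>))"
    by (simp add: star_assoc)
  also have "\<dots> = u (((j + 1) mod n + m) mod n) \<star> \<theta>"
    unfolding xe_shift[OF Suc.prems] using n_pos by (intro Suc.IH) simp
  also have "((j + 1) mod n + m) mod n = (j + Suc m) mod n"
    by (simp add: mod_add_left_eq)
  finally show ?case .
qed

lemma xp_mod: "xp (m mod n) = xp m"
  by (rule eq_by_action[OF xp_A xp_A]) (simp only: xp_shift mod_add_right_eq)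

lemma xp_dvd: "n dvd m \<Longrightarrow> xp m = \<epsilon>"
  using xp_mod[of m] xp_0 by (simp add: dvd_eq_mod_eq_0 del: nat_pow_0)

lemma eps_A_one: "\<epsilon> \<in> \<A>"
  by (rule E_A[OF E_one])

text \<open>Both sides agree on the columns of \<open>P\<close>: \<open>\<theta>\<close> fixes the first one,
  kills the others, and the power of \<open>x\<^sub>e\<close> moves the first one to the column with index
  \<open>m\<close> modulo \<open>n\<close>.\<close>

lemma theta_xp_theta: "\<theta> \<star> (xp m \<star> \<theta>) = (if n dvd m then \<theta> else 0)"
proof -
  have action: "\<theta> \<star> (xp m \<star> \<theta>) \<star> (u j \<star> \<theta>) = (if n dvd m then \<theta> else 0) \<star> (u j \<star> \<theta>)" if j: "j < n" for j
  proof (cases "j = 0")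
    case True
    have "\<theta> \<star> (xp m \<star> \<theta>) \<star> (u 0 \<star> \<theta>) = \<theta> \<star> (xp m \<star> (\<theta> \<star> (u 0 \<star> \<theta>)))"
      by (simp only: star_assoc)
    also have "\<dots> = \<theta> \<star> (u (m mod n) \<star> \<theta>)"
      using theta_u[OF n_pos] xp_shift[OF n_pos, of m] by simp
    also have "\<dots> = (if n dvd m then u 0 \<star> \<theta> else 0)"
      using theta_u[of "m mod n"] n_pos by (simp add: dvd_eq_mod_eq_0)
    finally show ?thesis
      using True theta_u[OF n_pos] by simp
  next
    case False
    have "\<theta> \<star> (xp m \<star> \<theta>) \<star> (u j \<star> \<theta>) = \<theta> \<star> (xp m \<star> (\<theta> \<star> (u j \<star> \<theta>)))"
      by (simp only: star_assoc)
    then show ?thesis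
      using False theta_u[OF j] by simp
  qed
  have left: "\<theta> \<star> (xp m \<star> \<theta>) \<in> \<A>"
    by (intro A_star theta_A xp_A)
  have right: "(if n dvd m then \<theta> else 0) \<in> \<A>"
    by (simp add: theta_A A_zero)
  show ?thesis
    by (rule eq_by_action[OF left right action])
qed

lemma theta_nonzero: "\<theta> \<noteq> 0"
  using average_theta eps_nonzero by auto

text \<open>The summand with index \<open>r\<close> is the projection to the column of \<open>P\<close> with
  index \<open>r\<close>.\<close>

lemma eps_decomposition: "(\<Sum>r<n. xp r \<star> (\<theta> \<star> xp ((n - r) mod n))) = \<epsilon>"
proof (rule eq_by_action)
  show "(\<Sum>r<n. xp r \<star> (\<theta> \<star> xp ((n - r) mod n))) \<in> \<A>"
    by (intro A_sum A_star xp_A theta_A)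
  show "\<epsilon> \<in> \<A>" by (rule eps_A_one)
  fix j assume j: "j < n"
  have "xp r \<star> (\<theta> \<star> xp ((n - r) mod n)) \<star> (u j \<star> \<theta>) = (if r = j then u j \<star> \<theta> else 0)" if r: "r < n" for r
  proof -
    have "xp r \<star> (\<theta> \<star> xp ((n - r) mod n)) \<star> (u j \<star> \<theta>) = xp r \<star> (\<theta> \<star> (u ((j + (n - r)) mod n) \<star> \<theta>))"
      using xp_shift[OF j, of "n - r"] by (simp only: star_assoc xp_mod)
    also have "\<dots> = (if (j + (n - r)) mod n = 0 then xp r \<star> (u 0 \<star> \<theta>) else 0)"
      using theta_u[of "(j + (n - r)) mod n"] n_pos by simp
    also have "(j + (n - r)) mod n = 0 \<longleftrightarrow> r = j"
      by (rule mod_diff_eq_0_iff[OF j r])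
    also have "xp r \<star> (u 0 \<star> \<theta>) = u r \<star> \<theta>"
      using xp_shift[OF n_pos, of r] r by simp
    finally show ?thesis by simp
  qed
  then have "(\<Sum>r<n. xp r \<star> (\<theta> \<star> xp ((n - r) mod n))) \<star> (u j \<star> \<theta>) = (\<Sum>r<n. if r = j then u j \<star> \<theta> else 0)"
    unfolding star_sum_left by (intro sum.cong) simp_all
  then show "(\<Sum>r<n. xp r \<star> (\<theta> \<star> xp ((n - r) mod n))) \<star> (u j \<star> \<theta>) = \<epsilon> \<star> (u j \<star> \<theta>)"
    using j eps_E[OF column_E[OF mat_P_closed j]] by (simp add: star_assoc[symmetric])
qed

lemma xe_int_pow: "xe [^]\<^bsub>na\<^esub> (i::int) = xp (nat (i mod int n))"
proof (cases "i \<ge> 0")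
  case True
  have "xe [^]\<^bsub>na\<^esub> i = xp (nat i)"
    unfolding int_pow_def2 by (rule if_not_P) (use True in simp)
  moreover have "nat (i mod int n) = nat i mod n"
    using nat_mod_distrib[OF True, of "int n"] by simp
  ultimately show ?thesis
    by (simp only: xp_mod)
next
  case False
  interpret na: monoid na by (rule monoid_na)
  define a b where "a = nat (- i)" and "b = nat (i mod int n)"
  have "int (a + b) = - i + i mod int n"
    using False n_pos by (simp add: a_def b_def)
  also have "\<dots> = int n * (- (i div int n))"
    by (simp add: minus_div_mult_eq_mod[symmetric])
  finally have "n dvd a + b"
    by (metis dvd_triv_left int_dvd_int_iff)
  then have "xp a \<star> xp b = \<epsilon>" "xp b \<star> xp a = \<epsilon>"
    unfolding xp_add by (simp_all add: xp_dvd add.commute)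
  then have "xp b = inv\<^bsub>na\<^esub> xp a"
    using xp_A by (intro na.inv_unique') (simp_all add: carrier_na)
  moreover have "xe [^]\<^bsub>na\<^esub> i = inv\<^bsub>na\<^esub> xp a"
    unfolding int_pow_def2 a_def by (rule if_P) (use False in simp)
  ultimately show ?thesis
    by (simp only: b_def)
qed

lemma nat_neg_mod: "nat ((- i) mod int n) = (n - nat (i mod int n)) mod n"
proof (cases "i mod int n = 0")
  case True
  then show ?thesis by (simp add: zmod_zminus1_eq_if)
next
  case False
  have "0 \<le> i mod int n" "i mod int n < int n"
    using n_pos by simp_all
  then show ?thesis
    using False by (simp add: zmod_zminus1_eq_if nat_diff_distrib)
qed

section \<open>The matrix units\<close>

context
  fixes T2 :: "'a set"
  assumes T2: "transversal G (carrier G) N T2"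
begin

lemma T2_carrier: "t \<in> T2 \<Longrightarrow> t \<in> carrier G"
  using T2 by (auto simp: transversal_def)

lemma finite_T2: "finite T2"
  using T2_carrier finite_carrier by (meson finite_subset subsetI)

lemma T2_separated:
  assumes "t \<in> T2" "t' \<in> T2" "inv t \<otimes> t' \<in> N"
  shows "t = t'"
proof -
  have "\<exists>!s. s \<in> T2 \<inter> (t <# N)"
    using T2 T2_carrier[OF assms(1)] by (simp add: transversal_def)
  moreover have "t \<in> t <# N"
    unfolding l_coset_def using T2_carrier[OF assms(1)] N_closed(3) by force
  moreover have "t' = t \<otimes> (inv t \<otimes> t')"
    using T2_carrier[OF assms(1)] T2_carrier[OF assms(2)] by simp
  then have "t' \<in> t <# N"
    unfolding l_coset_def using assms(3) by blast
  ultimately show ?thesis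
    using assms by auto
qed

lemma T2_orthogonal:
  assumes t: "t \<in> T2" "t' \<in> T2"
  shows "\<epsilon> \<star> (\<delta> (inv t) \<star> (\<delta> t' \<star> \<epsilon>)) = (if t = t' then \<epsilon> else 0)"
proof (cases "t = t'")
  case True
  then show ?thesis
    using T2_carrier[OF t(1)] by (simp add: delta_one_star eps_supp eps_idem)
next
  case False
  then have "inv t \<otimes> t' \<notin> N"
    using T2_separated t by blast
  then show ?thesis
    using eps_orthogonal[of "inv t \<otimes> t'"] False T2_carrier[OF t(1)] T2_carrier[OF t(2)] by simp
qed

lemma xp_T2_xp:
  assumes t: "t \<in> T2" "t' \<in> T2"
  shows "xp a \<star> (\<delta> (inv t) \<star> (\<delta> t' \<star> xp b)) = (if t = t' then xp (a + b) else 0)"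
proof -
  have "xp a \<star> (\<delta> (inv t) \<star> (\<delta> t' \<star> xp b)) = (xp a \<star> \<epsilon>) \<star> (\<delta> (inv t) \<star> (\<delta> t' \<star> (\<epsilon> \<star> xp b)))"
    by (simp only: A_eps[OF xp_A] eps_A[OF xp_A])
  also have "\<dots> = xp a \<star> (\<epsilon> \<star> (\<delta> (inv t) \<star> (\<delta> t' \<star> \<epsilon>))) \<star> xp b"
    by (simp only: star_assoc)
  also have "\<dots> = (if t = t' then xp (a + b) else 0)"
    unfolding T2_orthogonal[OF t] by (simp add: A_eps[OF xp_A] xp_add)
  finally show ?thesis .
qed

text \<open>Exponents below \<open>n\<close> and elements of \<open>T\<^sub>2\<close> parametrize the index set
  without repetitions.\<close>

definition elt :: "'a \<Rightarrow> nat \<Rightarrow> 'a \<Rightarrow> rat" where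
  "elt t r = \<delta> t \<star> xp r"

definition elt_inv :: "'a \<Rightarrow> nat \<Rightarrow> 'a \<Rightarrow> rat" where
  "elt_inv t r = xp ((n - r) mod n) \<star> \<delta> (inv t)"

lemma elt_inv_elt:
  assumes "t \<in> T2" "t' \<in> T2"
  shows "elt_inv t r \<star> elt t' r' = (if t = t' then xp ((n - r) mod n + r') else 0)"
  using xp_T2_xp[OF assms] by (simp only: elt_inv_def elt_def star_assoc)

lemma n_dvd_diff:
  assumes "r < n" "r' < n"
  shows "n dvd (n - r) mod n + r' \<longleftrightarrow> r = r'"
proof -
  have "n dvd (n - r) mod n + r' \<longleftrightarrow> (r' + (n - r)) mod n = 0"
    by (simp add: dvd_eq_mod_eq_0 mod_add_right_eq add.commute[of _ r'])
  then show ?thesis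
    unfolding mod_diff_eq_0_iff[OF assms(2,1)] .
qed

lemma elt_inj:
  assumes t: "t \<in> T2" "t' \<in> T2" and r: "r < n" "r' < n" and eq: "elt t r = elt t' r'"
  shows "t = t' \<and> r = r'"
proof -
  have "elt_inv t r \<star> elt t r = \<epsilon>"
    using elt_inv_elt[OF t(1) t(1), of r r] xp_dvd n_dvd_diff[OF r(1) r(1)] by simp
  then have eps: "\<epsilon> = (if t = t' then xp ((n - r) mod n + r') else 0)"
    using elt_inv_elt[OF t, of r r'] eq by simp
  then have "t = t'"
    using eps_nonzero by (metis (full_types))
  moreover have "\<theta> \<star> (\<epsilon> \<star> \<theta>) = \<theta>"
    by (simp add: eps_theta theta_idem)
  ultimately have "n dvd (n - r) mod n + r'"
    using eps theta_xp_theta[of "(n - r) mod n + r'"] theta_nonzero by (metis (full_types))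
  then show ?thesis
    using \<open>t = t'\<close> n_dvd_diff[OF r] by simp
qed

lemma index_set_eq: "index_set G na T2 xe = (\<lambda>(t, r). elt t r) ` (T2 \<times> {..<n})"
proof
  have lt: "nat (i mod int n) < n" for i
    using n_pos by (simp add: nat_less_iff)
  show "index_set G na T2 xe \<subseteq> (\<lambda>(t, r). elt t r) ` (T2 \<times> {..<n})"
    using lt by (auto simp: index_set_def xe_int_pow elt_def intro!: image_eqI[of _ _ "(_, nat (_ mod int n))"])
  show "(\<lambda>(t, r). elt t r) ` (T2 \<times> {..<n}) \<subseteq> index_set G na T2 xe"
  proof
    fix v assume "v \<in> (\<lambda>(t, r). elt t r) ` (T2 \<times> {..<n})"
    then obtain t r where v: "v = elt t r" "t \<in> T2" "r < n" by auto
    then have "v = \<delta> t \<star> (xe [^]\<^bsub>na\<^esub> int r)"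
      by (simp add: xe_int_pow elt_def)
    then show "v \<in> index_set G na T2 xe"
      unfolding index_set_def using v(2) by blast
  qed
qed

lemma index_inv_elt:
  assumes t: "t \<in> T2" and r: "r < n"
  shows "index_inv G na T2 xe (elt t r) = elt_inv t r"
  unfolding index_inv_def
proof (rule the_equality)
  have "elt t r = \<delta> t \<star> (xe [^]\<^bsub>na\<^esub> int r)" "elt_inv t r = (xe [^]\<^bsub>na\<^esub> (- int r)) \<star> \<delta> (inv t)"
    using r nat_neg_mod[of "int r"] by (simp_all add: xe_int_pow elt_def elt_inv_def)
  then show "\<exists>s\<in>T2. \<exists>i::int. elt t r = \<delta> s \<star> (xe [^]\<^bsub>na\<^esub> i) \<and>
      elt_inv t r = (xe [^]\<^bsub>na\<^esub> (- i)) \<star> \<delta> (inv s)"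
    using t by (intro bexI[of _ t] exI[of _ "int r"]) simp_all
next
  fix z assume "\<exists>s\<in>T2. \<exists>i::int. elt t r = \<delta> s \<star> (xe [^]\<^bsub>na\<^esub> i) \<and> z = (xe [^]\<^bsub>na\<^esub> (- i)) \<star> \<delta> (inv s)"
  then obtain s and i :: int where s: "s \<in> T2"
    and eq: "elt t r = \<delta> s \<star> (xe [^]\<^bsub>na\<^esub> i)" and z: "z = (xe [^]\<^bsub>na\<^esub> (- i)) \<star> \<delta> (inv s)"
    by auto
  have "nat (i mod int n) < n"
    using n_pos by (simp add: nat_less_iff)
  moreover have "elt t r = elt s (nat (i mod int n))"
    using eq by (simp add: xe_int_pow elt_def)
  ultimately have "t = s \<and> r = nat (i mod int n)"
    using elt_inj[OF t s r] by simp
  then show "z = elt_inv t r"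
    using z nat_neg_mod[of i] by (simp add: xe_int_pow elt_inv_def)
qed

definition unit :: "'a \<times> nat \<Rightarrow> 'a \<times> nat \<Rightarrow> 'a \<Rightarrow> rat" where
  "unit p q = elt (fst p) (snd p) \<star> \<theta> \<star> elt_inv (fst q) (snd q)"

abbreviation "J \<equiv> T2 \<times> {..<n}"

lemma unit_mult:
  assumes "p \<in> J" "q \<in> J" "p' \<in> J" "q' \<in> J"
  shows "unit p q \<star> unit p' q' = (if q = p' then unit p q' else 0)"
proof -
  obtain t r t' r' where q: "q = (t, r)" "t \<in> T2" "r < n" and p': "p' = (t', r')" "t' \<in> T2" "r' < n"
    using assms by (cases q; cases p') auto
  have "\<theta> \<star> (elt_inv t r \<star> elt t' r' \<star> \<theta>) = (if q = p' then \<theta> else 0)"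
    unfolding elt_inv_elt[OF q(2) p'(2)]
    using theta_xp_theta[of "(n - r) mod n + r'"] n_dvd_diff[OF q(3) p'(3)] q(1) p'(1) by auto
  then have mid: "\<theta> \<star> (elt_inv t r \<star> (elt t' r' \<star> \<theta>)) = (if q = p' then \<theta> else 0)"
    by (simp only: star_assoc)
  have "unit p q \<star> unit p' q' =
      elt (fst p) (snd p) \<star> (\<theta> \<star> (elt_inv t r \<star> (elt t' r' \<star> \<theta>))) \<star> elt_inv (fst q') (snd q')"
    by (simp only: unit_def q(1) p'(1) fst_conv snd_conv star_assoc)
  then show ?thesis
    unfolding mid by (simp add: unit_def)
qed

lemma shoda_e_eq: "shoda_e G H K = (\<Sum>t\<in>T2. \<delta> t \<star> (\<epsilon> \<star> \<delta> (inv t)))"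
proof -
  have conj: "conj_by G t \<epsilon> = \<delta> t \<star> (\<epsilon> \<star> \<delta> (inv t))" for t
    by (simp only: conj_by_eq star_assoc)
  have "inj_on (\<lambda>t. conj_by G t \<epsilon>) T2"
  proof (rule inj_onI)
    fix t t' assume t: "t \<in> T2" "t' \<in> T2" and eq: "conj_by G t \<epsilon> = conj_by G t' \<epsilon>"
    have c: "t \<in> carrier G" "t' \<in> carrier G" using t T2_carrier by auto
    have "conj_by G (inv t \<otimes> t') \<epsilon> = conj_by G (inv t) (conj_by G t \<epsilon>)"
      using c eq by (simp add: conj_by_conj_by)
    also have "\<dots> = \<epsilon>"
      using c by (simp add: conj_by_conj_by conj_by_one eps_supp)
    finally show "t = t'"
      using in_N_if_commutes_eps[of "inv t \<otimes> t'"] c T2_separated[OF t] by simp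
  qed
  moreover have "(\<lambda>t. conj_by G t \<epsilon>) ` T2 = conjugates G \<epsilon>"
  proof
    show "(\<lambda>t. conj_by G t \<epsilon>) ` T2 \<subseteq> conjugates G \<epsilon>"
      using T2_carrier by (auto simp: conjugates_def)
    show "conjugates G \<epsilon> \<subseteq> (\<lambda>t. conj_by G t \<epsilon>) ` T2"
    proof
      fix c assume "c \<in> conjugates G \<epsilon>"
      then obtain g where g: "g \<in> carrier G" "c = conj_by G g \<epsilon>"
        by (auto simp: conjugates_def)
      have "\<exists>!t. t \<in> T2 \<inter> (g <# N)"
        using T2 g(1) by (simp add: transversal_def)
      then obtain t m where t: "t \<in> T2" "m \<in> N" "t = g \<otimes> m"
        by (auto simp: l_coset_def)
      then have "conj_by G t \<epsilon> = conj_by G g (conj_by G m \<epsilon>)"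
        using g by (simp add: conj_by_conj_by)
      then have "c = conj_by G t \<epsilon>"
        by (simp only: conj_by_eps[OF t(2)] g(2))
      then show "c \<in> (\<lambda>t. conj_by G t \<epsilon>) ` T2"
        using t(1) by (rule image_eqI)
    qed
  qed
  ultimately have bij: "bij_betw (\<lambda>t. conj_by G t \<epsilon>) T2 (conjugates G \<epsilon>)"
    by (simp add: bij_betw_def)
  have "shoda_e G H K = (\<Sum>c\<in>conjugates G \<epsilon>. c)"
    unfolding shoda_e_def
    by (rule finsum_group_algebra) (auto simp: conjugates_def conj_by_eq)
  also have "\<dots> = (\<Sum>t\<in>T2. conj_by G t \<epsilon>)"
    by (rule sum.reindex_bij_betw[OF bij, symmetric])
  finally show ?thesis
    unfolding conj .
qed

lemma elt_inv_e:
  assumes t: "t \<in> T2"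
  shows "elt_inv t r \<star> shoda_e G H K = elt_inv t r"
proof -
  have "elt_inv t r \<star> (\<delta> s \<star> (\<epsilon> \<star> \<delta> (inv s))) = (if s = t then elt_inv t r else 0)" if s: "s \<in> T2" for s
  proof -
    have "elt_inv t r \<star> (\<delta> s \<star> (\<epsilon> \<star> \<delta> (inv s))) =
        xp ((n - r) mod n) \<star> (\<epsilon> \<star> (\<delta> (inv t) \<star> (\<delta> s \<star> \<epsilon>))) \<star> \<delta> (inv s)"
      using A_eps[OF xp_A, of "(n - r) mod n"] by (simp only: elt_inv_def star_assoc[symmetric])
    then show ?thesis
      unfolding T2_orthogonal[OF t s] by (auto simp: elt_inv_def A_eps[OF xp_A])
  qed
  then have "elt_inv t r \<star> shoda_e G H K = (\<Sum>s\<in>T2. if s = t then elt_inv t r else 0)"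
    unfolding shoda_e_eq star_sum_right by (intro sum.cong) simp_all
  then show ?thesis
    using t finite_T2 by simp
qed

lemma unit_sum: "(\<Sum>p\<in>J. unit p p) = shoda_e G H K"
proof -
  have "(\<Sum>p\<in>J. unit p p) = (\<Sum>t\<in>T2. \<Sum>r<n. unit (t, r) (t, r))"
    by (simp add: sum.cartesian_product case_prod_beta)
  also have "\<dots> = (\<Sum>t\<in>T2. \<delta> t \<star> (\<Sum>r<n. xp r \<star> (\<theta> \<star> xp ((n - r) mod n))) \<star> \<delta> (inv t))"
    by (simp only: unit_def elt_def elt_inv_def fst_conv snd_conv star_sum_left star_sum_right star_assoc)
  finally show ?thesis
    by (simp only: eps_decomposition shoda_e_eq star_assoc)
qed

text \<open>For \<open>g\<close> outside \<open>N\<close> the product \<open>\<epsilon> g \<epsilon>\<close>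
  vanishes. For \<open>g = h t\<close> in \<open>N\<close> with \<open>t\<close> in \<open>T\<^sub>1\<close> the
  factor \<open>t\<close> is absorbed by \<open>\<theta>\<close>, and \<open>\<theta> h \<theta>\<close> is a
  trace.\<close>

lemma theta_corner:
  assumes \<beta>: "\<beta> \<in> supp (carrier G)"
  shows "\<exists>a\<in>\<F>. \<theta> \<star> (\<beta> \<star> \<theta>) = a \<star> \<theta>"
proof -
  have ex: "\<exists>a\<in>\<F>. \<theta> \<star> (\<delta> g \<star> \<theta>) = a \<star> \<theta>" if g: "g \<in> carrier G" for g
  proof (cases "g \<in> N")
    case False
    have "\<theta> \<star> (\<delta> g \<star> \<theta>) = \<theta> \<star> (\<epsilon> \<star> (\<delta> g \<star> \<epsilon>)) \<star> \<theta>"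
      by (simp only: star_assoc eps_theta) (simp only: star_assoc[symmetric] theta_eps)
    then show ?thesis
      using eps_orthogonal[OF g False] F_zero by (intro bexI[of _ 0]) simp_all
  next
    case True
    define t where "t = rep g"
    define h where "h = g \<otimes> inv t"
    have t: "t \<in> T1" unfolding t_def by (rule rep_in_T1[OF True])
    have "inv (t \<otimes> inv g) \<in> H"
      unfolding t_def by (rule H_closed(2)[OF rep_coset[OF True]])
    then have h: "h \<in> H"
      using t g by (simp add: h_def inv_mult_group)
    have "\<delta> g \<star> \<theta> = \<delta> h \<star> (\<delta> t \<star> \<theta>)"
      using t g by (simp add: h_def m_assoc)
    also have "\<dots> = \<delta> h \<star> \<epsilon> \<star> \<theta>"
      by (simp only: T1_theta[OF t] star_assoc eps_theta)
    finally have "\<theta> \<star> (\<delta> g \<star> \<theta>) = (1 / of_nat n) *\<^sub>Q trace (\<delta> h \<star> \<epsilon>) \<star> \<theta>"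
      using theta_E_theta[OF delta_eps_E[OF h]] by (simp only: star_scale_left)
    then show ?thesis
      using F_scale[OF trace_F[OF delta_eps_E[OF h]]] by blast
  qed
  then obtain a where a: "\<And>g. g \<in> carrier G \<Longrightarrow> a g \<in> \<F> \<and> \<theta> \<star> (\<delta> g \<star> \<theta>) = a g \<star> \<theta>"
    by metis
  have "\<theta> \<star> (\<beta> \<star> \<theta>) = \<theta> \<star> ((\<Sum>g\<in>carrier G. \<beta> g *\<^sub>Q \<delta> g) \<star> \<theta>)"
    using supp_expand[OF finite_carrier \<beta>] by simp
  also have "\<dots> = (\<Sum>g\<in>carrier G. \<beta> g *\<^sub>Q a g) \<star> \<theta>"
    using a by (simp add: star_sum_left star_sum_right star_scale_left star_scale_right)
  finally show ?thesis
    using a by (intro bexI[of _ "\<Sum>g\<in>carrier G. \<beta> g *\<^sub>Q a g"] F_sum F_scale) simp_all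
qed

text \<open>For \<open>x\<close> in the index set, the isomorphism from \<open>F\<close> is \<open>a \<mapsto> x
  a \<theta> x\<inverse>\<close>.\<close>

lemma corner_iso:
  assumes p: "p \<in> J"
  shows "corner_ring (group_algebra G) (unit p p) \<simeq> ff"
proof -
  define x x' f where "x = elt (fst p) (snd p)" and "x' = elt_inv (fst p) (snd p)" and "f = unit p p"
  have f: "f = x \<star> \<theta> \<star> x'"
    by (simp add: f_def x_def x'_def unit_def)
  have x'x: "x' \<star> x = \<epsilon>"
    using p elt_inv_elt[of "fst p" "fst p" "snd p" "snd p"] xp_dvd n_dvd_diff[of "snd p" "snd p"]
    by (auto simp: x_def x'_def)
  have cancel: "v \<star> x' \<star> (x \<star> v') = v \<star> (\<epsilon> \<star> v')" for v v'
    using x'x by (metis star_assoc)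
  define h where "h a = x \<star> (a \<star> \<theta>) \<star> x'" for a
  have comm: "a \<star> \<theta> = \<theta> \<star> a" if "a \<in> \<F>" for a
    using F_commute_A[OF that theta_A] by simp
  have eps_F: "\<epsilon> \<star> (a \<star> v) = a \<star> v" if "a \<in> \<F>" for a v
    using eps_E[OF F_E[OF that]] by (simp add: star_assoc[symmetric])
  have supp_x: "v \<star> x' \<in> supp (carrier G)" for v
    by (rule star_in_carrier)
  let ?C = "corner_ring (group_algebra G) f"
  have carrier_C: "carrier ?C = (\<lambda>\<alpha>. f \<star> \<alpha> \<star> f) ` supp (carrier G)"
    by (simp add: corner_ring_def carrier_group_algebra)
  have ops: "v \<oplus>\<^bsub>?C\<^esub> v' = v + v'" "v \<otimes>\<^bsub>?C\<^esub> v' = v \<star> v'" "\<one>\<^bsub>?C\<^esub> = f" for v v'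
    by (simp_all add: corner_ring_def add_group_algebra)
  have h_corner: "h a = f \<star> h a \<star> f" if a: "a \<in> \<F>" for a
  proof -
    have "f \<star> h a \<star> f = x \<star> (\<theta> \<star> (x' \<star> x) \<star> (a \<star> \<theta>) \<star> (x' \<star> x) \<star> \<theta>) \<star> x'"
      by (simp only: f h_def star_assoc)
    also have "\<theta> \<star> (x' \<star> x) \<star> (a \<star> \<theta>) \<star> (x' \<star> x) \<star> \<theta> = \<theta> \<star> (a \<star> \<theta>)"
      unfolding x'x theta_eps by (simp only: star_assoc theta_eps eps_theta theta_idem)
    also have "\<dots> = a \<star> \<theta>"
      unfolding comm[OF a] by (simp only: star_assoc[symmetric] theta_idem)
    finally show ?thesis
      by (simp only: h_def)
  qed
  have "h \<in> ring_iso ff ?C"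
  proof (rule ring_iso_memI)
    show "h a \<in> carrier ?C" if "a \<in> carrier ff" for a
    proof -
      have "h a = f \<star> h a \<star> f"
        using that by (intro h_corner) (simp only: carrier_ff)
      moreover have "h a \<in> supp (carrier G)"
        unfolding h_def by (rule star_in_carrier)
      ultimately show ?thesis
        unfolding carrier_C by (rule image_eqI)
    qed
    show "h (a \<otimes>\<^bsub>ff\<^esub> b) = h a \<otimes>\<^bsub>?C\<^esub> h b" if "a \<in> carrier ff" "b \<in> carrier ff" for a b
    proof -
      have ab: "a \<in> \<F>" "b \<in> \<F>" using that by (simp_all add: carrier_ff)
      have "h a \<star> h b = x \<star> (a \<star> (\<theta> \<star> (x' \<star> x) \<star> (b \<star> \<theta>))) \<star> x'"
        by (simp only: h_def star_assoc)
      also have "\<theta> \<star> (x' \<star> x) \<star> (b \<star> \<theta>) = b \<star> \<theta>"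
        unfolding x'x theta_eps comm[OF ab(2)] by (simp only: star_assoc[symmetric] theta_idem)
      finally show ?thesis
        by (simp only: h_def ops ff_simps star_assoc)
    qed
    show "h (a \<oplus>\<^bsub>ff\<^esub> b) = h a \<oplus>\<^bsub>?C\<^esub> h b" for a b
      by (simp add: ops h_def star_add_left star_add_right)
    show "h \<one>\<^bsub>ff\<^esub> = \<one>\<^bsub>?C\<^esub>"
      unfolding ops(3) unfolding f by (simp add: h_def eps_theta)
    have "inj_on h \<F>"
    proof (rule inj_onI)
      fix a b assume ab: "a \<in> \<F>" "b \<in> \<F>" and eq: "h a = h b"
      have recover: "x' \<star> h c \<star> x = c \<star> \<theta>" if "c \<in> \<F>" for c
      proof -
        have "x' \<star> h c \<star> x = (x' \<star> x) \<star> (c \<star> \<theta>) \<star> (x' \<star> x)"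
          by (simp only: h_def star_assoc)
        then show ?thesis
          unfolding x'x by (simp only: star_assoc theta_eps eps_F[OF that])
      qed
      then have "a \<star> \<theta> = b \<star> \<theta>"
        using eq ab recover[OF ab(1)] recover[OF ab(2)] by simp
      then show "a = b"
        using E_theta_inj F_E ab by simp
    qed
    moreover have "h ` \<F> = carrier ?C"
    proof
      show "h ` \<F> \<subseteq> carrier ?C"
        using \<open>\<And>a. a \<in> carrier ff \<Longrightarrow> h a \<in> carrier ?C\<close> by (auto simp: carrier_ff)
      show "carrier ?C \<subseteq> h ` \<F>"
      proof
        fix c assume "c \<in> carrier ?C"
        then obtain \<alpha> where c: "c = f \<star> \<alpha> \<star> f"
          unfolding carrier_C by (rule imageE)
        obtain a where a: "a \<in> \<F>" "\<theta> \<star> (x' \<star> \<alpha> \<star> x \<star> \<theta>) = a \<star> \<theta>"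
          using theta_corner[of "x' \<star> \<alpha> \<star> x"] by (rule bexE[OF _]) simp_all
        have "c = x \<star> (\<theta> \<star> (x' \<star> \<alpha> \<star> x \<star> \<theta>)) \<star> x'"
          by (simp only: c f star_assoc)
        then have "c = h a"
          by (simp only: a(2) h_def)
        then show "c \<in> h ` \<F>"
          using a(1) by (rule image_eqI)
      qed
    qed
    ultimately show "bij_betw h (carrier ff) (carrier ?C)"
      by (simp add: bij_betw_def carrier_ff)
  qed
  then have "ff \<simeq> ?C"
    by (auto simp: is_ring_iso_def)
  then show ?thesis
    using ring_iso_sym[OF ring_ff] by (simp add: f_def)
qed

lemma matrix_units:
  fixes E :: "('a \<Rightarrow> rat) \<Rightarrow> ('a \<Rightarrow> rat) \<Rightarrow> ('a \<Rightarrow> rat)"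
  assumes E: "\<And>v v'. E v v' = v \<star> hat T1 \<star> \<epsilon> \<star> index_inv G na T2 xe v'"
  shows "complete_matrix_units (idem_algebra G (carrier G) (shoda_e G H K)) (index_set G na T2 xe) E
    \<and> (\<forall>v \<in> index_set G na T2 xe. corner_ring (group_algebra G) (E v v) \<simeq> ff)"
proof -
  let ?e = "shoda_e G H K" and ?I = "index_set G na T2 xe"
  let ?R = "idem_algebra G (carrier G) ?e" and ?g = "\<lambda>(t, r). elt t r"
  have inj: "inj_on ?g J"
    using elt_inj by (auto intro!: inj_onI)
  have E_unit: "E (?g p) (?g q) = unit p q" if "q \<in> J" for p q
    using that index_inv_elt[of "fst q" "snd q"]
    by (auto simp: E unit_def \<theta>_def star_assoc case_prod_beta)
  have carrier_R: "carrier ?R = (\<lambda>\<alpha>. \<alpha> \<star> ?e) ` supp (carrier G)"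
    by (simp add: idem_algebra_def carrier_group_algebra)
  have unit_R: "unit p q \<in> carrier ?R" if "q \<in> J" for p q
  proof -
    have "unit p q = unit p q \<star> ?e"
      using that elt_inv_e[of "fst q" "snd q"] by (auto simp: unit_def star_assoc)
    moreover have "unit p q \<in> supp (carrier G)"
      by (simp add: unit_def)
    ultimately show ?thesis
      unfolding carrier_R by (rule image_eqI)
  qed
  have "finsum ?R (\<lambda>v. E v v) ?I = (\<Sum>v\<in>?I. E v v)"
  proof (rule finsum_pointwise[where S = "carrier ?R"])
    show "0 \<in> carrier ?R"
      unfolding carrier_R by (rule image_eqI[of _ _ 0]) simp_all
    show "v + v' \<in> carrier ?R" if "v \<in> carrier ?R" "v' \<in> carrier ?R" for v v'
      using that unfolding carrier_R by (auto simp: star_add_left[symmetric])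
    show "E v v \<in> carrier ?R" if "v \<in> ?I" for v
      using that E_unit unit_R unfolding index_set_eq by auto
  qed simp_all
  also have "\<dots> = (\<Sum>p\<in>J. unit p p)"
    unfolding index_set_eq sum.reindex[OF inj] o_def by (intro sum.cong refl E_unit)
  finally have sum: "finsum ?R (\<lambda>v. E v v) ?I = \<one>\<^bsub>?R\<^esub>"
    by (simp add: unit_sum)
  have "complete_matrix_units ?R ?I E"
    unfolding complete_matrix_units_def
  proof (intro conjI ballI)
    fix v1 v2 assume "v1 \<in> ?I" "v2 \<in> ?I"
    then show "E v1 v2 \<in> carrier ?R"
      using E_unit unit_R unfolding index_set_eq by auto
  next
    show "\<one>\<^bsub>?R\<^esub> = finsum ?R (\<lambda>v. E v v) ?I"
      by (rule sum[symmetric])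
  next
    fix v1 v2 v3 v4 assume v: "v1 \<in> ?I" "v2 \<in> ?I" "v3 \<in> ?I" "v4 \<in> ?I"
    then obtain p1 p2 p3 p4 where p: "p1 \<in> J" "v1 = ?g p1" "p2 \<in> J" "v2 = ?g p2" "p3 \<in> J" "v3 = ?g p3"
      "p4 \<in> J" "v4 = ?g p4"
      unfolding index_set_eq by (elim imageE) 
    have "v2 = v3 \<longleftrightarrow> p2 = p3"
      unfolding p using inj_on_eq_iff[OF inj p(3,5)] .
    then show "E v1 v2 \<otimes>\<^bsub>?R\<^esub> E v3 v4 = (if v2 = v3 then E v1 v4 else \<zero>\<^bsub>?R\<^esub>)"
      using unit_mult[OF p(1,3,5,7)] E_unit[OF p(3), of p1] E_unit[OF p(7), of p3] E_unit[OF p(7), of p1]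
      by (simp add: p(2,4,6,8))
  qed
  moreover have "corner_ring (group_algebra G) (E v v) \<simeq> ff" if "v \<in> ?I" for v
    using that E_unit corner_iso unfolding index_set_eq by auto
  ultimately show ?thesis by blast
qed

end

end

theorem corollary4p2:
  fixes G :: "('a, 'b) monoid_scheme" and H K N T1 T2 :: "'a set"
    and y :: 'a and \<zeta> :: complex and \<phi> :: "'a set \<Rightarrow> 'a set"
    and QG :: "('a \<Rightarrow> rat) ring" and \<epsilon> e w xe :: "'a \<Rightarrow> rat" and bs :: "('a \<Rightarrow> rat) list"
    and I :: "('a \<Rightarrow> rat) set" and E :: "('a \<Rightarrow> rat) \<Rightarrow> ('a \<Rightarrow> rat) \<Rightarrow> ('a \<Rightarrow> rat)"
  assumes "group G" and "finite (carrier G)"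
    and "strong_shoda_pair G H K"
    and "N = normalizer G K"
    and "y \<in> H"
    and "subgroup_generated (G\<lparr>carrier := H\<rparr> Mod K) {K #>\<^bsub>G\<^esub> y} = G\<lparr>carrier := H\<rparr> Mod K"
    and "is_primitive_root \<zeta> (card (carrier (G\<lparr>carrier := H\<rparr> Mod K)))"
    and "is_section G H K \<phi>"
    and "\<And>g g'. g \<in> N \<Longrightarrow> g' \<in> N \<Longrightarrow> twisting G H K y \<zeta> \<phi> (H #>\<^bsub>G\<^esub> g) (H #>\<^bsub>G\<^esub> g') = 1"
    and "QG = group_algebra G"
    and "\<epsilon> = shoda_eps G H K" and "e = shoda_e G H K"
    and "normal_element (coeff_field G H K) (carrier (fixed_field G H K)) w"
    and "distinct bs"
    and "set bs = normal_basis (coeff_field G H K) (carrier (fixed_field G H K)) w"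
    and "xe = x_elem G H K \<phi> bs"
    and "transversal G N H T1" and "\<And>t. t \<in> T1 \<Longrightarrow> K #>\<^bsub>G\<^esub> t = \<phi> (H #>\<^bsub>G\<^esub> t)"
    and "transversal G (carrier G) N T2"
    and "I = index_set G (norm_algebra G H K) T2 xe"
    and "\<And>x x'. E x x' = x \<otimes>\<^bsub>QG\<^esub> hat T1 \<otimes>\<^bsub>QG\<^esub> \<epsilon> \<otimes>\<^bsub>QG\<^esub> index_inv G (norm_algebra G H K) T2 xe x'"
  shows "complete_matrix_units (idem_algebra G (carrier G) e) I E
    \<and> (\<forall>x \<in> I. corner_ring QG (E x x) \<simeq> fixed_field G H K)"
proof -
  interpret normal_basis_pair G H K y \<zeta> \<phi> T1 w bs
    using assms by (intro normal_basis_pair.intro untwisted_shoda_pair.intro shoda_pair.intro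
        rat_group_algebra.intro rat_group_algebra_axioms.intro shoda_pair_axioms.intro
        untwisted_shoda_pair_axioms.intro normal_basis_pair_axioms.intro) simp_all
  have T2: "transversal G (carrier G) (normalizer G K) T2"
    using assms by simp
  show ?thesis
    using matrix_units[OF T2, of E] assms by simp
qed

end
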